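(* Let $A\in\mathcal{M}(\lambda,\Lambda)$ for some $\lambda,\Lambda>0$ and suppose that $A$ satisfies the Cordes condition with constant $\delta\in(0,1]$. Let $\gamma:=\frac{\mathrm{tr}(A)}{|A|^2}\in L^\infty_{\mathrm{per}}(Y)$ and let $\tilde r\in L^2_{\mathrm{per}}(Y)$ denote the invariant measure to $\tilde A:=\gamma A$. Let $b_0(\varphi_1,\varphi_2):=(\gamma A:D^2\varphi_1,\Delta\varphi_2)_{L^2(Y)}$ for $\varphi_1,\varphi_2\in H^2_{\mathrm{per}}(Y)$, let $C_\delta:=(1-\sqrt{1-\delta})^{-1}$, and let $\Psi_h\subset H^2_{\mathrm{per},0}(Y)$ be a closed linear subspace of $H^2_{\mathrm{per},0}(Y)$. Then there exists a unique $\psi_h\in\Psi_h$ such that $$b_0(\varphi_h,\psi_h)=(\gamma,A:D^2\varphi_h)_{L^2(Y)}\qquad\forall\varphi_h\in\Psi_h.$$ Further, setting $\tilde r_h:=1-\Delta\psi_h\in L^2_{\mathrm{per}}(Y)$, we have that $$\|\tilde r-\tilde r_h\|_{L^2(Y)}=\|\Delta(\psi-\psi_h)\|_{L^2(Y)}\le\sqrt{n}\,\frac{\Lambda}{\lambda}C_\delta\inf_{\varphi_h\in\Psi_h}\|\Delta(\psi-\varphi_h)\|_{L^2(Y)},$$ where $\psi$ denotes the unique element in $H^2_{\mathrm{per},0}(Y)$ satisfying $b_0(\varphi,\psi)=(\gamma,A:D^2\varphi)_{L^2(Y)}$ for all $\varphi\in H^2_{\mathrm{per},0}(Y)$.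
   Context: $Y:=(0,1)^n$; "$Y$-periodic" means $\mathbb{Z}^n$-periodic. For $\lambda,\Lambda>0$, $\mathcal{M}(\lambda,\Lambda)$ denotes the set of all $Y$-periodic $A\in L^\infty(\mathbb{R}^n;\mathbb{R}^{n\times n}_{\mathrm{sym}})$ such that $\lambda|\xi|^2\le A\xi\cdot\xi\le\Lambda|\xi|^2$ a.e. in $\mathbb{R}^n$ for all $\xi\in\mathbb{R}^n\setminus\{0\}$. For matrices, $P:Q:=\sum_{i,j}p_{ij}q_{ij}$ and $|P|:=\sqrt{P:P}$. $A$ satisfies the Cordes condition with constant $\delta\in(0,1]$ if $\frac{|A|^2}{(\mathrm{tr}(A))^2}\le\frac{1}{n-1+\delta}$ a.e. in $\mathbb{R}^n$. $L^2_{\mathrm{per}}(Y)$, $L^\infty_{\mathrm{per}}(Y)$, $H^k_{\mathrm{per}}(Y)$ are the usual spaces of $Y$-periodic functions, and $H^k_{\mathrm{per},0}(Y):=\{\varphi\in H^k_{\mathrm{per}}(Y):\int_Y\varphi=0\}$. The invariant measure to $\tilde A$ is the function $\tilde r\in L^2_{\mathrm{per}}(Y)$ with $\int_Y\tilde r=1$ and $(\tilde r,-\tilde A:D^2\varphi)_{L^2(Y)}=0$ for all $\varphi\in H^2_{\mathrm{per}}(Y)$; under these assumptions it exists and is unique, as does $\psi$. *)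

theory Defs
  imports "HOL-Analysis.Analysis"
begin

text \<open>
  Elements of $L^2$, $L^\infty$ and $H^k$ are represented by functions defined on all of
  $\mathbb{R}^n$ (\<open>n = CARD('n)\<close>).  Functions are identified almost everywhere:
  all sets of functions below are closed under a.e. equality, and uniqueness is uniqueness
  up to a.e. equality.
\<close>

definition unit_cell :: "(real^'n) set" where
  "unit_cell = box 0 1"

definition int_lattice :: "(real^'n) set" where
  "int_lattice = {z. \<forall>i. z $ i \<in> \<int>}"

definition ae_periodic :: "(real^'n \<Rightarrow> 'b) \<Rightarrow> bool" where
  "ae_periodic f \<longleftrightarrow> (\<forall>z\<in>int_lattice. AE x in lebesgue. f (x + z) = f x)"

definition ex1_AE :: "(real^'n \<Rightarrow> real) set \<Rightarrow> ((real^'n \<Rightarrow> real) \<Rightarrow> bool) \<Rightarrow> bool" where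
  "ex1_AE S P \<longleftrightarrow>
     (\<exists>v\<in>S. P v \<and> (\<forall>w\<in>S. P w \<longrightarrow> (AE x in lebesgue. w x = v x)))"


section \<open>Periodic Lebesgue spaces\<close>

definition Linf_per :: "(real^'n \<Rightarrow> 'b::real_normed_vector) set" where
  "Linf_per = {f. f \<in> borel_measurable lebesgue \<and> ae_periodic f \<and>
                  (\<exists>C. AE x in lebesgue. norm (f x) \<le> C)}"

definition L2_per :: "(real^'n \<Rightarrow> real) set" where
  "L2_per = {f. f \<in> borel_measurable lebesgue \<and> ae_periodic f \<and>
                set_integrable lebesgue unit_cell (\<lambda>x. (f x)\<^sup>2)}"

definition L2_inner :: "(real^'n \<Rightarrow> real) \<Rightarrow> (real^'n \<Rightarrow> real) \<Rightarrow> real" where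
  "L2_inner f g = (LINT x:unit_cell|lebesgue. f x * g x)"

definition L2_norm :: "(real^'n \<Rightarrow> real) \<Rightarrow> real" where
  "L2_norm f = sqrt (L2_inner f f)"


section \<open>Periodic Sobolev spaces\<close>

definition partial_deriv :: "'n \<Rightarrow> (real^'n \<Rightarrow> real) \<Rightarrow> real^'n \<Rightarrow> real" where
  "partial_deriv i f x = frechet_derivative f (at x) (axis i 1)"

primrec Ck :: "nat \<Rightarrow> (real^'n \<Rightarrow> real) set" where
  "Ck 0 = {f. continuous_on UNIV f}"
| "Ck (Suc k) = {f. (\<forall>x. f differentiable (at x)) \<and> (\<forall>i. partial_deriv i f \<in> Ck k)}"

definition Cinf_per :: "(real^'n \<Rightarrow> real) set" where
  "Cinf_per = {f. (\<forall>k. f \<in> Ck k) \<and> (\<forall>z\<in>int_lattice. \<forall>x. f (x + z) = f x)}"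

text \<open>
  Weak derivatives are tested against smooth periodic functions, not only against functions
  with compact support in the open cell.  This is differentiation in the sense of distributions
  on the torus, so that for periodic functions it agrees with weak differentiation on
  $\mathbb{R}^n$ (no jumps across cell faces).
\<close>

definition has_weak_deriv :: "'n \<Rightarrow> (real^'n \<Rightarrow> real) \<Rightarrow> (real^'n \<Rightarrow> real) \<Rightarrow> bool" where
  "has_weak_deriv i v g \<longleftrightarrow>
     (\<forall>\<eta>\<in>Cinf_per. L2_inner v (partial_deriv i \<eta>) = - L2_inner g \<eta>)"

primrec H_per :: "nat \<Rightarrow> (real^'n \<Rightarrow> real) set" where
  "H_per 0 = L2_per"
| "H_per (Suc k) = {v \<in> L2_per. \<forall>i. \<exists>g\<in>H_per k. has_weak_deriv i v g}"

definition H_per0 :: "nat \<Rightarrow> (real^'n \<Rightarrow> real) set" where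
  "H_per0 k = {v \<in> H_per k. (LINT x:unit_cell|lebesgue. v x) = 0}"

text \<open>
  The weak derivative is determined up to a.e. equality; the choice operator picks an
  arbitrary representative.
\<close>

definition weak_deriv :: "'n \<Rightarrow> (real^'n \<Rightarrow> real) \<Rightarrow> real^'n \<Rightarrow> real" where
  "weak_deriv i v = (SOME g. g \<in> L2_per \<and> has_weak_deriv i v g)"

definition hessian :: "(real^'n \<Rightarrow> real) \<Rightarrow> real^'n \<Rightarrow> real^'n^'n" where
  "hessian v x = (\<chi> i j. weak_deriv i (weak_deriv j v) x)"

definition laplacian :: "(real^'n \<Rightarrow> real) \<Rightarrow> real^'n \<Rightarrow> real" where
  "laplacian v x = (\<Sum>i\<in>UNIV. weak_deriv i (weak_deriv i v) x)"

definition H2_norm :: "(real^'n \<Rightarrow> real) \<Rightarrow> real" where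
  "H2_norm v = sqrt ((L2_norm v)\<^sup>2 + (\<Sum>i\<in>UNIV. (L2_norm (weak_deriv i v))\<^sup>2)
                 + (\<Sum>i\<in>UNIV. \<Sum>j\<in>UNIV. (L2_norm (weak_deriv i (weak_deriv j v)))\<^sup>2))"

definition closed_subspace_H2_per0 :: "(real^'n \<Rightarrow> real) set \<Rightarrow> bool" where
  "closed_subspace_H2_per0 \<Psi> \<longleftrightarrow>
     \<Psi> \<subseteq> H_per0 2 \<and>
     (\<lambda>x. 0) \<in> \<Psi> \<and>
     (\<forall>u\<in>\<Psi>. \<forall>v\<in>\<Psi>. (\<lambda>x. u x + v x) \<in> \<Psi>) \<and>
     (\<forall>c. \<forall>v\<in>\<Psi>. (\<lambda>x. c * v x) \<in> \<Psi>) \<and>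
     (\<forall>u v. (\<forall>k::nat. u k \<in> \<Psi>) \<and> v \<in> H_per0 2 \<and>
            (\<lambda>k. H2_norm (\<lambda>x. u k x - v x)) \<longlonglongrightarrow> 0 \<longrightarrow> v \<in> \<Psi>)"


section \<open>Coefficients\<close>

text \<open>
  The inner product and norm of the type \<open>real^'n^'n\<close> are $P:Q$ and the associated
  (Frobenius) norm $|P|$.
\<close>

lemma matrix_inner_eq: "P \<bullet> Q = (\<Sum>i\<in>UNIV. \<Sum>j\<in>UNIV. P $ i $ j * Q $ i $ j)"
  for P Q :: "real^'n^'n"
  by (simp add: inner_vec_def)

lemma matrix_norm_eq: "norm P = sqrt (P \<bullet> P)" for P :: "real^'n^'n"
  by (rule norm_eq_sqrt_inner)

definition elliptic_coeffs :: "real \<Rightarrow> real \<Rightarrow> (real^'n \<Rightarrow> real^'n^'n) set" where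
  "elliptic_coeffs lam Lam =
     {A \<in> Linf_per. (AE x in lebesgue. transpose (A x) = A x) \<and>
        (\<forall>\<xi>. \<xi> \<noteq> 0 \<longrightarrow>
           (AE x in lebesgue. lam * (norm \<xi>)\<^sup>2 \<le> (A x *v \<xi>) \<bullet> \<xi> \<and>
                              (A x *v \<xi>) \<bullet> \<xi> \<le> Lam * (norm \<xi>)\<^sup>2))}"

definition cordes :: "real \<Rightarrow> (real^'n \<Rightarrow> real^'n^'n) \<Rightarrow> bool" where
  "cordes \<delta> A \<longleftrightarrow>
     (AE x in lebesgue. (norm (A x))\<^sup>2 / (trace (A x))\<^sup>2 \<le> 1 / (real CARD('n) - 1 + \<delta>))"

definition cordes_const :: "real \<Rightarrow> real" where
  "cordes_const \<delta> = inverse (1 - sqrt (1 - \<delta>))"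

definition renorm :: "(real^'n \<Rightarrow> real^'n^'n) \<Rightarrow> real^'n \<Rightarrow> real" where
  "renorm A x = trace (A x) / (norm (A x))\<^sup>2"

definition invariant_measure :: "(real^'n \<Rightarrow> real^'n^'n) \<Rightarrow> (real^'n \<Rightarrow> real) \<Rightarrow> bool" where
  "invariant_measure B r \<longleftrightarrow>
     r \<in> L2_per \<and> (LINT x:unit_cell|lebesgue. r x) = 1 \<and>
     (\<forall>\<phi>\<in>H_per 2. L2_inner r (\<lambda>x. (- B x) \<bullet> hessian \<phi> x) = 0)"

definition b0 :: "(real^'n \<Rightarrow> real^'n^'n) \<Rightarrow> (real^'n \<Rightarrow> real) \<Rightarrow> (real^'n \<Rightarrow> real) \<Rightarrow> real" where
  "b0 A \<phi>\<^sub>1 \<phi>\<^sub>2 =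
     L2_inner (\<lambda>x. (renorm A x *\<^sub>R A x) \<bullet> hessian \<phi>\<^sub>1 x) (laplacian \<phi>\<^sub>2)"

text \<open>The test space is an argument: it is a subspace for the discrete problem, and all of
  \<open>H_per0 2\<close> for the continuous one.\<close>

definition solves_dual :: "(real^'n \<Rightarrow> real^'n^'n) \<Rightarrow> (real^'n \<Rightarrow> real) set \<Rightarrow> (real^'n \<Rightarrow> real) \<Rightarrow> bool" where
  "solves_dual A V \<psi> \<longleftrightarrow>
     (\<forall>\<phi>\<in>V. b0 A \<phi> \<psi> = L2_inner (renorm A) (\<lambda>x. A x \<bullet> hessian \<phi> x))"

end

theory Submission
  imports Defs
begin

text \<open>
  Measure every function of $H^2_{\mathrm{per},0}$ by its Laplacian.  On the torus
  $\|D^2\varphi\| = \|\Delta\varphi\|$, and for a matrix $P$ of positive trace the Cordes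
  condition says precisely that the renormalised matrix $(\mathrm{tr} P/|P|^2) P$ has Frobenius
  distance at most $\sqrt{1-\delta}$ from the identity (\<open>cordes_near_identity\<close>).  Since
  $\Delta\varphi = I : D^2\varphi$, the two facts together give
  $\|\gamma A : D^2\varphi - \Delta\varphi\| \le \sqrt{1-\delta}\,\|\Delta\varphi\|$: seen as a map
  from $\Delta\varphi$ to $\gamma A : D^2\varphi$, the operator is a perturbation of the identity of
  $L^2$ by a contraction.

  The theorem is then a statement about a Hilbert space and a linear graph $G$ of pairs $(d,t)$
  with $\|t-d\| \le q\|d\|$, $q<1$.  The dual problem asks for $w$ among the first components with
  $\langle t,w\rangle = \langle t,y\rangle$ for all $(d,t) \in G$.  It is solvable by the Riesz
  representation and a contraction argument (\<open>galerkin_dual_unique_solution\<close>), coercivity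
  with constant $1-q$ makes the solution unique, and Galerkin orthogonality gives Cea's estimate
  (\<open>galerkin_dual_quasi_optimal\<close>).  The continuity constant is the bound
  $|\gamma A| = \mathrm{tr} A/|A| \le \sqrt n$, and $\lambda \le \Lambda$ turns the constant
  $\sqrt n\,C_\delta$ into that of the theorem.

  Completeness of the space of Laplacians and the link with the invariant measure need two facts
  about the torus.  The Laplacian maps $H^2_{\mathrm{per},0}$ onto the functions of mean zero
  (\<open>poisson_solvable\<close>), and $\|\Delta v\|$ controls the whole $H^2$ norm there
  (\<open>H2_norm_le_laplacian\<close>).  Consequently the invariant measure, whose mean is $1$, has
  the form $1-\Delta\psi$, and its defining equation becomes the dual problem for $\psi$ with
  $y = 1$ (\<open>invariant_measure_iff_dual\<close>).

  All of this harmonic analysis is done in the Hartley system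
  $\mathrm{cas}_k(x) = \cos(2\pi k\cdot x) + \sin(2\pi k\cdot x)$, $k \in \mathbb{Z}^n$.  It is an
  orthonormal basis of the \<^emph>\<open>real\<close> space $L^2$, so that no complex coefficients and no pairing of
  $k$ with $-k$ are needed, and $\partial_i \mathrm{cas}_k = 2\pi k_i\,\mathrm{cas}_{-k}$.  In
  coefficients a weak derivative is therefore multiplication by $-2\pi k_i$ combined with the reflection
  $k \mapsto -k$ (\<open>has_weak_deriv_iff_hat\<close>), and the Laplacian is multiplication by
  $-4\pi^2|k|^2$.
\<close>

section \<open>Near-identity operators in a Hilbert space\<close>

text \<open>The first-order condition at a minimum, used below for the variation of a quadratic functional.\<close>

lemma linear_coefficient_of_nonneg_quadratic:
  fixes d a :: real
  assumes "\<And>t. 0 \<le> 2 * t * d + t\<^sup>2 * a"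
  shows "d = 0"
proof (rule ccontr)
  assume "d \<noteq> 0"
  define t where "t = - d / (\<bar>a\<bar> + 1)"
  have t: "t * (\<bar>a\<bar> + 1) = - d" by (simp add: t_def)
  have "t\<^sup>2 * a \<le> t\<^sup>2 * (\<bar>a\<bar> + 1)" by (intro mult_left_mono) auto
  also have "\<dots> = t * (t * (\<bar>a\<bar> + 1))" by (simp add: power2_eq_square)
  also have "\<dots> = - (t * d)" unfolding t by simp
  finally have "0 \<le> t * d" using assms[of t] by linarith
  moreover have "t * d = - (d\<^sup>2 / (\<bar>a\<bar> + 1))" by (simp add: t_def power2_eq_square)
  moreover have "d\<^sup>2 / (\<bar>a\<bar> + 1) > 0" using \<open>d \<noteq> 0\<close> by (intro divide_pos_pos) auto
  ultimately show False by linarith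
qed

text \<open>The representing vector minimises $J(u) = \|u\|^2 - 2\,l(u)$ on $S$: by the parallelogram law a
  minimising sequence is Cauchy, and the first variation of $J$ at the minimum is the claim.\<close>

lemma riesz_representation_on_complete_subspace:
  fixes S :: "'a::real_inner set" and l :: "'a \<Rightarrow> real"
  assumes S: "subspace S" "complete S"
    and add: "\<And>u v. u \<in> S \<Longrightarrow> v \<in> S \<Longrightarrow> l (u + v) = l u + l v"
    and scale: "\<And>c u. u \<in> S \<Longrightarrow> l (c *\<^sub>R u) = c * l u"
    and bound: "\<And>u. u \<in> S \<Longrightarrow> \<bar>l u\<bar> \<le> C * norm u"
  shows "\<exists>w\<in>S. \<forall>u\<in>S. l u = u \<bullet> w"
proof -
  define J where "J u = u \<bullet> u - 2 * l u" for u
  have diff: "l (u - v) = l u - l v" if "u \<in> S" "v \<in> S" for u v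
    using add[of u "- 1 *\<^sub>R v"] scale[of v "-1"] that S(1) by (simp add: subspace_neg)
  have lower: "J u \<ge> - C\<^sup>2" if "u \<in> S" for u
  proof -
    have "0 \<le> (norm u - C)\<^sup>2" by simp
    then show ?thesis
      using bound[OF that] unfolding J_def power2_norm_eq_inner[symmetric]
      by (simp add: power2_eq_square algebra_simps)
  qed
  define m where "m = (INF u\<in>S. J u)"
  have bdd: "bdd_below (J ` S)" using lower by (auto intro!: bdd_belowI)
  have ne: "S \<noteq> {}" using subspace_0[OF S(1)] by auto
  have m_le: "m \<le> J u" if "u \<in> S" for u
    unfolding m_def using that bdd by (rule cINF_lower[rotated])
  have "\<exists>u\<in>S. J u < m + inverse (real (Suc k))" for k
    using cINF_less_iff[OF ne bdd, of "m + inverse (real (Suc k))"] by (auto simp: m_def)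
  then obtain u where u: "\<And>k. u k \<in> S" "\<And>k. J (u k) < m + inverse (real (Suc k))" by metis
  have parallelogram: "(norm (a - b))\<^sup>2 \<le> 2 * (J a - m) + 2 * (J b - m)" if "a \<in> S" "b \<in> S" for a b
  proof -
    \<comment> \<open>the midpoint of $a$ and $b$ lies in $S$, so $J$ is at least $m$ there\<close>
    let ?h = "(1/2) *\<^sub>R (a + b)"
    have h: "?h \<in> S" using that S(1) by (intro subspace_scale subspace_add) auto
    have "l ?h = (l a + l b) / 2"
      using that S(1) by (subst scale) (auto simp: subspace_add add)
    then have "4 * J ?h = (norm (a + b))\<^sup>2 - 4 * (l a + l b)"
      by (simp add: J_def power2_norm_eq_inner)
    moreover have "(norm (a + b))\<^sup>2 + (norm (a - b))\<^sup>2 = 2 * (a \<bullet> a) + 2 * (b \<bullet> b)"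
      by (simp add: power2_norm_eq_inner algebra_simps inner_commute)
    ultimately show ?thesis using m_le[OF h] by (simp add: J_def algebra_simps)
  qed
  define r where "r k = inverse (real (Suc k))" for k
  have "Cauchy u"
  proof (rule metric_CauchyI)
    fix e :: real assume "e > 0"
    then obtain N where N: "inverse (real (Suc N)) < e\<^sup>2 / 4"
      using reals_Archimedean[of "e\<^sup>2/4"] by auto
    have "dist (u i) (u j) < e" if "i \<ge> N" "j \<ge> N" for i j
    proof -
      have "inverse (real (Suc i)) \<le> inverse (real (Suc N))" "inverse (real (Suc j)) \<le> inverse (real (Suc N))"
        using that by auto
      then have "r i \<le> r N" "r j \<le> r N" unfolding r_def by auto
      then have "(norm (u i - u j))\<^sup>2 < e\<^sup>2"
        using parallelogram[OF u(1) u(1), of i j] u(2)[of i] u(2)[of j] N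
        unfolding r_def[symmetric] by argo
      then show ?thesis using \<open>e > 0\<close> by (simp add: dist_norm power_less_imp_less_base)
    qed
    then show "\<exists>M. \<forall>m\<ge>M. \<forall>n\<ge>M. dist (u m) (u n) < e" by blast
  qed
  then obtain w where w: "w \<in> S" "u \<longlonglongrightarrow> w"
    using S(2) u(1) unfolding complete_def by blast
  have "(\<lambda>k. l (u k) - l w) \<longlonglongrightarrow> 0"
  proof (rule Lim_null_comparison)
    show "\<forall>\<^sub>F k in sequentially. norm (l (u k) - l w) \<le> C * norm (u k - w)"
      using bound u(1) w(1) S(1) by (auto simp: diff[symmetric] subspace_diff)
    show "(\<lambda>k. C * norm (u k - w)) \<longlonglongrightarrow> 0"
      using w(2) by (auto intro!: tendsto_eq_intros simp: LIM_zero)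
  qed
  then have "(\<lambda>k. l (u k)) \<longlonglongrightarrow> l w" by (simp add: LIM_zero_iff)
  then have "(\<lambda>k. J (u k)) \<longlonglongrightarrow> J w"
    unfolding J_def using w(2) by (intro tendsto_intros)
  moreover have "(\<lambda>k. m + inverse (real (Suc k))) \<longlonglongrightarrow> m + 0"
    by (intro tendsto_intros LIMSEQ_inverse_real_of_nat)
  ultimately have Jw: "J w \<le> m"
    using u(2) by (force intro: LIMSEQ_le less_imp_le)
  \<comment> \<open>$J(w + t v) - J(w)$ is a quadratic polynomial in $t$ without negative values\<close>
  have "l v = v \<bullet> w" if v: "v \<in> S" for v
  proof -
    let ?d = "v \<bullet> w - l v"
    have *: "0 \<le> 2 * t * ?d + t\<^sup>2 * (v \<bullet> v)" for t
    proof -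
      have "w + t *\<^sub>R v \<in> S" using v w(1) S(1) by (intro subspace_add subspace_scale) auto
      from m_le[OF this] Jw have "J w \<le> J (w + t *\<^sub>R v)" by simp
      moreover have "l (w + t *\<^sub>R v) = l w + t * l v"
        using v w(1) S(1) by (simp add: add scale subspace_scale)
      ultimately show ?thesis
        by (simp add: J_def algebra_simps power2_eq_square inner_commute)
    qed
    have "?d = 0"
      by (rule linear_coefficient_of_nonneg_quadratic) (rule *)
    then show ?thesis by simp
  qed
  then show ?thesis using w(1) by blast
qed

text \<open>Coercivity of the form $(d, w) \mapsto \langle t, w\rangle$ on a graph of pairs $(d,t)$, from
  $\langle t, d\rangle = \|d\|^2 + \langle t - d, d\rangle$.\<close>

lemma near_identity_graph_coercive:
  fixes G :: "('a::real_inner \<times> 'a) set"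
  assumes "(d, t) \<in> G" and near: "\<And>d t. (d, t) \<in> G \<Longrightarrow> norm (t - d) \<le> q * norm d"
  shows "(1 - q) * (norm d)\<^sup>2 \<le> t \<bullet> d"
proof -
  have "d \<bullet> d - t \<bullet> d \<le> norm (t - d) * norm d"
    using norm_cauchy_schwarz[of "d - t" d] by (simp add: inner_diff_left norm_minus_commute)
  also have "\<dots> \<le> (q * norm d) * norm d"
    by (intro mult_right_mono near assms) auto
  finally show ?thesis by (simp add: power2_norm_eq_inner[symmetric] power2_eq_square algebra_simps)
qed

text \<open>A Lax-Milgram theorem for the transposed problem.  The relation is a graph: two second components
  over the same $d$ differ by a $t$ with $(0,t) \in G$, and then $\|t\| \le q\|0\|$.  Writing $S$ for
  its function, the equation $\langle S u, w\rangle = \langle S u, y\rangle$ is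
  $\langle u, w\rangle = \langle S u, y\rangle - \langle S u - u, w\rangle$; for given $w$ the
  right-hand side is a bounded functional of $u$, and its Riesz vector depends on $w$ with Lipschitz
  constant $q$.  The solution is the fixed point.\<close>

lemma galerkin_dual_unique_solution:
  fixes G :: "('a::real_inner \<times> 'a) set"
  assumes G: "subspace G" and compl: "complete (fst ` G)"
    and q: "0 \<le> q" "q < 1"
    and near: "\<And>d t. (d, t) \<in> G \<Longrightarrow> norm (t - d) \<le> q * norm d"
  shows "\<exists>!w. w \<in> fst ` G \<and> (\<forall>(d, t)\<in>G. t \<bullet> w = t \<bullet> y)"
proof (rule ex_ex1I)
  let ?W = "fst ` G"
  have W: "subspace ?W"
    using linear_subspace_image[OF linear_fst G] .
  have "\<forall>d\<in>?W. \<exists>t. (d, t) \<in> G" by auto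
  then obtain S where S: "\<And>d. d \<in> ?W \<Longrightarrow> (d, S d) \<in> G" by metis
  have S_eq: "t = S d" if "(d, t) \<in> G" for d t
  proof -
    have "(d, S d) \<in> G" using that S by force
    from subspace_diff[OF G that this] have "(0, t - S d) \<in> G" by simp
    from near[OF this] show ?thesis by simp
  qed
  have S_add: "S (u + v) = S u + S v" if "u \<in> ?W" "v \<in> ?W" for u v
    using subspace_add[OF G S[OF that(1)] S[OF that(2)]] by (auto dest: S_eq)
  have S_scale: "S (c *\<^sub>R u) = c *\<^sub>R S u" if "u \<in> ?W" for c u
    using subspace_scale[OF G S[OF that], of c] by (auto dest: S_eq)
  have S_near: "norm (S u - u) \<le> q * norm u" if "u \<in> ?W" for u
    using near[OF S[OF that]] .
  have "\<forall>w\<in>?W. \<exists>w'\<in>?W. \<forall>u\<in>?W. S u \<bullet> y - (S u - u) \<bullet> w = u \<bullet> w'"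
  proof
    fix w assume "w \<in> ?W"
    show "\<exists>w'\<in>?W. \<forall>u\<in>?W. S u \<bullet> y - (S u - u) \<bullet> w = u \<bullet> w'"
    proof (rule riesz_representation_on_complete_subspace[OF W compl])
      fix u assume u: "u \<in> ?W"
      have "\<bar>S u \<bullet> y - (S u - u) \<bullet> w\<bar> \<le> \<bar>u \<bullet> y\<bar> + \<bar>(S u - u) \<bullet> y\<bar> + \<bar>(S u - u) \<bullet> w\<bar>"
        by (simp add: inner_diff_left)
      also have "\<dots> \<le> norm u * norm y + (q * norm u) * norm y + (q * norm u) * norm w"
        by (intro add_mono order_trans[OF Cauchy_Schwarz_ineq2] mult_right_mono S_near u) auto
      finally show "\<bar>S u \<bullet> y - (S u - u) \<bullet> w\<bar> \<le> (norm y + q * norm y + q * norm w) * norm u"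
        by (simp add: algebra_simps)
    qed (auto simp: S_add S_scale inner_add_left inner_diff_left algebra_simps)
  qed
  then obtain F where F: "\<And>w. w \<in> ?W \<Longrightarrow> F w \<in> ?W"
    "\<And>w u. w \<in> ?W \<Longrightarrow> u \<in> ?W \<Longrightarrow> S u \<bullet> y - (S u - u) \<bullet> w = u \<bullet> F w" by metis
  have "\<exists>!w\<in>?W. F w = w"
  proof (rule Banach_fix[OF compl _ q])
    show "?W \<noteq> {}" using subspace_0[OF W] by auto
    show "F ` ?W \<subseteq> ?W" using F(1) by auto
    fix v w assume vw: "v \<in> ?W" "w \<in> ?W"
    let ?e = "F v - F w"
    have e: "?e \<in> ?W" by (rule subspace_diff[OF W F(1)[OF vw(1)] F(1)[OF vw(2)]])
    have "?e \<bullet> ?e = (S ?e - ?e) \<bullet> (w - v)"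
      using F(2)[OF vw(1) e] F(2)[OF vw(2) e] inner_diff_right[of ?e "F v" "F w"]
        inner_diff_right[of "S ?e - ?e" w v] by linarith
    also have "\<dots> \<le> norm (S ?e - ?e) * norm (w - v)" by (rule norm_cauchy_schwarz)
    also have "\<dots> \<le> (q * norm ?e) * norm (w - v)" by (intro mult_right_mono S_near e) auto
    also have "norm (w - v) = norm (v - w)" by (rule norm_minus_commute)
    also have "?e \<bullet> ?e = norm ?e * norm ?e" by (metis power2_norm_eq_inner power2_eq_square)
    finally have "norm ?e * norm ?e \<le> norm ?e * (q * norm (v - w))" by (simp only: ac_simps)
    then show "dist (F v) (F w) \<le> q * dist v w"
      using q by (cases "?e = 0") (auto simp: dist_norm)
  qed
  then obtain w where w: "w \<in> ?W" "F w = w" by blast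
  have "t \<bullet> w = t \<bullet> y" if "(d, t) \<in> G" for d t
  proof -
    have "d \<in> ?W" using that by force
    from F(2)[OF w(1) this] show ?thesis
      unfolding S_eq[OF that] w(2) by (simp add: inner_diff_left)
  qed
  then show "\<exists>w. w \<in> ?W \<and> (\<forall>(d, t)\<in>G. t \<bullet> w = t \<bullet> y)" using w(1) by blast
next
  fix v w assume v: "v \<in> fst ` G \<and> (\<forall>(d, t)\<in>G. t \<bullet> v = t \<bullet> y)"
    and w: "w \<in> fst ` G \<and> (\<forall>(d, t)\<in>G. t \<bullet> w = t \<bullet> y)"
  then obtain s t where st: "(v, s) \<in> G" "(w, t) \<in> G" by auto
  from subspace_diff[OF G this] have "(v - w, s - t) \<in> G" by simp
  moreover from this have "(s - t) \<bullet> (v - w) = 0" using v w by (fastforce simp: inner_diff_right)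
  ultimately have "(1 - q) * (norm (v - w))\<^sup>2 \<le> 0"
    using near_identity_graph_coercive[of "v - w" "s - t" G q] near by simp
  then show "v = w" using q by (simp add: mult_le_0_iff)
qed

text \<open>Cea's argument.  Both solutions satisfy the equations with test pairs from $G$, so in the coercivity
  estimate for $w - w_h$ the approximation $w_h$ in the test slot can be replaced by any other first
  component $v$ of $G$.\<close>

lemma galerkin_dual_quasi_optimal:
  fixes G V :: "('a::real_inner \<times> 'a) set"
  assumes V: "subspace V" and GV: "G \<subseteq> V"
    and near: "\<And>d t. (d, t) \<in> V \<Longrightarrow> norm (t - d) \<le> q * norm d"
    and bound: "\<And>d t. (d, t) \<in> V \<Longrightarrow> norm t \<le> M * norm d"
    and w: "w \<in> fst ` V" "\<And>d t. (d, t) \<in> V \<Longrightarrow> t \<bullet> w = t \<bullet> y"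
    and wh: "wh \<in> fst ` G" "\<And>d t. (d, t) \<in> G \<Longrightarrow> t \<bullet> wh = t \<bullet> y"
    and v: "v \<in> fst ` G"
  shows "(1 - q) * norm (w - wh) \<le> M * norm (w - v)"
proof -
  obtain s where s: "(w, s) \<in> V" using w by auto
  obtain sh where sh: "(wh, sh) \<in> G" using wh by auto
  obtain r where r: "(v, r) \<in> G" using v by auto
  let ?e = "w - wh"
  have "(?e, s - sh) \<in> V" using subspace_diff[OF V s, of "(wh, sh)"] sh GV by auto
  from near_identity_graph_coercive[OF this near]
  have "(1 - q) * (norm ?e)\<^sup>2 \<le> (s - sh) \<bullet> ?e" by auto
  also have "\<dots> = (s - r) \<bullet> ?e"
  proof -
    have "r \<bullet> w = r \<bullet> y" "r \<bullet> wh = r \<bullet> y" "sh \<bullet> w = sh \<bullet> y" "sh \<bullet> wh = sh \<bullet> y"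
      using w(2) wh(2) r sh GV by blast+
    then show ?thesis by (simp add: inner_diff_left inner_diff_right)
  qed
  also have "\<dots> \<le> norm (s - r) * norm ?e" by (rule norm_cauchy_schwarz)
  also have "\<dots> \<le> (M * norm (w - v)) * norm ?e"
    using subspace_diff[OF V s, of "(v, r)"] r GV by (intro mult_right_mono bound) auto
  finally have "norm ?e * ((1 - q) * norm ?e) \<le> norm ?e * (M * norm (w - v))"
    by (simp add: power2_eq_square ac_simps)
  moreover have "0 \<le> M * norm (w - v)"
    using bound[of "w - v" "s - r"] subspace_diff[OF V s, of "(v, r)"] r GV
    by (auto intro: order_trans[OF norm_ge_zero])
  ultimately show ?thesis by (cases "?e = 0") auto
qed

section \<open>Orthonormal systems\<close>

definition orthonormal_on :: "'i set \<Rightarrow> ('i \<Rightarrow> 'a::real_inner) \<Rightarrow> bool" where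
  "orthonormal_on I e \<longleftrightarrow> (\<forall>i\<in>I. \<forall>j\<in>I. e i \<bullet> e j = (if i = j then 1 else 0))"

lemma orthonormal_sum_inner:
  assumes "orthonormal_on I e" "finite F" "F \<subseteq> I" "j \<in> I"
  shows "(\<Sum>i\<in>F. a i *\<^sub>R e i) \<bullet> e j = (if j \<in> F then a j else 0)"
proof -
  have "(\<Sum>i\<in>F. a i *\<^sub>R e i) \<bullet> e j = (\<Sum>i\<in>F. if i = j then a i else 0)"
    unfolding inner_sum_left using assms by (intro sum.cong) (auto simp: orthonormal_on_def)
  then show ?thesis using assms(2) by simp
qed

lemma orthonormal_sum_norm:
  assumes "orthonormal_on I e" "finite F" "F \<subseteq> I"
  shows "(norm (\<Sum>i\<in>F. a i *\<^sub>R e i))\<^sup>2 = (\<Sum>i\<in>F. (a i)\<^sup>2)"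
proof -
  have "(\<Sum>i\<in>F. a i *\<^sub>R e i) \<bullet> (a j *\<^sub>R e j) = (a j)\<^sup>2" if "j \<in> F" for j
    using orthonormal_sum_inner[OF assms, of j a] that assms by (auto simp: power2_eq_square)
  then show ?thesis by (simp add: power2_norm_eq_inner inner_sum_right)
qed

lemma bessel_summable:
  fixes e :: "'i \<Rightarrow> 'a::real_inner"
  assumes "orthonormal_on I e"
  shows "(\<lambda>i. (x \<bullet> e i)\<^sup>2) summable_on I"
proof (rule nonneg_bdd_above_summable_on)
  show "bdd_above (sum (\<lambda>i. (x \<bullet> e i)\<^sup>2) ` {F. F \<subseteq> I \<and> finite F})"
  proof (rule bdd_aboveI2)
    fix F assume "F \<in> {F. F \<subseteq> I \<and> finite F}"
    then have F: "finite F" "F \<subseteq> I" by auto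
    let ?p = "\<Sum>i\<in>F. (x \<bullet> e i) *\<^sub>R e i"
    have "x \<bullet> ?p = (\<Sum>i\<in>F. (x \<bullet> e i)\<^sup>2)"
      by (simp add: inner_sum_right power2_eq_square)
    moreover have "?p \<bullet> ?p = (\<Sum>i\<in>F. (x \<bullet> e i)\<^sup>2)"
      using orthonormal_sum_norm[OF assms F] by (simp add: power2_norm_eq_inner)
    moreover have "0 \<le> (x - ?p) \<bullet> (x - ?p)" by simp
    ultimately show "(\<Sum>i\<in>F. (x \<bullet> e i)\<^sup>2) \<le> x \<bullet> x"
      by (simp add: inner_diff_left inner_diff_right inner_commute)
  qed
qed simp

text \<open>The finite partial sums form a Cauchy net, because the squared distance of two nested partial sums
  is a partial sum of the squared coefficients.\<close>

lemma riesz_fischer: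
  fixes e :: "'i \<Rightarrow> 'a::{real_inner, complete_space}"
  assumes on: "orthonormal_on I e" and a: "(\<lambda>i. (a i)\<^sup>2) summable_on I"
  obtains x where "((\<lambda>i. a i *\<^sub>R e i) has_sum x) I" "\<And>k. k \<in> I \<Longrightarrow> x \<bullet> e k = a k"
proof -
  let ?f = "\<lambda>i. a i *\<^sub>R e i"
  obtain s where s: "((\<lambda>i. (a i)\<^sup>2) has_sum s) I" using a summable_on_def by blast
  have "\<exists>P. eventually P (finite_subsets_at_top I) \<and>
            (\<forall>F F'. P F \<and> P F' \<longrightarrow> dist (sum ?f F) (sum ?f F') < \<epsilon>)" if "\<epsilon> > 0" for \<epsilon>
  proof -
    \<comment> \<open>partial sums of squares beyond $X$ then lie within $\epsilon^2/8 < (\epsilon/2)^2$ of each other\<close>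
    let ?d = "\<epsilon>\<^sup>2 / 16"
    have "\<forall>\<^sub>F F in finite_subsets_at_top I. dist (\<Sum>i\<in>F. (a i)\<^sup>2) s < ?d"
    proof -
      have "?d > 0" using that by simp
      then show ?thesis using s unfolding has_sum_def tendsto_iff by blast
    qed
    then obtain X where X: "finite X" "X \<subseteq> I"
      "\<And>F. finite F \<Longrightarrow> X \<subseteq> F \<Longrightarrow> F \<subseteq> I \<Longrightarrow> dist (\<Sum>i\<in>F. (a i)\<^sup>2) s < ?d"
      by (auto simp: eventually_finite_subsets_at_top)
    define P where "P F \<longleftrightarrow> finite F \<and> X \<subseteq> F \<and> F \<subseteq> I" for F
    have near: "norm (sum ?f F - sum ?f X) < \<epsilon> / 2" if "P F" for F
    proof -
      have F: "finite F" "X \<subseteq> F" "F \<subseteq> I" using that by (auto simp: P_def)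
      have "(norm (sum ?f F - sum ?f X))\<^sup>2 = (norm (sum ?f (F - X)))\<^sup>2"
        using F X by (simp add: sum_diff)
      also have "\<dots> = (\<Sum>i\<in>F - X. (a i)\<^sup>2)"
        using F by (intro orthonormal_sum_norm[OF on]) auto
      also have "\<dots> = (\<Sum>i\<in>F. (a i)\<^sup>2) - (\<Sum>i\<in>X. (a i)\<^sup>2)"
        using F X by (simp add: sum_diff)
      also have "\<dots> < (\<epsilon> / 2)\<^sup>2"
      proof -
        have "\<bar>(\<Sum>i\<in>F. (a i)\<^sup>2) - s\<bar> < ?d" "\<bar>(\<Sum>i\<in>X. (a i)\<^sup>2) - s\<bar> < ?d" "0 < \<epsilon>\<^sup>2"
          using X(3)[OF F] X(3)[of X] X(1,2) \<open>\<epsilon> > 0\<close> unfolding dist_real_def by auto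
        then have "(\<Sum>i\<in>F. (a i)\<^sup>2) - (\<Sum>i\<in>X. (a i)\<^sup>2) < \<epsilon>\<^sup>2 / 4" by linarith
        then show ?thesis by (simp add: power_divide)
      qed
      finally show ?thesis
        by (rule power_less_imp_less_base) (use \<open>\<epsilon> > 0\<close> in simp)
    qed
    have "eventually P (finite_subsets_at_top I)"
      using X(1,2) by (auto simp: P_def eventually_finite_subsets_at_top)
    moreover have "dist (sum ?f F) (sum ?f F') < \<epsilon>" if "P F" "P F'" for F F'
      using near[OF that(1)] near[OF that(2)] dist_triangle_half_l[of "sum ?f F" "sum ?f X" \<epsilon> "sum ?f F'"]
      by (simp add: dist_norm norm_minus_commute)
    ultimately show ?thesis by blast
  qed
  then have "cauchy_filter (filtermap (sum ?f) (finite_subsets_at_top I))"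
    by (simp add: cauchy_filter_metric_filtermap)
  moreover have "complete (UNIV::'a set)"
    by (meson Cauchy_convergent UNIV_I complete_def convergent_def)
  ultimately obtain x where "(sum ?f \<longlongrightarrow> x) (finite_subsets_at_top I)"
    using complete_uniform[where S=UNIV] by (force simp add: filterlim_def)
  then have x: "(?f has_sum x) I" by (simp add: has_sum_def)
  have "x \<bullet> e k = a k" if k: "k \<in> I" for k
  proof -
    have "((\<lambda>i. ?f i \<bullet> e k) has_sum (x \<bullet> e k)) I"
      by (rule has_sum_bounded_linear[OF bounded_linear_inner_left x])
    moreover have "((\<lambda>i. ?f i \<bullet> e k) has_sum a k) I"
      using on k by (intro has_sum_finite_neutralI[of "{k}"]) (auto simp: orthonormal_on_def)
    ultimately show ?thesis by (rule has_sum_unique)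
  qed
  with x show ?thesis using that by blast
qed

text \<open>Totality enters once: the element that has the coefficients of $x$ by Riesz-Fischer differs from
  $x$ by something orthogonal to the whole system.\<close>

lemma parseval:
  fixes e :: "'i \<Rightarrow> 'a::{real_inner, complete_space}"
  assumes on: "orthonormal_on I e"
    and total: "\<And>x. (\<And>i. i \<in> I \<Longrightarrow> x \<bullet> e i = 0) \<Longrightarrow> x = 0"
  shows "((\<lambda>i. (x \<bullet> e i) * (y \<bullet> e i)) has_sum (x \<bullet> y)) I"
proof -
  obtain z where z: "((\<lambda>i. (x \<bullet> e i) *\<^sub>R e i) has_sum z) I" "\<And>k. k \<in> I \<Longrightarrow> z \<bullet> e k = x \<bullet> e k"
    using riesz_fischer[OF on bessel_summable[OF on]] by blast
  have "x - z = 0" using z(2) by (intro total) (simp add: inner_diff_left)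
  then have "z = x" by simp
  have "((\<lambda>i. ((x \<bullet> e i) *\<^sub>R e i) \<bullet> y) has_sum (x \<bullet> y)) I"
    using z(1) unfolding \<open>z = x\<close> by (rule has_sum_bounded_linear[OF bounded_linear_inner_left])
  then show ?thesis by (simp add: inner_commute)
qed

section \<open>The unit cell and the lattice\<close>

abbreviation cell_lebesgue :: "(real^'n) measure" where
  "cell_lebesgue \<equiv> lebesgue_on unit_cell"

lemma unit_cell_sets [simp, measurable]: "unit_cell \<in> sets lebesgue"
  by (simp add: unit_cell_def)

lemma sets_lebesgue_Int_unit_cell: "unit_cell \<inter> space lebesgue \<in> sets lebesgue"
  by simp

lemma emeasure_unit_cell: "emeasure lebesgue (unit_cell :: (real^'n) set) = 1"
proof -
  have "(1::real^'n) \<bullet> b = 1" if "b \<in> Basis" for b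
    using that by (auto simp: Basis_vec_def inner_axis)
  then show ?thesis
    unfolding unit_cell_def by (simp add: emeasure_lborel_box_eq)
qed

lemma finite_measure_cell: "finite_measure (cell_lebesgue :: (real^'n) measure)"
  by (rule finite_measureI)
    (simp add: emeasure_restrict_space[OF sets_lebesgue_Int_unit_cell] space_restrict_space emeasure_unit_cell)

lemma measure_cell: "measure (cell_lebesgue :: (real^'n) measure) (space cell_lebesgue) = 1"
  by (simp add: emeasure_restrict_space[OF sets_lebesgue_Int_unit_cell] space_restrict_space
      measure_def emeasure_unit_cell)

lemma set_integrable_cell: "set_integrable lebesgue unit_cell f \<longleftrightarrow> integrable cell_lebesgue f"
  for f :: "real^'n \<Rightarrow> real"
  unfolding set_integrable_def using integrable_restrict_space[OF sets_lebesgue_Int_unit_cell] by blast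

lemma set_integral_cell: "(LINT x:unit_cell|lebesgue. f x) = (LINT x|cell_lebesgue. f x)"
  for f :: "real^'n \<Rightarrow> real"
  unfolding set_lebesgue_integral_def integral_restrict_space[OF sets_lebesgue_Int_unit_cell] ..

lemma L2_inner_cell: "L2_inner f g = (LINT x|cell_lebesgue. f x * g x)"
  by (simp add: L2_inner_def set_integral_cell)

lemma measurable_cell: "f \<in> borel_measurable lebesgue \<Longrightarrow> f \<in> borel_measurable cell_lebesgue"
  by (rule measurable_restrict_space1)

lemma AE_cell: "(AE x in lebesgue. P x) \<Longrightarrow> AE x in cell_lebesgue. P x"
  unfolding AE_restrict_space_iff[OF sets_lebesgue_Int_unit_cell] by (auto elim: eventually_mono)

lemma AE_lebesgue_translate:
  fixes z :: "'a::euclidean_space"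
  assumes "AE x in lebesgue. P x"
  shows "AE x in lebesgue. P (x + z)"
proof -
  obtain N where N: "negligible N" "{x. \<not> P x} \<subseteq> N"
    using assms by (auto simp: eventually_ae_filter_negligible)
  have "{x. \<not> P (x + z)} \<subseteq> (+) (- z) ` N"
  proof
    fix x assume "x \<in> {x. \<not> P (x + z)}"
    then have "x + z \<in> N" using N by auto
    then show "x \<in> (+) (- z) ` N" by (intro image_eqI[of _ _ "x + z"]) auto
  qed
  then show ?thesis
    using negligible_translation[OF N(1), of "- z"] unfolding eventually_ae_filter_negligible by blast
qed

lemma countable_int_lattice: "countable (int_lattice :: (real^'n) set)"
proof -
  have "int_lattice \<subseteq> range (\<lambda>z::int^'n. (\<chi> i. of_int (z $ i)) :: real^'n)"
  proof
    fix x :: "real^'n" assume "x \<in> int_lattice"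
    then have "x = (\<chi> i. of_int ((\<chi> i. \<lfloor>x $ i\<rfloor>) $ i))"
      by (auto simp: int_lattice_def vec_eq_iff elim!: Ints_cases)
    then show "x \<in> range (\<lambda>z::int^'n. (\<chi> i. of_int (z $ i)) :: real^'n)" by blast
  qed
  then show ?thesis by (rule countable_subset) simp
qed

lemma int_lattice_uminus: "z \<in> int_lattice \<Longrightarrow> - z \<in> int_lattice"
  by (simp add: int_lattice_def)

text \<open>The open cell and its lattice translates miss only the faces, a null set for each of countably many
  translations.\<close>

lemma AE_lattice_translate_in_cell:
  "AE x in lebesgue. \<exists>z\<in>int_lattice. x + z \<in> (unit_cell :: (real^'n) set)"
proof -
  have "AE x in lebesgue. x \<notin> cbox 0 1 - box 0 (1::real^'n)"
    using negligible_frontier_interval[of 0 "1::real^'n"]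
    unfolding eventually_ae_filter_negligible by (intro exI[of _ "cbox 0 1 - box 0 1"]) auto
  then have "AE x in lebesgue. x + z \<notin> cbox 0 1 - box 0 (1::real^'n)" for z
    by (rule AE_lebesgue_translate)
  then have "AE x in lebesgue. \<forall>z\<in>int_lattice. x + z \<notin> cbox 0 1 - box 0 (1::real^'n)"
    by (simp add: AE_ball_countable countable_int_lattice)
  then show ?thesis
  proof eventually_elim
    case (elim x)
    let ?z = "(\<chi> i. - of_int \<lfloor>x $ i\<rfloor>) :: real^'n"
    have "?z \<in> int_lattice" by (simp add: int_lattice_def)
    moreover have "x + ?z \<in> cbox 0 1"
      by (auto simp: mem_box_cart algebra_simps) (smt (verit) of_int_floor_le real_of_int_floor_add_one_ge)+
    ultimately show ?case using elim by (auto simp: unit_cell_def)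
  qed
qed

text \<open>Integrals see a function only on the cell, whereas identification of functions is almost everywhere
  on the whole space; this lemma passes from the first to the second.\<close>

lemma AE_periodic_from_cell:
  fixes f :: "real^'n \<Rightarrow> 'b"
  assumes per: "ae_periodic f" and cell: "AE x in cell_lebesgue. P (f x)"
  shows "AE x in lebesgue. P (f x)"
proof -
  have "AE x in lebesgue. x \<in> unit_cell \<longrightarrow> P (f x)"
    using cell by (simp add: AE_restrict_space_iff[OF sets_lebesgue_Int_unit_cell])
  then have "AE x in lebesgue. x + z \<in> unit_cell \<longrightarrow> P (f (x + z))" for z
    by (rule AE_lebesgue_translate)
  then have "AE x in lebesgue. \<forall>z\<in>int_lattice. x + z \<in> unit_cell \<longrightarrow> P (f (x + z))"
    by (simp add: AE_ball_countable countable_int_lattice)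
  moreover have "AE x in lebesgue. \<forall>z\<in>int_lattice. f (x + z) = f x"
    using per by (simp add: AE_ball_countable countable_int_lattice ae_periodic_def)
  ultimately show ?thesis
    using AE_lattice_translate_in_cell by eventually_elim auto
qed

lemma ae_periodic_comp:
  assumes "ae_periodic f" shows "ae_periodic (\<lambda>x. h (f x))"
  using assms unfolding ae_periodic_def by (auto elim!: eventually_mono)

lemma ae_periodic_comp2:
  assumes "ae_periodic f" "ae_periodic g" shows "ae_periodic (\<lambda>x. h (f x) (g x))"
  unfolding ae_periodic_def
proof
  fix z :: "real^'a" assume z: "z \<in> int_lattice"
  have "AE x in lebesgue. f (x + z) = f x" "AE x in lebesgue. g (x + z) = g x"
    using assms z by (auto simp: ae_periodic_def)
  then show "AE x in lebesgue. h (f (x + z)) (g (x + z)) = h (f x) (g x)"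
    by eventually_elim simp
qed

lemma ae_periodic_seq:
  assumes "\<And>k::nat. ae_periodic (u k)" shows "ae_periodic (\<lambda>x. h (\<lambda>k. u k x))"
  unfolding ae_periodic_def
proof
  fix z :: "real^'a" assume z: "z \<in> int_lattice"
  have "AE x in lebesgue. \<forall>k. u k (x + z) = u k x"
    using assms z by (simp add: ae_periodic_def AE_all_countable)
  then show "AE x in lebesgue. h (\<lambda>k. u k (x + z)) = h (\<lambda>k. u k x)"
    by eventually_elim simp
qed

lemma ae_periodicI: "(\<And>x z. z \<in> int_lattice \<Longrightarrow> f (x + z) = f x) \<Longrightarrow> ae_periodic f"
  by (simp add: ae_periodic_def)

section \<open>The vector space of square-integrable periodic functions\<close>

lemma L2_per_iff:
  "f \<in> L2_per \<longleftrightarrow> f \<in> borel_measurable lebesgue \<and> ae_periodic f \<and> integrable cell_lebesgue (\<lambda>x. (f x)\<^sup>2)"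
  by (simp add: L2_per_def set_integrable_cell)

lemma L2_perD:
  assumes "f \<in> L2_per"
  shows "f \<in> borel_measurable lebesgue" "f \<in> borel_measurable cell_lebesgue" "ae_periodic f"
    "integrable cell_lebesgue (\<lambda>x. (f x)\<^sup>2)"
  using assms by (auto simp: L2_per_iff intro: measurable_cell)

lemma integrable_L2_mult:
  assumes "f \<in> L2_per" "g \<in> L2_per"
  shows "integrable cell_lebesgue (\<lambda>x. f x * g x)"
proof (rule Bochner_Integration.integrable_bound)
  show "integrable cell_lebesgue (\<lambda>x. (f x)\<^sup>2 + (g x)\<^sup>2)"
    using L2_perD[OF assms(1)] L2_perD[OF assms(2)] by auto
  show "(\<lambda>x. f x * g x) \<in> borel_measurable cell_lebesgue"
    using L2_perD[OF assms(1)] L2_perD[OF assms(2)] by auto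
  have "\<bar>a * b\<bar> \<le> a\<^sup>2 + b\<^sup>2" for a b :: real
  proof -
    have "2 * (\<bar>a\<bar> * \<bar>b\<bar>) \<le> a\<^sup>2 + b\<^sup>2" using sum_squares_bound[of "\<bar>a\<bar>" "\<bar>b\<bar>"] by simp
    then show ?thesis unfolding abs_mult using mult_nonneg_nonneg[of "\<bar>a\<bar>" "\<bar>b\<bar>"] by linarith
  qed
  then show "AE x in cell_lebesgue. norm (f x * g x) \<le> norm ((f x)\<^sup>2 + (g x)\<^sup>2)"
    by auto
qed

lemma L2_per_add:
  assumes "f \<in> L2_per" "g \<in> L2_per" shows "(\<lambda>x. f x + g x) \<in> L2_per"
proof -
  have "integrable cell_lebesgue (\<lambda>x. (f x)\<^sup>2 + (g x)\<^sup>2 + 2 * (f x * g x))"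
    using assms by (intro Bochner_Integration.integrable_add integrable_mult_right integrable_L2_mult L2_perD(4))
  then show ?thesis
    using L2_perD[OF assms(1)] L2_perD[OF assms(2)] ae_periodic_comp2[of f g "(+)"]
    by (simp add: L2_per_iff power2_sum mult.assoc)
qed

lemma L2_per_scale:
  assumes "f \<in> L2_per" shows "(\<lambda>x. c * f x) \<in> L2_per"
  using L2_perD[OF assms] ae_periodic_comp[of f "\<lambda>y. c * y"] by (simp add: L2_per_iff power_mult_distrib)

lemma L2_per_uminus: "f \<in> L2_per \<Longrightarrow> (\<lambda>x. - f x) \<in> L2_per"
  using L2_per_scale[of f "-1"] by simp

lemma L2_per_diff: "f \<in> L2_per \<Longrightarrow> g \<in> L2_per \<Longrightarrow> (\<lambda>x. f x - g x) \<in> L2_per"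
  using L2_per_add[of f "\<lambda>x. -1 * g x"] L2_per_scale[of g "-1"] by simp

lemma L2_per_sum: "finite I \<Longrightarrow> (\<And>i. i \<in> I \<Longrightarrow> f i \<in> L2_per) \<Longrightarrow> (\<lambda>x. \<Sum>i\<in>I. f i x) \<in> L2_per"
proof (induction I rule: finite_induct)
  case empty
  then show ?case by (simp add: L2_per_iff ae_periodic_def)
next
  case (insert i I)
  then show ?case using L2_per_add[of "f i" "\<lambda>x. \<Sum>i\<in>I. f i x"] by simp
qed

lemma Linf_perD:
  assumes "f \<in> Linf_per"
  obtains C where "f \<in> borel_measurable lebesgue" "ae_periodic f" "AE x in lebesgue. norm (f x) \<le> C"
  using assms by (auto simp: Linf_per_def)

lemma L2_per_mult_bounded:
  fixes c :: "real^'n \<Rightarrow> real"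
  assumes "c \<in> Linf_per" "f \<in> L2_per" shows "(\<lambda>x. c x * f x) \<in> L2_per"
proof -
  obtain C where C: "c \<in> borel_measurable lebesgue" "ae_periodic c" "AE x in lebesgue. norm (c x) \<le> C"
    using Linf_perD[OF assms(1)] .
  note f = L2_perD[OF assms(2)]
  have "integrable cell_lebesgue (\<lambda>x. (c x * f x)\<^sup>2)"
  proof (rule Bochner_Integration.integrable_bound)
    show "integrable cell_lebesgue (\<lambda>x. C\<^sup>2 * (f x)\<^sup>2)" using f by simp
    show "(\<lambda>x. (c x * f x)\<^sup>2) \<in> borel_measurable cell_lebesgue"
      using f measurable_cell[OF C(1)] by auto
    show "AE x in cell_lebesgue. norm ((c x * f x)\<^sup>2) \<le> norm (C\<^sup>2 * (f x)\<^sup>2)"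
      using AE_cell[OF C(3)]
    proof eventually_elim
      case (elim x)
      then have "(c x)\<^sup>2 \<le> C\<^sup>2" using power_mono[of "\<bar>c x\<bar>" C 2] by simp
      then show ?case by (simp add: power_mult_distrib mult_right_mono)
    qed
  qed
  then show ?thesis
    using f C ae_periodic_comp2[of c f "(*)"] by (simp add: L2_per_iff)
qed

lemma Linf_per_imp_L2_per:
  fixes c :: "real^'n \<Rightarrow> real"
  assumes "c \<in> Linf_per" shows "c \<in> L2_per"
proof -
  have "(\<lambda>x. 1) \<in> L2_per"
    using finite_measure.integrable_const[OF finite_measure_cell] by (simp add: L2_per_iff ae_periodic_def)
  from L2_per_mult_bounded[OF assms this] show ?thesis by simp
qed

lemma const_L2_per [simp]: "(\<lambda>x. c) \<in> L2_per"
  by (intro Linf_per_imp_L2_per) (auto simp: Linf_per_def ae_periodic_def)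

lemma L2_inner_commute: "L2_inner f g = L2_inner g f"
  by (simp add: L2_inner_def mult.commute)

lemma L2_inner_add_left:
  assumes "f \<in> L2_per" "g \<in> L2_per" "h \<in> L2_per"
  shows "L2_inner (\<lambda>x. f x + g x) h = L2_inner f h + L2_inner g h"
  using integrable_L2_mult[OF assms(1,3)] integrable_L2_mult[OF assms(2,3)]
  by (simp add: L2_inner_cell distrib_right)

lemma L2_inner_scale_left: "L2_inner (\<lambda>x. c * f x) h = c * L2_inner f h"
  by (simp add: L2_inner_cell mult.assoc)

lemma L2_inner_cong_AE:
  assumes "AE x in lebesgue. f x = f' x" "AE x in lebesgue. g x = g' x"
    and "f \<in> L2_per" "f' \<in> L2_per" "g \<in> L2_per" "g' \<in> L2_per"
  shows "L2_inner f g = L2_inner f' g'"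
  unfolding L2_inner_cell
proof (rule integral_cong_AE)
  show "AE x in cell_lebesgue. f x * g x = f' x * g' x"
    using AE_cell[OF assms(1)] AE_cell[OF assms(2)] by eventually_elim simp
qed (use assms in \<open>auto intro!: borel_measurable_times dest: L2_perD(2)\<close>)

text \<open>The definiteness that makes the quotient below an inner product space.\<close>

lemma L2_inner_self_eq_0_iff:
  assumes "f \<in> L2_per"
  shows "L2_inner f f = 0 \<longleftrightarrow> (AE x in lebesgue. f x = 0)"
proof -
  have "L2_inner f f = 0 \<longleftrightarrow> (AE x in cell_lebesgue. f x = 0)"
    unfolding L2_inner_cell
    using integral_nonneg_eq_0_iff_AE[OF integrable_L2_mult[OF assms assms]] by simp
  also have "\<dots> \<longleftrightarrow> (AE x in lebesgue. f x = 0)"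
    using AE_periodic_from_cell[OF L2_perD(3)[OF assms], of "\<lambda>y. y = 0"] AE_cell by blast
  finally show ?thesis .
qed

lemma integral_cell_eq_inner: "(LINT x:unit_cell|lebesgue. f x) = L2_inner f (\<lambda>x. 1)"
  by (simp add: L2_inner_def)

section \<open>The Hilbert space of the torus\<close>

quotient_type 'n torus_L2 = "real^'n::finite \<Rightarrow> real" / partial:
  "\<lambda>f g. f \<in> L2_per \<and> g \<in> L2_per \<and> (AE x in lebesgue. f x = g x)"
proof (rule part_equivpI)
  show "\<exists>x. x \<in> L2_per \<and> x \<in> L2_per \<and> (AE xa in lebesgue. x xa = x xa)"
    by (rule exI[of _ "\<lambda>x. 0"]) simp
  show "symp (\<lambda>f g. f \<in> L2_per \<and> g \<in> L2_per \<and> (AE x in lebesgue. f x = g x))"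
    by (auto simp: symp_def eq_commute)
  show "transp (\<lambda>f g. f \<in> L2_per \<and> g \<in> L2_per \<and> (AE x in lebesgue. f x = g x))"
    unfolding transp_def by (auto elim: AE_mp)
qed

instantiation torus_L2 :: (finite) real_inner
begin

lift_definition zero_torus_L2 :: "'a torus_L2" is "\<lambda>x. 0" by simp

lift_definition plus_torus_L2 :: "'a torus_L2 \<Rightarrow> 'a torus_L2 \<Rightarrow> 'a torus_L2" is "\<lambda>f g x. f x + g x"
  by (auto simp: L2_per_add elim: eventually_elim2)

lift_definition scaleR_torus_L2 :: "real \<Rightarrow> 'a torus_L2 \<Rightarrow> 'a torus_L2" is "\<lambda>c f x. c * f x"
  by (auto simp: L2_per_scale elim: eventually_mono)

lift_definition minus_torus_L2 :: "'a torus_L2 \<Rightarrow> 'a torus_L2 \<Rightarrow> 'a torus_L2" is "\<lambda>f g x. f x - g x"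
  by (auto simp: L2_per_diff elim: eventually_elim2)

lift_definition uminus_torus_L2 :: "'a torus_L2 \<Rightarrow> 'a torus_L2" is "\<lambda>f x. - f x"
  by (auto simp: L2_per_uminus elim: eventually_mono)

lift_definition inner_torus_L2 :: "'a torus_L2 \<Rightarrow> 'a torus_L2 \<Rightarrow> real" is L2_inner
  by (auto intro: L2_inner_cong_AE)

definition norm_torus_L2 :: "'a torus_L2 \<Rightarrow> real" where "norm_torus_L2 x = sqrt (x \<bullet> x)"
definition dist_torus_L2 :: "'a torus_L2 \<Rightarrow> 'a torus_L2 \<Rightarrow> real" where "dist_torus_L2 x y = norm (x - y)"
definition sgn_torus_L2 :: "'a torus_L2 \<Rightarrow> 'a torus_L2" where "sgn_torus_L2 x = inverse (norm x) *\<^sub>R x"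
definition uniformity_torus_L2 :: "('a torus_L2 \<times> 'a torus_L2) filter" where
  "uniformity_torus_L2 = (INF e\<in>{0 <..}. principal {(x, y). dist x y < e})"
definition open_torus_L2 :: "'a torus_L2 set \<Rightarrow> bool" where
  "open_torus_L2 U \<longleftrightarrow> (\<forall>x\<in>U. eventually (\<lambda>(x', y). x' = x \<longrightarrow> y \<in> U) uniformity)"

instance
proof
  fix x y z :: "'a torus_L2" and a b c :: real
  show "x + y + z = x + (y + z)" by transfer (auto simp: add.assoc L2_per_add)
  show "x + y = y + x" by transfer (auto simp: add.commute L2_per_add)
  show "0 + x = x" by transfer auto
  show "- x + x = 0" by transfer (auto simp: L2_per_add L2_per_uminus)
  show "x - y = x + - y" by transfer (auto simp: L2_per_diff)
  show "c *\<^sub>R (x + y) = c *\<^sub>R x + c *\<^sub>R y" by transfer (auto simp: distrib_left L2_per_add L2_per_scale)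
  show "(a + b) *\<^sub>R x = a *\<^sub>R x + b *\<^sub>R x" by transfer (auto simp: distrib_right L2_per_add L2_per_scale)
  show "a *\<^sub>R b *\<^sub>R x = (a * b) *\<^sub>R x" by transfer (auto simp: mult.assoc L2_per_scale)
  show "1 *\<^sub>R x = x" by transfer auto
  show "dist x y = norm (x - y)" by (rule dist_torus_L2_def)
  show "sgn x = inverse (norm x) *\<^sub>R x" by (rule sgn_torus_L2_def)
  show "uniformity = (INF e\<in>{0 <..}. principal {(x :: 'a torus_L2, y). dist x y < e})"
    by (rule uniformity_torus_L2_def)
  fix U :: "'a torus_L2 set"
  show "open U \<longleftrightarrow> (\<forall>x\<in>U. eventually (\<lambda>(x', y). x' = x \<longrightarrow> y \<in> U) uniformity)"
    by (rule open_torus_L2_def)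
next
  fix x y z :: "'a torus_L2" and c :: real
  show "x \<bullet> y = y \<bullet> x" by transfer (simp add: L2_inner_commute)
  show "(x + y) \<bullet> z = x \<bullet> z + y \<bullet> z" by transfer (simp add: L2_inner_add_left)
  show "(c *\<^sub>R x) \<bullet> y = c * (x \<bullet> y)" by transfer (simp add: L2_inner_scale_left)
  show "0 \<le> x \<bullet> x" by transfer (simp add: L2_inner_cell)
  show "(x \<bullet> x = 0) = (x = 0)" by transfer (auto simp: L2_inner_self_eq_0_iff)
  show "norm x = sqrt (x \<bullet> x)" by (rule norm_torus_L2_def)
qed

end

abbreviation cls :: "(real^'n \<Rightarrow> real) \<Rightarrow> 'n torus_L2" where "cls \<equiv> abs_torus_L2"

lemma cls_eq_iff:
  assumes "f \<in> L2_per" "g \<in> L2_per"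
  shows "cls f = cls g \<longleftrightarrow> (AE x in lebesgue. f x = g x)"
  using Quotient_rel[OF Quotient_torus_L2, of f g] assms by auto

lemma cls_surj: obtains f where "f \<in> L2_per" "x = cls f"
  using Quotient_abs_rep[OF Quotient_torus_L2, of x] Quotient_rep_reflp[OF Quotient_torus_L2, of x] by metis

lemma cls_zero: "cls (\<lambda>x. 0) = 0"
  by (simp add: zero_torus_L2_def)

lemma cls_add: "f \<in> L2_per \<Longrightarrow> g \<in> L2_per \<Longrightarrow> cls (\<lambda>x. f x + g x) = cls f + cls g"
  by (rule plus_torus_L2.abs_eq[symmetric]) auto

lemma cls_diff: "f \<in> L2_per \<Longrightarrow> g \<in> L2_per \<Longrightarrow> cls (\<lambda>x. f x - g x) = cls f - cls g"
  by (rule minus_torus_L2.abs_eq[symmetric]) auto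

lemma cls_scale: "f \<in> L2_per \<Longrightarrow> cls (\<lambda>x. c * f x) = c *\<^sub>R cls f"
  by (rule scaleR_torus_L2.abs_eq[symmetric]) auto

lemma inner_cls: "f \<in> L2_per \<Longrightarrow> g \<in> L2_per \<Longrightarrow> cls f \<bullet> cls g = L2_inner f g"
  by (rule inner_torus_L2.abs_eq) auto

lemma norm_cls: "f \<in> L2_per \<Longrightarrow> norm (cls f) = L2_norm f"
  by (simp add: norm_eq_sqrt_inner inner_cls L2_norm_def)

lemma integral_abs_le_L2_norm:
  assumes "f \<in> L2_per" shows "(LINT x|cell_lebesgue. \<bar>f x\<bar>) \<le> L2_norm f"
proof -
  have af: "(\<lambda>x. \<bar>f x\<bar>) \<in> L2_per"
    using L2_perD[OF assms] ae_periodic_comp[of f abs] by (simp add: L2_per_iff)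
  have "(LINT x|cell_lebesgue. \<bar>f x\<bar>) = cls (\<lambda>x. \<bar>f x\<bar>) \<bullet> cls (\<lambda>x. 1)"
    by (simp add: inner_cls af L2_inner_cell)
  also have "\<dots> \<le> norm (cls (\<lambda>x. \<bar>f x\<bar>)) * norm (cls (\<lambda>x. 1) :: 'a torus_L2)"
    by (rule norm_cauchy_schwarz)
  also have "\<dots> = L2_norm f"
    by (simp add: norm_cls af) (use measure_cell[where 'n='a] in \<open>simp add: L2_norm_def L2_inner_cell\<close>)
  finally show ?thesis .
qed

text \<open>The analytic core of the completeness of $L^2$.  On the cell, of measure one, the $L^1$ norm is bounded
  by the $L^2$ norm, so the increments are summable and the sequence converges almost
  everywhere; Fatou's lemma turns this into convergence in norm.  The pointwise limit is taken on the
  whole space, which makes it periodic without any extension from the cell.\<close>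

lemma L2_per_limit:
  fixes v :: "nat \<Rightarrow> real^'n \<Rightarrow> real"
  assumes v: "\<And>k. v k \<in> L2_per"
    and close: "\<And>j k. k \<le> j \<Longrightarrow> L2_norm (\<lambda>x. v j x - v k x) \<le> (1/2)^k"
  obtains f where "f \<in> L2_per" "\<And>k. L2_norm (\<lambda>x. f x - v k x) \<le> (1/2)^k"
proof -
  define f where "f x = lim (\<lambda>k. v k x)" for x
  have f_meas: "f \<in> borel_measurable lebesgue"
    unfolding f_def using L2_perD(1)[OF v] by (rule borel_measurable_lim_metric)
  have f_per: "ae_periodic f"
    unfolding f_def using ae_periodic_seq[of v lim] L2_perD(3)[OF v] by blast
  define g where "g k x = v (Suc k) x - v k x" for k x
  have g: "g k \<in> L2_per" for k unfolding g_def using v by (intro L2_per_diff)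
  note [measurable] = L2_perD(2)[OF g] L2_perD(2)[OF v] measurable_cell[OF f_meas]
  have "AE x in cell_lebesgue. (\<Sum>k. ennreal \<bar>g k x\<bar>) \<noteq> \<infinity>"
  proof (rule nn_integral_PInf_AE)
    have "(\<integral>\<^sup>+x. ennreal \<bar>g k x\<bar> \<partial>cell_lebesgue) \<le> ennreal ((1/2)^k)" for k
    proof -
      have "integrable cell_lebesgue (\<lambda>x. \<bar>g k x\<bar>)"
        using integrable_L2_mult[OF g[of k] const_L2_per[of 1]] by simp
      then have "(\<integral>\<^sup>+x. ennreal \<bar>g k x\<bar> \<partial>cell_lebesgue) = ennreal (LINT x|cell_lebesgue. \<bar>g k x\<bar>)"
        by (intro nn_integral_eq_integral) auto
      also have "\<dots> \<le> ennreal ((1/2)^k)"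
        using integral_abs_le_L2_norm[OF g[of k]] close[of k "Suc k"]
        unfolding g_def by (intro ennreal_leI) auto
      finally show ?thesis .
    qed
    then have "(\<integral>\<^sup>+x. (\<Sum>k. ennreal \<bar>g k x\<bar>) \<partial>cell_lebesgue) \<le> (\<Sum>k. ennreal ((1/2)^k))"
      by (subst nn_integral_suminf) (auto intro!: suminf_le)
    also have "\<dots> = ennreal (\<Sum>k. (1/2)^k)"
      by (rule suminf_ennreal2) (auto intro: summable_geometric)
    also have "\<dots> < \<infinity>" by simp
    finally show "(\<integral>\<^sup>+x. (\<Sum>k. ennreal \<bar>g k x\<bar>) \<partial>cell_lebesgue) \<noteq> \<infinity>" by simp
  qed auto
  then have lim: "AE x in cell_lebesgue. (\<lambda>k. v k x) \<longlonglongrightarrow> f x"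
  proof eventually_elim
    case (elim x)
    then have "summable (\<lambda>k. \<bar>g k x\<bar>)" by (intro summable_suminf_not_top) auto
    then have "summable (\<lambda>k. g k x)" by (rule summable_rabs_cancel)
    then have "convergent (\<lambda>n. \<Sum>k<n. g k x)" by (simp add: summable_iff_convergent)
    moreover have "(\<Sum>k<n. g k x) = v n x - v 0 x" for n
      unfolding g_def by (rule sum_lessThan_telescope)
    ultimately have "convergent (\<lambda>n. v n x - v 0 x)" by simp
    then have "convergent (\<lambda>n. (v n x - v 0 x) + v 0 x)" by (intro convergent_add convergent_const)
    then show ?case by (simp add: f_def convergent_LIMSEQ_iff)
  qed
  have fatou: "(\<integral>\<^sup>+x. ennreal ((f x - v k x)\<^sup>2) \<partial>cell_lebesgue) \<le> ennreal (((1/2)^k)\<^sup>2)" for k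
  proof -
    have "(\<integral>\<^sup>+x. ennreal ((f x - v k x)\<^sup>2) \<partial>cell_lebesgue)
      = (\<integral>\<^sup>+x. liminf (\<lambda>j. ennreal ((v j x - v k x)\<^sup>2)) \<partial>cell_lebesgue)"
    proof (rule nn_integral_cong_AE)
      show "AE x in cell_lebesgue. ennreal ((f x - v k x)\<^sup>2) = liminf (\<lambda>j. ennreal ((v j x - v k x)\<^sup>2))"
        using lim
      proof eventually_elim
        case (elim x)
        have "(\<lambda>j. ennreal ((v j x - v k x)\<^sup>2)) \<longlonglongrightarrow> ennreal ((f x - v k x)\<^sup>2)"
          using elim by (intro tendsto_intros)
        then show ?case by (metis lim_imp_Liminf sequentially_bot)
      qed
    qed
    also have "\<dots> \<le> liminf (\<lambda>j. \<integral>\<^sup>+x. ennreal ((v j x - v k x)\<^sup>2) \<partial>cell_lebesgue)"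
      by (rule nn_integral_liminf) auto
    also have "\<dots> \<le> limsup (\<lambda>j. \<integral>\<^sup>+x. ennreal ((v j x - v k x)\<^sup>2) \<partial>cell_lebesgue)"
      by (rule Liminf_le_Limsup) simp
    also have "\<dots> \<le> ennreal (((1/2)^k)\<^sup>2)"
    proof (rule Limsup_bounded)
      show "\<forall>\<^sub>F j in sequentially. (\<integral>\<^sup>+x. ennreal ((v j x - v k x)\<^sup>2) \<partial>cell_lebesgue) \<le> ennreal (((1/2)^k)\<^sup>2)"
        using eventually_ge_at_top[of k]
      proof eventually_elim
        case (elim j)
        let ?w = "\<lambda>x. v j x - v k x"
        have "?w \<in> L2_per" using v by (intro L2_per_diff)
        then have "(\<integral>\<^sup>+x. ennreal ((?w x)\<^sup>2) \<partial>cell_lebesgue) = ennreal (L2_inner ?w ?w)"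
          unfolding L2_inner_cell power2_eq_square[symmetric]
          by (intro nn_integral_eq_integral) (auto dest: L2_perD)
        also have "L2_inner ?w ?w = (L2_norm ?w)\<^sup>2"
          by (simp add: L2_norm_def L2_inner_cell)
        also have "ennreal \<dots> \<le> ennreal (((1/2)^k)\<^sup>2)"
          using close[OF elim] by (intro ennreal_leI power_mono) (auto simp: L2_norm_def L2_inner_cell)
        finally show ?case .
      qed
    qed
    finally show ?thesis .
  qed
  have fv: "(\<lambda>x. f x - v k x) \<in> L2_per" for k
  proof -
    have "integrable cell_lebesgue (\<lambda>x. (f x - v k x)\<^sup>2)"
      using fatou[of k] by (intro integrableI_bounded) (auto simp: le_less_trans)
    then show ?thesis
      using f_meas f_per L2_perD[OF v[of k]] ae_periodic_comp2[of f "v k" "(-)"] by (simp add: L2_per_iff)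
  qed
  have "f \<in> L2_per" using L2_per_add[OF fv[of 0] v[of 0]] by simp
  moreover have "L2_norm (\<lambda>x. f x - v k x) \<le> (1/2)^k" for k
  proof -
    have "ennreal (LINT x|cell_lebesgue. (f x - v k x)\<^sup>2) \<le> ennreal (((1/2)^k)\<^sup>2)"
      using fatou[of k] L2_perD(4)[OF fv[of k]] by (simp add: nn_integral_eq_integral)
    then have "L2_inner (\<lambda>x. f x - v k x) (\<lambda>x. f x - v k x) \<le> ((1/2)^k)\<^sup>2"
      by (subst (asm) ennreal_le_iff) (simp_all add: L2_inner_cell power2_eq_square)
    then show ?thesis
      unfolding L2_norm_def by (intro real_le_lsqrt) (auto simp: L2_inner_cell)
  qed
  ultimately show ?thesis using that by blast
qed

text \<open>Passing to classes modulo equality almost everywhere turns the function space into an instance of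
  the type classes for Hilbert spaces, for which Riesz, Parseval and the Galerkin lemmas are stated.\<close>

text \<open>It suffices that a subsequence with geometrically small increments converges.\<close>

instance torus_L2 :: (finite) complete_space
proof
  fix X :: "nat \<Rightarrow> 'a torus_L2" assume X: "Cauchy X"
  have "\<exists>N. \<forall>m\<ge>N. \<forall>n\<ge>N. dist (X m) (X n) < (1/2)^k" for k :: nat
    using X by (auto simp: Cauchy_def)
  then obtain N where N: "\<And>k m n. m \<ge> N k \<Longrightarrow> n \<ge> N k \<Longrightarrow> dist (X m) (X n) < (1/2)^k" by metis
  \<comment> \<open>a strictly increasing index that stays above $N$\<close>
  define r where "r k = (\<Sum>i\<le>k. N i) + k" for k
  have r: "strict_mono r" unfolding r_def by (rule strict_monoI_Suc) simp
  have rN: "r k \<ge> N k" for k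
    unfolding r_def using member_le_sum[of k "{..k}" N] by auto
  have "\<forall>x::'a torus_L2. \<exists>f. f \<in> L2_per \<and> x = cls f" using cls_surj by metis
  then obtain rep :: "'a torus_L2 \<Rightarrow> _" where rep: "\<And>x. rep x \<in> L2_per" "\<And>x. cls (rep x) = x" by metis
  define v where "v k = rep (X (r k))" for k
  have v: "v k \<in> L2_per" "cls (v k) = X (r k)" for k by (auto simp: v_def rep)
  have norm_v: "L2_norm (\<lambda>x. f x - v k x) = dist (cls f) (X (r k))" if "f \<in> L2_per" for f k
    using that v by (simp add: norm_cls[symmetric] cls_diff L2_per_diff dist_norm)
  have "L2_norm (\<lambda>x. v j x - v k x) \<le> (1/2)^k" if "k \<le> j" for j k
    using N[of k "r j" "r k"] rN[of k] strict_mono_less_eq[OF r, of k j] that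
    by (simp add: norm_v v less_imp_le)
  then obtain f where f: "f \<in> L2_per" "\<And>k. L2_norm (\<lambda>x. f x - v k x) \<le> (1/2)^k"
    using L2_per_limit[of v] v(1) by blast
  have "(X \<circ> r) \<longlonglongrightarrow> cls f"
  proof (rule metric_tendsto_imp_tendsto)
    show "(\<lambda>k. (1/2::real)^k) \<longlonglongrightarrow> 0" by (rule LIMSEQ_power_zero) simp
    show "\<forall>\<^sub>F k in sequentially. dist ((X \<circ> r) k) (cls f) \<le> dist ((1/2::real)^k) 0"
      using f(2) by (simp add: norm_v f(1) dist_commute)
  qed
  from Cauchy_converges_subseq[OF X r this] show "convergent X" by (auto simp: convergent_def)
qed

section \<open>Translation invariance of the cell integral\<close>

definition lattice_periodic :: "(real^'n \<Rightarrow> 'b) \<Rightarrow> bool" where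
  "lattice_periodic F \<longleftrightarrow> (\<forall>z\<in>int_lattice. \<forall>x. F (x + z) = F x)"

lemma continuous_integrable_cell:
  fixes F :: "real^'n \<Rightarrow> real"
  assumes "continuous_on UNIV F"
  shows "integrable cell_lebesgue F" "(LINT x|cell_lebesgue. F x) = integral (cbox 0 1) F"
proof -
  have "set_integrable lebesgue (cbox 0 1) F"
    using absolutely_integrable_continuous[of 0 1 F] continuous_on_subset[OF assms] by auto
  then have "set_integrable lebesgue unit_cell F"
    by (rule set_integrable_subset) (auto simp: unit_cell_def box_subset_cbox)
  then show int: "integrable cell_lebesgue F" by (simp add: set_integrable_cell)
  show "(LINT x|cell_lebesgue. F x) = integral (cbox 0 1) F"
    using lebesgue_integral_eq_integral[OF int] by (simp add: unit_cell_def integral_open_interval)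
qed

lemma continuous_periodic_L2_per:
  fixes F :: "real^'n \<Rightarrow> real"
  assumes "continuous_on UNIV F" "lattice_periodic F"
  shows "F \<in> L2_per"
proof -
  have "F \<in> borel_measurable lebesgue"
    using borel_measurable_continuous_onI[OF assms(1)] by (simp add: measurable_completion)
  moreover have "integrable cell_lebesgue (\<lambda>x. (F x)\<^sup>2)"
    by (intro continuous_integrable_cell continuous_intros assms)
  ultimately show ?thesis
    using assms(2) by (auto simp: L2_per_iff lattice_periodic_def intro: ae_periodicI)
qed

text \<open>The shifted cube is cut at the plane $x_i = 1$.  The part beyond it is a lattice translate of the
  slab of the unit cube that the shift has vacated.\<close>

lemma integral_cell_shift_nonneg:
  fixes F :: "real^'n \<Rightarrow> real"
  assumes F: "continuous_on UNIV F" "lattice_periodic F" and t: "0 \<le> t" "t \<le> 1"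
  shows "integral (cbox 0 1) (\<lambda>x. F (x + axis i t)) = integral (cbox 0 1) F"
proof -
  let ?e = "axis i 1 :: real^'n" and ?te = "axis i t :: real^'n"
  have int: "F integrable_on cbox a b" for a b
    by (intro integrable_continuous continuous_on_subset[OF F(1)]) auto
  have B: "?e \<in> Basis" by (auto simp: Basis_vec_def)
  let ?top = "1 - axis i (1 - t) :: real^'n"
  have axc: "axis i s $ j = (if j = i then s else 0)" for s :: real and j by (simp add: axis_def)
  have low: "cbox 0 1 \<inter> {x. x \<bullet> ?e \<le> t} = cbox 0 ?top"
    by (rule set_eqI, simp add: mem_box_cart inner_axis axc) (use t in \<open>smt (verit)\<close>)
  have mid: "cbox 0 1 \<inter> {x. x \<bullet> ?e \<ge> t} = cbox (0 + ?te) (1 + ?te) \<inter> {x. x \<bullet> ?e \<le> 1}"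
    by (rule set_eqI, simp add: mem_box_cart inner_axis axc) (use t in \<open>smt (verit)\<close>)
  have high: "cbox (0 + ?te) (1 + ?te) \<inter> {x. x \<bullet> ?e \<ge> 1} = cbox (0 + ?e) (?top + ?e)"
    by (rule set_eqI, simp add: mem_box_cart inner_axis axc) (use t in \<open>smt (verit)\<close>)
  have "?e \<in> int_lattice" by (simp add: int_lattice_def axis_def)
  then have per: "F (?e + x) = F x" for x
    using F(2) unfolding lattice_periodic_def by (metis add.commute)
  have "integral (cbox 0 1) (\<lambda>x. F (x + ?te)) = integral (cbox (0 + ?te) (1 + ?te)) F"
    using integral_shift_cbox_plus[of 0 1 F ?te] by (simp add: o_def add.commute)
  also have "\<dots> = integral (cbox 0 1 \<inter> {x. x \<bullet> ?e \<ge> t}) F + integral (cbox (0 + ?e) (?top + ?e)) F"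
    using integral_split[OF int B, of "0 + ?te" "1 + ?te" 1] unfolding mid[symmetric] high .
  also have "integral (cbox (0 + ?e) (?top + ?e)) F = integral (cbox 0 1 \<inter> {x. x \<bullet> ?e \<le> t}) F"
    using integral_shift_cbox_plus[of 0 ?top F ?e] unfolding low by (simp add: o_def per)
  also have "integral (cbox 0 1 \<inter> {x. x \<bullet> ?e \<ge> t}) F + integral (cbox 0 1 \<inter> {x. x \<bullet> ?e \<le> t}) F
    = integral (cbox 0 1) F"
    using integral_split[OF int B, of 0 1 t] by simp
  finally show ?thesis .
qed

lemma lattice_periodic_shift: "lattice_periodic F \<Longrightarrow> lattice_periodic (\<lambda>x. F (x + a))"
  unfolding lattice_periodic_def by (metis add.assoc add.commute)

lemma integral_cell_shift:
  fixes F :: "real^'n \<Rightarrow> real"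
  assumes F: "continuous_on UNIV F" "lattice_periodic F" and t: "\<bar>t\<bar> \<le> 1"
  shows "integral (cbox 0 1) (\<lambda>x. F (x + axis i t)) = integral (cbox 0 1) F"
proof (cases "t \<ge> 0")
  case True
  then show ?thesis using integral_cell_shift_nonneg[OF F] t by simp
next
  case False
  have "continuous_on UNIV (\<lambda>x. F (x + axis i t))"
    by (rule continuous_on_compose2[OF F(1)]) (auto intro!: continuous_intros)
  from integral_cell_shift_nonneg[OF this lattice_periodic_shift[OF F(2)], of "-t" i]
  have "integral (cbox 0 1) (\<lambda>x. F (x + axis i (- t) + axis i t)) = integral (cbox 0 1) (\<lambda>x. F (x + axis i t))"
    using False t by simp
  moreover have "x + axis i (- t) + axis i t = x" for x :: "real^'n"
    by (simp add: vec_eq_iff axis_def)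
  ultimately show ?thesis by simp
qed

text \<open>The divergence theorem on the torus: the integral of $x \mapsto F(x + t e_i)$ over the cell does not
  depend on $t$, and its derivative at $t = 0$ is the integral of $\partial_i F$.\<close>

lemma integral_cell_derivative_zero:
  fixes F F' :: "real^'n \<Rightarrow> real"
  assumes F: "continuous_on UNIV F" "lattice_periodic F" and F': "continuous_on UNIV F'"
    and deriv: "\<And>x. ((\<lambda>t. F (x + axis i t)) has_real_derivative F' x) (at 0)"
  shows "(LINT x|cell_lebesgue. F' x) = 0"
proof -
  let ?U = "{-1<..<1::real}"
  have ax: "axis i s + axis i t = (axis i (s + t) :: real^'n)" for s t
    by (simp add: vec_eq_iff axis_def)
  have cont_ax: "continuous_on S (\<lambda>t. axis i (g t) :: real^'n)" if "continuous_on S g" for S :: "'z::topological_space set" and g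
  proof -
    have "(\<lambda>t. axis i (g t) :: real^'n) = (\<lambda>t. g t *\<^sub>R axis i 1)"
      by (auto simp: vec_eq_iff axis_def)
    then show ?thesis using that by (simp only:) (intro continuous_intros)
  qed
  have d: "((\<lambda>t. F (x + axis i t)) has_real_derivative F' (x + axis i s)) (at s)" for x s
  proof -
    have "((\<lambda>t. F ((x + axis i s) + axis i t)) has_real_derivative F' (x + axis i s)) (at (s + - s))"
      using deriv[of "x + axis i s"] by simp
    then have "((\<lambda>t. F ((x + axis i s) + axis i (t + - s))) has_real_derivative F' (x + axis i s)) (at s)"
      by (rule DERIV_shift[THEN iffD1])
    then show ?thesis by (simp add: add.assoc ax)
  qed
  have "((\<lambda>t. integral (cbox 0 1) (\<lambda>x. F (x + axis i t))) has_field_derivative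
      integral (cbox 0 1) (\<lambda>x. F' (x + axis i 0))) (at 0 within ?U)"
  proof (rule leibniz_rule_field_derivative)
    fix s x show "((\<lambda>t. F (x + axis i t)) has_real_derivative F' (x + axis i s)) (at s within ?U)"
      using d by (rule has_field_derivative_at_within)
  next
    fix s show "(\<lambda>x. F (x + axis i s)) integrable_on cbox 0 1"
      by (intro integrable_continuous continuous_on_compose2[OF F(1)]) (auto intro!: continuous_intros)
  next
    show "continuous_on (?U \<times> cbox 0 1) (\<lambda>(s, x). F' (x + axis i s))"
      unfolding split_beta
      by (intro continuous_on_compose2[OF F'] continuous_intros cont_ax) auto
  qed auto
  then have "((\<lambda>t. integral (cbox 0 1) (\<lambda>x. F (x + axis i t))) has_field_derivative
      integral (cbox 0 1) (\<lambda>x. F' (x + axis i 0))) (at 0)"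
    by (simp add: at_within_open[of 0 ?U])
  moreover have "((\<lambda>t. integral (cbox 0 1) (\<lambda>x. F (x + axis i t))) has_field_derivative 0) (at 0)"
  proof (rule has_field_derivative_transform_within[OF DERIV_const])
    fix t :: real assume "dist t 0 < 1"
    then show "integral (cbox 0 1) F = integral (cbox 0 1) (\<lambda>x. F (x + axis i t))"
      using integral_cell_shift[OF F, of t i] by simp
  qed (rule zero_less_one, simp)
  ultimately have "integral (cbox 0 1) (\<lambda>x. F' (x + axis i 0)) = 0"
    by (rule DERIV_unique)
  moreover have "axis i 0 = (0 :: real^'n)" by (simp add: vec_eq_iff axis_def)
  ultimately show ?thesis by (simp add: continuous_integrable_cell(2)[OF F'])
qed

section \<open>The Hartley system\<close>

text \<open>The kernel of the Hartley transform, the real substitute for $e^{2\pi i k\cdot x}$.\<close>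

definition cas :: "real^'n \<Rightarrow> real^'n \<Rightarrow> real" where
  "cas k x = cos (2 * pi * (k \<bullet> x)) + sin (2 * pi * (k \<bullet> x))"

lemma cas_zero [simp]: "cas 0 x = 1"
  by (simp add: cas_def)

lemma int_lattice_inner_Ints: "k \<in> int_lattice \<Longrightarrow> z \<in> int_lattice \<Longrightarrow> k \<bullet> z \<in> \<int>"
  by (auto simp: int_lattice_def inner_vec_def intro!: Ints_sum)

lemma int_lattice_add: "k \<in> int_lattice \<Longrightarrow> l \<in> int_lattice \<Longrightarrow> k + l \<in> int_lattice"
  and int_lattice_diff: "k \<in> int_lattice \<Longrightarrow> l \<in> int_lattice \<Longrightarrow> k - l \<in> int_lattice"
  and int_lattice_zero [simp]: "0 \<in> int_lattice"
  and int_lattice_axis [simp]: "axis i 1 \<in> int_lattice"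
  by (auto simp: int_lattice_def axis_def)

lemma lattice_wave_periodic:
  assumes "k \<in> int_lattice" shows "lattice_periodic (\<lambda>x. cos (2 * pi * (k \<bullet> x) + \<phi>))"
  unfolding lattice_periodic_def
proof (intro ballI allI)
  fix z x :: "real^'a" assume "z \<in> int_lattice"
  with assms obtain m where m: "k \<bullet> z = of_int m" using int_lattice_inner_Ints by (metis Ints_cases)
  have "cos (2 * pi * (k \<bullet> (x + z)) + \<phi>) = cos ((2 * pi * (k \<bullet> x) + \<phi>) + 2 * pi * of_int m)"
    by (simp add: inner_add_right m algebra_simps)
  also have "\<dots> = cos (2 * pi * (k \<bullet> x) + \<phi>)"
    using sin_cos_eq_iff[of "(2 * pi * (k \<bullet> x) + \<phi>) + 2 * pi * of_int m" "2 * pi * (k \<bullet> x) + \<phi>"] by auto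
  finally show "cos (2 * pi * (k \<bullet> (x + z)) + \<phi>) = cos (2 * pi * (k \<bullet> x) + \<phi>)" .
qed

lemma cas_eq_waves: "cas k x = cos (2 * pi * (k \<bullet> x) + 0) + cos (2 * pi * (k \<bullet> x) + (- (pi/2)))"
  by (simp add: cas_def cos_diff)

lemma cas_continuous [continuous_intros]: "continuous_on S (cas k)"
  unfolding cas_def by (intro continuous_intros)

lemma cas_periodic: "k \<in> int_lattice \<Longrightarrow> lattice_periodic (cas k)"
  using lattice_wave_periodic[of k 0] lattice_wave_periodic[of k "- (pi/2)"]
  unfolding lattice_periodic_def cas_eq_waves by simp

lemma cas_L2_per: "k \<in> int_lattice \<Longrightarrow> cas k \<in> L2_per"
  by (intro continuous_periodic_L2_per cas_continuous cas_periodic)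

lemma cas_has_derivative:
  "(cas k has_derivative (\<lambda>h. 2 * pi * (k \<bullet> h) * cas (- k) x)) (at x)"
  unfolding cas_def by (auto intro!: derivative_eq_intros simp: algebra_simps)

text \<open>A shift by half a wavelength in a coordinate direction changes the sign of the wave but not its
  integral over the cell.\<close>

lemma integral_lattice_wave:
  assumes "m \<in> int_lattice" "m \<noteq> 0"
  shows "(LINT x|cell_lebesgue. cos (2 * pi * (m \<bullet> x) + \<phi>)) = 0"
proof -
  let ?F = "\<lambda>x. cos (2 * pi * (m \<bullet> x) + \<phi>)"
  have cont: "continuous_on UNIV ?F" by (intro continuous_intros)
  obtain i where i: "m $ i \<noteq> 0" using assms(2) by (auto simp: vec_eq_iff)
  obtain n where n: "m $ i = of_int n" using assms(1) by (auto simp: int_lattice_def elim: Ints_cases)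
  \<comment> \<open>half a wavelength in direction $i$\<close>
  let ?t = "1 / (2 * m $ i)"
  have "1 \<le> \<bar>m $ i\<bar>" using i by (simp add: n)
  then have t: "\<bar>?t\<bar> \<le> 1" by (simp add: abs_mult field_simps)
  have "2 * pi * (m \<bullet> (x + axis i ?t)) + \<phi> = 2 * pi * (m \<bullet> x) + \<phi> + pi" for x
    using i by (simp add: inner_add_right inner_axis field_simps)
  then have flip: "?F (x + axis i ?t) = - ?F x" for x by (simp add: cos_add)
  have "integral (cbox 0 1) ?F = integral (cbox 0 1) (\<lambda>x. ?F (x + axis i ?t))"
    using integral_cell_shift[OF cont lattice_wave_periodic[OF assms(1)] t] by simp
  also have "\<dots> = - integral (cbox 0 1) ?F" unfolding flip by simp
  finally have "integral (cbox 0 1) ?F = 0" by simp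
  then show ?thesis by (simp only: continuous_integrable_cell(2)[OF cont])
qed

text \<open>This product formula explains both why the system is orthonormal, as only the frequency $k - l$ survives
  integration, and why its span is an algebra.\<close>

lemma cas_mult: "cas k x * cas l x = cos (2 * pi * ((k - l) \<bullet> x)) + sin (2 * pi * ((k + l) \<bullet> x))"
  by (simp add: cas_def inner_diff_left inner_add_left right_diff_distrib distrib_left cos_diff sin_add algebra_simps)

lemma cas_orthonormal:
  assumes "k \<in> int_lattice" "l \<in> int_lattice"
  shows "L2_inner (cas k) (cas l) = (if k = l then 1 else 0)"
proof -
  have "(LINT x|cell_lebesgue. cos (2 * pi * ((k - l) \<bullet> x))) = (if k = l then 1 else 0)"
    using integral_lattice_wave[OF int_lattice_diff[OF assms], of 0] measure_cell[where 'n='a] by simp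
  moreover have "(LINT x|cell_lebesgue. sin (2 * pi * ((k + l) \<bullet> x))) = 0"
  proof (cases "k + l = 0")
    case False
    from integral_lattice_wave[OF int_lattice_add[OF assms] this, of "- (pi/2)"]
    show ?thesis by (simp add: cos_diff)
  qed simp
  moreover have "integrable cell_lebesgue (\<lambda>x. cos (2 * pi * ((k - l) \<bullet> x)))"
    "integrable cell_lebesgue (\<lambda>x. sin (2 * pi * ((k + l) \<bullet> x)))"
    by (intro continuous_integrable_cell continuous_intros)+
  ultimately show ?thesis
    by (simp add: L2_inner_cell cas_mult)
qed

section \<open>Completeness of the Hartley system\<close>

text \<open>Real trigonometric polynomials, as the linear span of the Hartley system.\<close>

inductive_set trig_poly :: "(real^'n \<Rightarrow> real) set" where
  wave: "k \<in> int_lattice \<Longrightarrow> (\<lambda>x. c * cas k x) \<in> trig_poly"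
| add: "p \<in> trig_poly \<Longrightarrow> q \<in> trig_poly \<Longrightarrow> (\<lambda>x. p x + q x) \<in> trig_poly"

lemma trig_poly_cos_sin:
  assumes "k \<in> int_lattice"
  shows "(\<lambda>x. c * cos (2 * pi * (k \<bullet> x))) \<in> trig_poly" "(\<lambda>x. c * sin (2 * pi * (k \<bullet> x))) \<in> trig_poly"
  using trig_poly.add[OF trig_poly.wave[OF assms, of "c/2"] trig_poly.wave[OF int_lattice_uminus[OF assms], of "c/2"]]
    trig_poly.add[OF trig_poly.wave[OF assms, of "c/2"] trig_poly.wave[OF int_lattice_uminus[OF assms], of "-c/2"]]
  by (simp_all add: cas_def algebra_simps)

lemma trig_poly_mult:
  assumes "p \<in> trig_poly" "q \<in> trig_poly" shows "(\<lambda>x. p x * q x) \<in> trig_poly"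
  using assms
proof (induction p rule: trig_poly.induct)
  case (wave k c)
  from wave(2,1) show ?case
  proof (induction q rule: trig_poly.induct)
    case (wave l d)
    have "(\<lambda>x. (c * d) * cos (2 * pi * ((k - l) \<bullet> x)) + (c * d) * sin (2 * pi * ((k + l) \<bullet> x))) \<in> trig_poly"
      using wave by (intro trig_poly.add trig_poly_cos_sin int_lattice_diff int_lattice_add)
    moreover have "c * cas k x * (d * cas l x)
      = (c * d) * cos (2 * pi * ((k - l) \<bullet> x)) + (c * d) * sin (2 * pi * ((k + l) \<bullet> x))" for x
      using cas_mult[of k x l] by (simp add: algebra_simps)
    ultimately show ?case by simp
  next
    case (add p q)
    then show ?case using trig_poly.add by (simp add: distrib_left)
  qed
next
  case (add p q)
  then show ?case using trig_poly.add by (simp add: distrib_right)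
qed

lemma trig_poly_L2_per: "p \<in> trig_poly \<Longrightarrow> p \<in> L2_per"
  by (induction rule: trig_poly.induct) (auto intro: L2_per_scale L2_per_add cas_L2_per)

lemma trig_poly_inner_zero:
  assumes "f \<in> L2_per" and zero: "\<And>k. k \<in> int_lattice \<Longrightarrow> L2_inner f (cas k) = 0"
  shows "p \<in> trig_poly \<Longrightarrow> L2_inner f p = 0"
proof (induction rule: trig_poly.induct)
  case (wave k c)
  then show ?case
    using L2_inner_scale_left[of c "cas k" f] zero by (simp add: L2_inner_commute[of f])
next
  case (add p q)
  then show ?case
    using L2_inner_add_left[OF trig_poly_L2_per trig_poly_L2_per assms(1), of p q] by (simp add: L2_inner_commute[of f])
qed

text \<open>The covering of the torus, embedded in $\mathbb{C}^n$ as a product of unit circles.  It makes periodic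
  functions available to the Stone-Weierstrass theorem, which requires a compact space whose points are
  separated: on the closed cube opposite faces would not be.\<close>

definition torus_point :: "real^'n \<Rightarrow> complex^'n" where
  "torus_point x = (\<chi> i. cis (2 * pi * x $ i))"

lemma torus_point_continuous [continuous_intros]: "continuous_on S torus_point"
  unfolding torus_point_def
  by (intro continuous_on_vec_lambda) (auto simp: cis_conv_exp intro!: continuous_intros)

lemma torus_point_periodic: "lattice_periodic (\<lambda>x::real^'n. \<phi> (torus_point x))"
  unfolding lattice_periodic_def
proof (intro ballI allI)
  fix z x :: "real^'n" assume z: "z \<in> int_lattice"
  have "cis (2 * pi * (x + z) $ i) = cis (2 * pi * x $ i)" for i
  proof -
    obtain m where "z $ i = of_int m" using z by (auto simp: int_lattice_def elim: Ints_cases)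
    then show ?thesis
      using sin_cos_eq_iff[of "2 * pi * (x + z) $ i" "2 * pi * x $ i"]
      by (auto simp: complex_eq_iff algebra_simps)
  qed
  then show "\<phi> (torus_point (x + z)) = \<phi> (torus_point x)" by (simp add: torus_point_def)
qed

lemma torus_point_inj: "inj_on torus_point unit_cell"
proof (rule inj_onI)
  fix x y :: "real^'n" assume x: "x \<in> unit_cell" and y: "y \<in> unit_cell" and eq: "torus_point x = torus_point y"
  have "x $ i = y $ i" for i
  proof -
    have "cis (2 * pi * x $ i) = cis (2 * pi * y $ i)"
      using eq by (simp add: torus_point_def vec_eq_iff)
    then obtain n :: int where "2 * pi * x $ i = 2 * pi * y $ i + 2 * pi * n"
      using sin_cos_eq_iff[of "2 * pi * x $ i" "2 * pi * y $ i"] by (auto simp: complex_eq_iff)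
    then have "2 * pi * (x $ i) = 2 * pi * (y $ i + n)" by (simp add: distrib_left)
    then have n: "x $ i = y $ i + n" by simp
    moreover have "0 < x $ i" "x $ i < 1" "0 < y $ i" "y $ i < 1"
      using x y by (auto simp: unit_cell_def mem_box_cart)
    ultimately have "\<bar>real_of_int n\<bar> < 1" by linarith
    then show ?thesis using n by simp
  qed
  then show "x = y" by (simp add: vec_eq_iff)
qed

text \<open>Stone-Weierstrass on the product of circles, for the algebra of continuous functions that become
  trigonometric polynomials when pulled back along \<open>torus_point\<close>; the real and imaginary parts of
  the coordinates separate points.\<close>

lemma trig_poly_uniformly_dense:
  fixes \<phi> :: "complex^'n \<Rightarrow> real"
  assumes \<phi>: "continuous_on UNIV \<phi>" and e: "e > 0"
  obtains p where "p \<in> trig_poly" "\<And>x. \<bar>\<phi> (torus_point x) - p x\<bar> < e"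
proof -
  let ?S = "{z :: complex^'n. \<forall>i. norm (z $ i) = 1}"
  let ?R = "{\<psi>. continuous_on UNIV \<psi> \<and> (\<exists>p\<in>trig_poly. \<forall>x. \<psi> (torus_point x) = p x)}"
  have coord: "(\<lambda>z. Re (z $ i)) \<in> ?R" "(\<lambda>z. Im (z $ i)) \<in> ?R" for i
    using trig_poly_cos_sin[of "axis i 1" 1]
    by (auto intro!: continuous_intros bexI simp: torus_point_def inner_axis' )
  interpret function_ring_on ?R ?S
  proof
    have "?S \<subseteq> cball 0 (\<Sum>i\<in>(UNIV::'n set). 1)"
    proof
      fix z :: "complex^'n" assume "z \<in> ?S"
      then have "norm z \<le> (\<Sum>i\<in>(UNIV::'n set). 1)"
        using L2_set_le_sum[of UNIV "\<lambda>i. norm (z $ i)"] by (simp add: norm_vec_def)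
      then show "z \<in> cball 0 (\<Sum>i\<in>(UNIV::'n set). 1)" by simp
    qed
    moreover have "closed ?S"
      by (intro closed_Collect_all closed_Collect_eq continuous_intros)
    ultimately show "compact ?S"
      using bounded_subset bounded_cball compact_eq_bounded_closed by blast
  next
    fix f g :: "complex^'n \<Rightarrow> real" assume "f \<in> ?R" "g \<in> ?R"
    then obtain p q where *: "p \<in> trig_poly" "q \<in> trig_poly" "\<And>x. f (torus_point x) = p x"
      "\<And>x. g (torus_point x) = q x" "continuous_on UNIV f" "continuous_on UNIV g" by blast
    show "(\<lambda>x. f x + g x) \<in> ?R"
      using * trig_poly.add[OF *(1,2)] by (auto intro!: continuous_intros bexI)
    show "(\<lambda>x. f x * g x) \<in> ?R"
      using * trig_poly_mult[OF *(1,2)] by (auto intro!: continuous_intros bexI)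
  next
    fix c :: real show "(\<lambda>_. c) \<in> ?R"
      using trig_poly.wave[OF int_lattice_zero, of c] by (auto intro!: bexI)
  next
    fix x y :: "complex^'n" assume "x \<noteq> y"
    then obtain i where "Re (x $ i) \<noteq> Re (y $ i) \<or> Im (x $ i) \<noteq> Im (y $ i)"
      by (auto simp: vec_eq_iff complex_eq_iff)
    then show "\<exists>f\<in>?R. f x \<noteq> f y"
      by (elim disjE) (rule bexI[OF _ coord(1)[of i]] bexI[OF _ coord(2)[of i]], assumption)+
  qed (auto intro: continuous_on_subset)
  obtain \<psi> where \<psi>: "\<psi> \<in> ?R" "\<forall>z\<in>?S. \<bar>\<phi> z - \<psi> z\<bar> < e"
    using Stone_Weierstrass_basic[OF continuous_on_subset[OF \<phi>] e] by blast
  then obtain p where "p \<in> trig_poly" "\<And>x. \<psi> (torus_point x) = p x" by blast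
  moreover have "torus_point x \<in> ?S" for x :: "real^'n" by (simp add: torus_point_def)
  ultimately show ?thesis using that[of p] \<psi>(2) by metis
qed

lemma inner_torus_continuous_zero:
  fixes \<phi> :: "complex^'n \<Rightarrow> real"
  assumes f: "f \<in> L2_per" and zero: "\<And>k. k \<in> int_lattice \<Longrightarrow> L2_inner f (cas k) = 0"
    and \<phi>: "continuous_on UNIV \<phi>"
  shows "L2_inner f (\<lambda>x. \<phi> (torus_point x)) = 0"
proof (rule ccontr)
  let ?g = "\<lambda>x. \<phi> (torus_point x)"
  assume nz: "L2_inner f ?g \<noteq> 0"
  define M where "M = (LINT x|cell_lebesgue. \<bar>f x\<bar>)"
  have M: "M \<ge> 0" unfolding M_def by simp
  have absf: "integrable cell_lebesgue (\<lambda>x. \<bar>f x\<bar>)"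
    using integrable_L2_mult[OF f const_L2_per[of 1]] by simp
  \<comment> \<open>an error for which $e M$ stays strictly below the inner product\<close>
  define e where "e = \<bar>L2_inner f ?g\<bar> / (M + 1)"
  have e: "e > 0" "e * (M + 1) = \<bar>L2_inner f ?g\<bar>" using nz M by (auto simp: e_def)
  obtain p where p: "p \<in> trig_poly" "\<And>x. \<bar>?g x - p x\<bar> < e"
    using trig_poly_uniformly_dense[OF \<phi> e(1)] by blast
  have g: "?g \<in> L2_per"
    by (intro continuous_periodic_L2_per torus_point_periodic continuous_on_compose2[OF \<phi>] continuous_intros) auto
  have pL: "p \<in> L2_per" by (rule trig_poly_L2_per[OF p(1)])
  have "L2_inner f ?g = (LINT x|cell_lebesgue. f x * ?g x) - (LINT x|cell_lebesgue. f x * p x)"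
    using trig_poly_inner_zero[OF f zero p(1)] by (simp add: L2_inner_cell)
  also have "\<dots> = (LINT x|cell_lebesgue. f x * (?g x - p x))"
    using integrable_L2_mult[OF f g] integrable_L2_mult[OF f pL] by (simp add: right_diff_distrib)
  also have "\<bar>\<dots>\<bar> \<le> (LINT x|cell_lebesgue. \<bar>f x * (?g x - p x)\<bar>)"
    by (rule integral_abs_bound)
  also have "\<dots> \<le> (LINT x|cell_lebesgue. e * \<bar>f x\<bar>)"
  proof (rule integral_mono)
    show "integrable cell_lebesgue (\<lambda>x. \<bar>f x * (?g x - p x)\<bar>)"
      by (intro integrable_abs integrable_L2_mult f L2_per_diff g pL)
    show "integrable cell_lebesgue (\<lambda>x. e * \<bar>f x\<bar>)" using absf by simp
    fix x show "\<bar>f x * (?g x - p x)\<bar> \<le> e * \<bar>f x\<bar>"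
      using mult_right_mono[OF less_imp_le[OF p(2)[of x]], of "\<bar>f x\<bar>"] by (simp add: abs_mult mult.commute)
  qed
  also have "\<dots> = e * M" by (simp add: M_def)
  finally show False using e by (simp add: distrib_left)
qed

text \<open>The indicator of the compact image of $K$ is the pointwise limit of the continuous functions
  $\max(0, 1 - m\,\mathrm{dist}(z, C))$.  As \<open>torus_point\<close> is injective on the open cell, pulling it back
  gives the indicator of $K$ on the cell.\<close>

lemma integral_compact_zero:
  assumes f: "f \<in> L2_per" and zero: "\<And>k. k \<in> int_lattice \<Longrightarrow> L2_inner f (cas k) = 0"
    and K: "compact K" "K \<subseteq> unit_cell"
  shows "(LINT x|cell_lebesgue. f x * indicator K x) = 0"
proof (cases "K = {}")
  case False
  let ?C = "torus_point ` K"
  have C: "closed ?C" "?C \<noteq> {}"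
    using compact_continuous_image[OF torus_point_continuous K(1)] compact_imp_closed False by auto
  define \<phi> where "\<phi> m z = max 0 (1 - real m * infdist z ?C)" for m z
  have cont: "continuous_on UNIV (\<phi> m)" for m
    unfolding \<phi>_def by (intro continuous_intros)
  note [measurable] = L2_perD(2)[OF f]
  have meas: "(\<lambda>x. \<phi> m (torus_point x)) \<in> borel_measurable cell_lebesgue" for m
    by (intro L2_perD(2) continuous_periodic_L2_per torus_point_periodic
        continuous_on_compose2[OF cont] continuous_intros) auto
  have Kmeas: "indicator K \<in> borel_measurable cell_lebesgue"
    using compact_imp_closed[OF K(1)] by (intro measurable_cell borel_measurable_indicator) simp
  have "(\<lambda>m. LINT x|cell_lebesgue. f x * \<phi> m (torus_point x)) \<longlonglongrightarrow> (LINT x|cell_lebesgue. f x * indicator K x)"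
  proof (rule integral_dominated_convergence)
    show "(\<lambda>x. f x * indicator K x) \<in> borel_measurable cell_lebesgue"
      by (rule borel_measurable_times[OF L2_perD(2)[OF f] Kmeas])
    show "(\<lambda>x. f x * \<phi> m (torus_point x)) \<in> borel_measurable cell_lebesgue" for m
      by (rule borel_measurable_times[OF L2_perD(2)[OF f] meas])
    show "integrable cell_lebesgue (\<lambda>x. \<bar>f x\<bar>)"
      using integrable_L2_mult[OF f const_L2_per[of 1]] by simp
    show "AE x in cell_lebesgue. norm (f x * \<phi> m (torus_point x)) \<le> \<bar>f x\<bar>" for m
    proof (rule AE_I2)
      fix x
      have "\<bar>\<phi> m (torus_point x)\<bar> \<le> 1" by (simp add: \<phi>_def infdist_nonneg)
      then show "norm (f x * \<phi> m (torus_point x)) \<le> \<bar>f x\<bar>"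
        using mult_left_le[of "\<bar>\<phi> m (torus_point x)\<bar>" "\<bar>f x\<bar>"] by (simp add: abs_mult)
    qed
    show "AE x in cell_lebesgue. (\<lambda>m. f x * \<phi> m (torus_point x)) \<longlonglongrightarrow> f x * indicator K x"
    proof (rule AE_I2)
      fix x :: "real^'a" assume "x \<in> space cell_lebesgue"
      then have x: "x \<in> unit_cell" by (simp add: space_restrict_space)
      have mem: "torus_point x \<in> ?C \<longleftrightarrow> x \<in> K"
        using inj_onD[OF torus_point_inj _ x] K(2) by blast
      have "(\<lambda>m. \<phi> m (torus_point x)) \<longlonglongrightarrow> indicator K x"
      proof (cases "x \<in> K")
        case True
        then show ?thesis by (simp add: \<phi>_def infdist_zero mem)
      next
        case False
        then have pos: "infdist (torus_point x) ?C > 0"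
          using C mem in_closed_iff_infdist_zero[OF C, of "torus_point x"] infdist_nonneg[of "torus_point x" ?C] by auto
        obtain N :: nat where "1 / infdist (torus_point x) ?C < N" using reals_Archimedean2 by blast
        then have "\<phi> m (torus_point x) = 0" if "m \<ge> N" for m
        proof -
          have "1 < real N * infdist (torus_point x) ?C"
            using \<open>1 / infdist (torus_point x) ?C < N\<close> pos by (simp add: field_simps)
          also have "\<dots> \<le> real m * infdist (torus_point x) ?C"
            using that pos by (intro mult_right_mono) auto
          finally show ?thesis by (simp add: \<phi>_def)
        qed
        then have "\<forall>\<^sub>F m in sequentially. \<phi> m (torus_point x) = 0"
          by (auto simp: eventually_sequentially)
        then show ?thesis using False by (simp add: tendsto_eventually)
      qed
      then show "(\<lambda>m. f x * \<phi> m (torus_point x)) \<longlonglongrightarrow> f x * indicator K x"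
        by (intro tendsto_intros)
    qed
  qed
  moreover have "(LINT x|cell_lebesgue. f x * \<phi> m (torus_point x)) = 0" for m
    using inner_torus_continuous_zero[OF f zero cont] by (simp add: L2_inner_cell)
  ultimately show ?thesis by (simp add: LIMSEQ_const_iff)
qed simp

text \<open>By inner regularity the set where $f$ is positive is exhausted by closed sets up to small measure,
  and on each of them a positive function has integral zero.\<close>

lemma nonpos_AE_if_compact_integrals_zero:
  fixes f :: "real^'n \<Rightarrow> real"
  assumes f: "f \<in> L2_per"
    and zero: "\<And>K. compact K \<Longrightarrow> K \<subseteq> unit_cell \<Longrightarrow> (LINT x|cell_lebesgue. f x * indicator K x) = 0"
  shows "AE x in lebesgue. f x \<le> 0"
proof -
  define P where "P = {x \<in> unit_cell. f x > 0}"
  have fm: "f \<in> borel_measurable lebesgue" using f by (rule L2_perD)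
  have P: "P \<in> sets lebesgue"
  proof -
    have "P = unit_cell \<inter> (f -` {0<..} \<inter> space lebesgue)" by (auto simp: P_def)
    then show ?thesis using measurable_sets[OF fm, of "{0<..}"] by auto
  qed
  have intf: "integrable cell_lebesgue f" using integrable_L2_mult[OF f const_L2_per[of 1]] by simp
  have small: "emeasure lebesgue P < ennreal e" if e: "e > 0" for e
  proof -
    obtain T where T: "closed T" "T \<subseteq> P" "P - T \<in> lmeasurable" "emeasure lebesgue (P - T) < ennreal e"
      using sets_lebesgue_inner_closed[OF P e] by blast
    have Tc: "T \<subseteq> unit_cell" using T(2) by (auto simp: P_def)
    have "bounded T" using bounded_subset[OF bounded_box Tc[unfolded unit_cell_def]] .
    then have comp: "compact T" using T(1) compact_eq_bounded_closed by blast
    have Tset: "T \<in> sets cell_lebesgue"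
      using T(1) Tc by (simp add: sets_restrict_space_iff)
    have "T \<in> null_sets cell_lebesgue"
    proof (rule null_if_pos_func_has_zero_int[OF intf Tset])
      show "AE x\<in>T in cell_lebesgue. 0 < f x" using T(2) by (auto simp: P_def)
      show "(LINT x:T|cell_lebesgue. f x) = 0"
        using zero[OF comp Tc] by (simp add: set_lebesgue_integral_def mult.commute)
    qed
    then have "T \<in> null_sets lebesgue"
      using Tc by (simp add: null_sets_restrict_space)
    then have "emeasure lebesgue T = 0" by (rule null_setsD1)
    moreover have "emeasure lebesgue P \<le> emeasure lebesgue (P - T) + emeasure lebesgue T"
    proof -
      have "P \<subseteq> (P - T) \<union> T" by auto
      then have "emeasure lebesgue P \<le> emeasure lebesgue ((P - T) \<union> T)"
        using P T(1) by (intro emeasure_mono) auto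
      also have "\<dots> \<le> emeasure lebesgue (P - T) + emeasure lebesgue T"
        using P T(1) by (intro emeasure_subadditive) auto
      finally show ?thesis .
    qed
    ultimately show ?thesis using T(4) by simp
  qed
  have "emeasure lebesgue P = 0"
  proof (rule ccontr)
    assume "emeasure lebesgue P \<noteq> 0"
    then obtain r where r: "0 < ennreal (real_of_rat r)" "ennreal (real_of_rat r) < emeasure lebesgue P"
      using ennreal_rat_dense[of 0 "emeasure lebesgue P"] by (auto simp: zero_less_iff_neq_zero)
    from r(1) have "real_of_rat r > 0" by (simp only: ennreal_less_zero_iff)
    from less_trans[OF r(2) small[OF this]] show False by simp
  qed
  then have "AE x in lebesgue. x \<notin> P"
    using P by (intro AE_not_in) auto
  then have "AE x in cell_lebesgue. f x \<le> 0"
    unfolding AE_restrict_space_iff[OF sets_lebesgue_Int_unit_cell]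
    by eventually_elim (auto simp: P_def)
  then show ?thesis by (rule AE_periodic_from_cell[OF L2_perD(3)[OF f], of "\<lambda>y. y \<le> 0"])
qed

lemma cas_total:
  assumes f: "f \<in> L2_per" and zero: "\<And>k. k \<in> int_lattice \<Longrightarrow> L2_inner f (cas k) = 0"
  shows "AE x in lebesgue. f x = 0"
proof -
  note K = integral_compact_zero[OF f zero]
  have "AE x in lebesgue. f x \<le> 0"
    by (rule nonpos_AE_if_compact_integrals_zero[OF f K])
  moreover have "AE x in lebesgue. - f x \<le> 0"
    by (rule nonpos_AE_if_compact_integrals_zero[OF L2_per_uminus[OF f]]) (simp add: K)
  ultimately show ?thesis by eventually_elim simp
qed

section \<open>Hartley coefficients\<close>

text \<open>The coefficient of $f$ at the frequency $k$ in the Hartley system.\<close>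

definition hat :: "(real^'n \<Rightarrow> real) \<Rightarrow> real^'n \<Rightarrow> real" where
  "hat f k = L2_inner f (cas k)"

lemma hat_cls: "f \<in> L2_per \<Longrightarrow> k \<in> int_lattice \<Longrightarrow> cls f \<bullet> cls (cas k) = hat f k"
  by (simp add: hat_def inner_cls cas_L2_per)

lemma hartley_orthonormal: "orthonormal_on int_lattice (\<lambda>k. cls (cas k))"
  by (simp add: orthonormal_on_def inner_cls cas_L2_per cas_orthonormal)

lemma hartley_total:
  assumes "\<And>k. k \<in> int_lattice \<Longrightarrow> x \<bullet> cls (cas k) = 0" shows "x = 0"
proof -
  obtain f where f: "f \<in> L2_per" "x = cls f" using cls_surj .
  then have "AE y in lebesgue. f y = 0"
    using assms by (intro cas_total) (auto simp: inner_cls cas_L2_per)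
  then show ?thesis using f by (simp add: cls_zero[symmetric] cls_eq_iff)
qed

lemma hartley_parseval:
  assumes "f \<in> L2_per" "g \<in> L2_per"
  shows "((\<lambda>k. hat f k * hat g k) has_sum L2_inner f g) int_lattice"
proof -
  have "((\<lambda>k. (cls f \<bullet> cls (cas k)) * (cls g \<bullet> cls (cas k))) has_sum (cls f \<bullet> cls g)) int_lattice"
    by (rule parseval[OF hartley_orthonormal hartley_total])
  then show ?thesis
    unfolding inner_cls[OF assms]
    by (rule has_sum_cong[THEN iffD1, rotated]) (simp add: hat_cls assms)
qed

lemma hartley_riesz_fischer:
  fixes a :: "real^'n \<Rightarrow> real"
  assumes "(\<lambda>k. (a k)\<^sup>2) summable_on int_lattice"
  obtains f where "f \<in> L2_per" "\<And>k. k \<in> int_lattice \<Longrightarrow> hat f k = a k"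
proof -
  obtain x where x: "\<And>k. k \<in> int_lattice \<Longrightarrow> x \<bullet> cls (cas k) = a k"
    using riesz_fischer[OF hartley_orthonormal assms] by metis
  obtain f where f: "f \<in> L2_per" "x = cls f" using cls_surj .
  then show ?thesis using that[of f] x hat_cls by metis
qed

lemma hartley_unique:
  assumes f: "f \<in> L2_per" and g: "g \<in> L2_per" and "\<And>k. k \<in> int_lattice \<Longrightarrow> hat f k = hat g k"
  shows "AE x in lebesgue. f x = g x"
proof -
  have "cls f - cls g = 0"
    using assms by (intro hartley_total) (simp add: inner_diff_left hat_cls)
  then show ?thesis using f g by (simp add: cls_eq_iff)
qed

lemma hat_add: "f \<in> L2_per \<Longrightarrow> g \<in> L2_per \<Longrightarrow> k \<in> int_lattice \<Longrightarrow> hat (\<lambda>x. f x + c * g x) k = hat f k + c * hat g k"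
  by (simp add: hat_def L2_inner_add_left L2_per_scale cas_L2_per L2_inner_scale_left)

lemma hat_zero: "hat f 0 = (LINT x:unit_cell|lebesgue. f x)"
  by (simp add: hat_def L2_inner_def)

section \<open>Weak derivatives in terms of coefficients\<close>

lemma has_real_derivative_along_axis:
  fixes F :: "real^'n \<Rightarrow> real"
  assumes "(F has_derivative D) (at x)"
  shows "((\<lambda>t. F (x + axis i t)) has_real_derivative D (axis i 1)) (at 0)"
proof -
  have ax: "axis i t = t *\<^sub>R axis i (1::real)" for t by (simp add: vec_eq_iff axis_def)
  have "((\<lambda>t. x + t *\<^sub>R axis i (1::real)) has_derivative (\<lambda>t. t *\<^sub>R axis i 1)) (at 0)"
    by (auto intro!: derivative_eq_intros)
  moreover have "(F has_derivative D) (at (x + 0 *\<^sub>R axis i (1::real)))" using assms by simp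
  ultimately have "((\<lambda>t. F (x + t *\<^sub>R axis i 1)) has_derivative (\<lambda>t. D (t *\<^sub>R axis i 1))) (at 0)"
    by (rule has_derivative_compose)
  moreover have "(\<lambda>t. D (t *\<^sub>R axis i 1)) = (*) (D (axis i 1))"
    using linear_cmul[OF has_derivative_linear[OF assms], of _ "axis i 1"] by (simp add: fun_eq_iff)
  moreover have "(\<lambda>t. F (x + axis i t)) = (\<lambda>t. F (x + t *\<^sub>R axis i 1))"
    by (rule ext) (subst ax, rule refl)
  ultimately show ?thesis by (simp only: has_field_derivative_def)
qed

lemma Cinf_perD:
  assumes "\<eta> \<in> Cinf_per"
  shows "(\<eta> has_derivative frechet_derivative \<eta> (at x)) (at x)" "continuous_on UNIV \<eta>"
    "continuous_on UNIV (partial_deriv i \<eta>)" "lattice_periodic \<eta>" "lattice_periodic (partial_deriv i \<eta>)"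
proof -
  have C: "\<eta> \<in> Ck k" for k using assms by (simp add: Cinf_per_def)
  show d: "(\<eta> has_derivative frechet_derivative \<eta> (at x)) (at x)" for x
    using C[of "Suc 0"] by (simp add: frechet_derivative_works)
  show "continuous_on UNIV \<eta>" using C[of 0] by simp
  show "continuous_on UNIV (partial_deriv i \<eta>)" using C[of "Suc 0"] by simp
  show per: "lattice_periodic \<eta>" using assms by (simp add: Cinf_per_def lattice_periodic_def)
  have "frechet_derivative \<eta> (at (x + z)) = frechet_derivative \<eta> (at x)" if "z \<in> int_lattice" for x z
  proof -
    have "((\<lambda>y. y + z) has_derivative (\<lambda>y. y)) (at x)" by (auto intro!: derivative_eq_intros)
    from has_derivative_compose[OF this d]
    have "((\<lambda>y. \<eta> (y + z)) has_derivative frechet_derivative \<eta> (at (x + z))) (at x)" .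
    then have "(\<eta> has_derivative frechet_derivative \<eta> (at (x + z))) (at x)"
      using per that by (simp add: lattice_periodic_def)
    then show ?thesis by (rule frechet_derivative_at)
  qed
  then show "lattice_periodic (partial_deriv i \<eta>)"
    by (simp add: lattice_periodic_def partial_deriv_def)
qed

lemma Cinf_per_L2:
  assumes "\<eta> \<in> Cinf_per" shows "\<eta> \<in> L2_per" "partial_deriv i \<eta> \<in> L2_per"
  using Cinf_perD[OF assms] by (auto intro: continuous_periodic_L2_per)

lemma partial_deriv_cas: "partial_deriv i (\<lambda>x. c * cas k x) = (\<lambda>x. (c * (2 * pi * k $ i)) * cas (- k) x)"
proof
  fix x
  have "((\<lambda>x. c * cas k x) has_derivative (\<lambda>h. c * (2 * pi * (k \<bullet> h) * cas (- k) x))) (at x)"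
    by (intro has_derivative_mult_right cas_has_derivative)
  from frechet_derivative_at[OF this, symmetric]
  show "partial_deriv i (\<lambda>x. c * cas k x) x = (c * (2 * pi * k $ i)) * cas (- k) x"
    by (simp add: partial_deriv_def inner_axis)
qed

lemma cas_Ck: "(\<lambda>x. c * cas k x) \<in> Ck m"
proof (induction m arbitrary: c k)
  case 0
  show ?case by (auto intro!: continuous_intros)
next
  case (Suc m)
  have "(\<lambda>x. c * cas k x) differentiable at x" for x
    using has_derivative_mult_right[OF cas_has_derivative] by (auto simp: differentiable_def)
  then show ?case using Suc by (simp add: partial_deriv_cas)
qed

lemma cas_Cinf_per: "k \<in> int_lattice \<Longrightarrow> cas k \<in> Cinf_per"
  using cas_Ck[of 1 k] cas_periodic[of k] by (simp add: Cinf_per_def lattice_periodic_def)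

text \<open>Integration by parts against $\mathrm{cas}_k$; the boundary terms cancel because the product is periodic.\<close>

lemma hat_partial_deriv:
  assumes \<eta>: "\<eta> \<in> Cinf_per" and k: "k \<in> int_lattice"
  shows "hat (partial_deriv i \<eta>) k = - (2 * pi * k $ i) * hat \<eta> (- k)"
proof -
  note E = Cinf_perD[OF \<eta>] and L = Cinf_per_L2[OF \<eta>]
  have mk: "- k \<in> int_lattice" using k by (rule int_lattice_uminus)
  let ?F = "\<lambda>x. \<eta> x * cas k x"
  \<comment> \<open>$F\' = \partial_i (\eta\,\mathrm{cas}_k)$\<close>
  let ?F' = "\<lambda>x. partial_deriv i \<eta> x * cas k x + (2 * pi * k $ i) * (\<eta> x * cas (- k) x)"
  have "(LINT x|cell_lebesgue. ?F' x) = 0"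
  proof (rule integral_cell_derivative_zero[where F = ?F])
    show "continuous_on UNIV ?F" "continuous_on UNIV ?F'" by (intro continuous_intros E)+
    show "lattice_periodic ?F" using E(4) cas_periodic[OF k] by (simp add: lattice_periodic_def)
    fix x
    have "(?F has_derivative (\<lambda>h. \<eta> x * (2 * pi * (k \<bullet> h) * cas (- k) x)
        + frechet_derivative \<eta> (at x) h * cas k x)) (at x)"
      by (intro has_derivative_mult E(1) cas_has_derivative)
    from has_real_derivative_along_axis[OF this, of i]
    show "((\<lambda>t. ?F (x + axis i t)) has_real_derivative ?F' x) (at 0)"
      by (simp add: partial_deriv_def inner_axis algebra_simps)
  qed
  moreover have "(LINT x|cell_lebesgue. ?F' x) = hat (partial_deriv i \<eta>) k + (2 * pi * k $ i) * hat \<eta> (- k)"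
    using integrable_L2_mult[OF L(2)[of i] cas_L2_per[OF k]] integrable_L2_mult[OF L(1) cas_L2_per[OF mk]]
    by (simp add: hat_def L2_inner_cell)
  ultimately show ?thesis by simp
qed

lemma has_sum_lattice_reflect:
  "((\<lambda>k. f (- k)) has_sum s) int_lattice \<longleftrightarrow> (f has_sum s) (int_lattice :: (real^'n) set)"
  by (rule has_sum_reindex_bij_betw) (auto intro!: bij_betwI[of _ _ _ uminus] int_lattice_uminus)

lemma summable_lattice_reflect:
  "f summable_on int_lattice \<Longrightarrow> (\<lambda>k. f (- k)) summable_on (int_lattice :: (real^'n) set)"
  unfolding summable_on_def has_sum_lattice_reflect .

text \<open>Testing with $\mathrm{cas}_k$ gives the coefficients.  Conversely Parseval's identity reduces testing
  with an arbitrary smooth $\eta$ to the coefficients of $\partial_i\eta$, and the reflection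
  $k \mapsto -k$ of the lattice restores the order of the terms.\<close>

lemma has_weak_deriv_iff_hat:
  assumes v: "v \<in> L2_per" and g: "g \<in> L2_per"
  shows "has_weak_deriv i v g \<longleftrightarrow> (\<forall>k\<in>int_lattice. hat g k = - (2 * pi * k $ i) * hat v (- k))"
proof
  assume w: "has_weak_deriv i v g"
  show "\<forall>k\<in>int_lattice. hat g k = - (2 * pi * k $ i) * hat v (- k)"
  proof
    fix k :: "real^'a" assume k: "k \<in> int_lattice"
    have "L2_inner v (partial_deriv i (cas k)) = - hat g k"
      using w cas_Cinf_per[OF k] by (simp add: has_weak_deriv_def hat_def)
    moreover have "L2_inner v (partial_deriv i (cas k)) = (2 * pi * k $ i) * hat v (- k)"
      using partial_deriv_cas[of i 1 k] L2_inner_scale_left[of "2 * pi * k $ i" "cas (- k)" v]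
      by (simp add: hat_def L2_inner_commute[of v])
    ultimately show "hat g k = - (2 * pi * k $ i) * hat v (- k)" by simp
  qed
next
  assume h: "\<forall>k\<in>int_lattice. hat g k = - (2 * pi * k $ i) * hat v (- k)"
  show "has_weak_deriv i v g"
    unfolding has_weak_deriv_def
  proof
    fix \<eta> :: "real^'a \<Rightarrow> real" assume \<eta>: "\<eta> \<in> Cinf_per"
    note L = Cinf_per_L2[OF \<eta>]
    have "((\<lambda>k. hat v k * hat (partial_deriv i \<eta>) k) has_sum L2_inner v (partial_deriv i \<eta>)) int_lattice"
      by (rule hartley_parseval[OF v L(2)])
    then have "((\<lambda>k. hat v (- k) * hat (partial_deriv i \<eta>) (- k)) has_sum L2_inner v (partial_deriv i \<eta>)) int_lattice"
      by (subst has_sum_lattice_reflect)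
    moreover have "hat v (- k) * hat (partial_deriv i \<eta>) (- k) = - 1 * (hat g k * hat \<eta> k)" if "k \<in> int_lattice" for k
      using h that hat_partial_deriv[OF \<eta> int_lattice_uminus[OF that], of i] by simp
    ultimately have "((\<lambda>k. - 1 * (hat g k * hat \<eta> k)) has_sum L2_inner v (partial_deriv i \<eta>)) int_lattice"
      by (subst has_sum_cong[symmetric])
    moreover have "((\<lambda>k. - 1 * (hat g k * hat \<eta> k)) has_sum (- 1 * L2_inner g \<eta>)) int_lattice"
      by (intro has_sum_cmult_right hartley_parseval g L(1))
    ultimately have "L2_inner v (partial_deriv i \<eta>) = - 1 * L2_inner g \<eta>" by (rule has_sum_unique)
    then show "L2_inner v (partial_deriv i \<eta>) = - L2_inner g \<eta>" by simp
  qed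
qed

lemma weak_deriv_chosen:
  assumes "g \<in> L2_per" "has_weak_deriv i v g"
  shows "weak_deriv i v \<in> L2_per" "has_weak_deriv i v (weak_deriv i v)"
  using someI[of "\<lambda>g. g \<in> L2_per \<and> has_weak_deriv i v g" g] assms by (auto simp: weak_deriv_def)

section \<open>The periodic Sobolev spaces\<close>

lemma H_per_L2: "v \<in> H_per k \<Longrightarrow> v \<in> L2_per"
  by (cases k) auto

lemma H_per_lincomb:
  "u \<in> H_per k \<Longrightarrow> v \<in> H_per k \<Longrightarrow> (\<lambda>x. u x + c * v x) \<in> H_per k"
proof (induction k arbitrary: u v)
  case 0
  then show ?case by (simp add: L2_per_add L2_per_scale)
next
  case (Suc k)
  have uv: "u \<in> L2_per" "v \<in> L2_per" using Suc.prems by auto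
  have "\<exists>g\<in>H_per k. has_weak_deriv i (\<lambda>x. u x + c * v x) g" for i
  proof -
    obtain g h where gh: "g \<in> H_per k" "has_weak_deriv i u g" "h \<in> H_per k" "has_weak_deriv i v h"
      using Suc.prems by force
    have L: "g \<in> L2_per" "h \<in> L2_per" using gh H_per_L2 by auto
    have "has_weak_deriv i (\<lambda>x. u x + c * v x) (\<lambda>x. g x + c * h x)"
      using gh(2,4) uv L
      by (simp add: has_weak_deriv_iff_hat L2_per_add L2_per_scale hat_add int_lattice_uminus algebra_simps)
    then show ?thesis using Suc.IH[OF gh(1,3)] by blast
  qed
  then show ?case using uv by (simp add: L2_per_add L2_per_scale)
qed

lemma H_per0_lincomb:
  assumes "u \<in> H_per0 k" "v \<in> H_per0 k" shows "(\<lambda>x. u x + c * v x) \<in> H_per0 k"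
proof -
  have L: "u \<in> L2_per" "v \<in> L2_per" using assms H_per_L2 by (auto simp: H_per0_def)
  have "hat (\<lambda>x. u x + c * v x) 0 = hat u 0 + c * hat v 0" using L by (simp add: hat_add)
  then show ?thesis
    using assms H_per_lincomb[of u k v c] by (simp add: H_per0_def hat_zero)
qed

lemma zero_H_per: "(\<lambda>x. 0) \<in> H_per k"
proof (induction k)
  case (Suc k)
  have "has_weak_deriv i (\<lambda>x. 0) (\<lambda>x. 0)" for i by (simp add: has_weak_deriv_def L2_inner_def)
  then show ?case using Suc by auto
qed simp

lemma zero_H_per0: "(\<lambda>x. 0) \<in> H_per0 k"
  using zero_H_per by (simp add: H_per0_def)

text \<open>The derivative that membership in the Sobolev space provides and the one chosen by
  \<open>weak_deriv\<close> have the same coefficients, hence the same weak derivatives.  The two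
  reflections of the lattice in a second derivative cancel.\<close>

lemma weak_deriv_H_per2:
  assumes v: "v \<in> H_per 2"
  shows "weak_deriv j v \<in> L2_per"
    "k \<in> int_lattice \<Longrightarrow> hat (weak_deriv j v) k = - (2 * pi * k $ j) * hat v (- k)"
    "weak_deriv i (weak_deriv j v) \<in> L2_per"
    "k \<in> int_lattice \<Longrightarrow> hat (weak_deriv i (weak_deriv j v)) k = - (4 * pi\<^sup>2) * (k $ i * k $ j) * hat v k"
proof -
  have vL: "v \<in> L2_per" using v by (rule H_per_L2)
  from v have "\<exists>g\<in>H_per (Suc 0). has_weak_deriv j v g"
    unfolding numeral_2_eq_2 H_per.simps(2) by blast
  then obtain g where g: "g \<in> H_per (Suc 0)" "has_weak_deriv j v g" by blast
  have gL: "g \<in> L2_per" using g(1) by (rule H_per_L2)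
  note w = weak_deriv_chosen[OF gL g(2)]
  show w1: "weak_deriv j v \<in> L2_per" by (rule w)
  show h1: "hat (weak_deriv j v) k = - (2 * pi * k $ j) * hat v (- k)" if "k \<in> int_lattice" for k
    using w(2) that has_weak_deriv_iff_hat[OF vL w(1)] by blast
  have hg: "hat g k = - (2 * pi * k $ j) * hat v (- k)" if "k \<in> int_lattice" for k
    using g(2) that has_weak_deriv_iff_hat[OF vL gL] by blast
  from g(1) obtain h where h: "h \<in> L2_per" "has_weak_deriv i g h" by auto
  have "has_weak_deriv i (weak_deriv j v) h"
    using h h1 hg has_weak_deriv_iff_hat[OF gL h(1)] has_weak_deriv_iff_hat[OF w1 h(1)]
    by (simp add: int_lattice_uminus)
  note w2 = weak_deriv_chosen[OF h(1) this]
  show "weak_deriv i (weak_deriv j v) \<in> L2_per" by (rule w2)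
  show "hat (weak_deriv i (weak_deriv j v)) k = - (4 * pi\<^sup>2) * (k $ i * k $ j) * hat v k" if "k \<in> int_lattice" for k
    using w2 that has_weak_deriv_iff_hat[OF w1 w2(1)] h1[OF int_lattice_uminus[OF that]]
    by (simp add: power2_eq_square algebra_simps)
qed

lemma weak_deriv2_lincomb:
  assumes u: "u \<in> H_per 2" and v: "v \<in> H_per 2"
  shows "AE x in lebesgue. weak_deriv i (weak_deriv j (\<lambda>x. u x + c * v x)) x
    = weak_deriv i (weak_deriv j u) x + c * weak_deriv i (weak_deriv j v) x"
proof (rule hartley_unique)
  note uv = H_per_lincomb[OF u v, of c]
  note [simp] = weak_deriv_H_per2[OF u] weak_deriv_H_per2[OF v] weak_deriv_H_per2[OF uv]
    H_per_L2[OF u] H_per_L2[OF v]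
  show "weak_deriv i (weak_deriv j (\<lambda>x. u x + c * v x)) \<in> L2_per" by simp
  show "(\<lambda>x. weak_deriv i (weak_deriv j u) x + c * weak_deriv i (weak_deriv j v) x) \<in> L2_per"
    by (simp add: L2_per_add L2_per_scale)
  fix k :: "real^'a" assume "k \<in> int_lattice"
  then show "hat (weak_deriv i (weak_deriv j (\<lambda>x. u x + c * v x))) k
    = hat (\<lambda>x. weak_deriv i (weak_deriv j u) x + c * weak_deriv i (weak_deriv j v) x) k"
    by (simp add: hat_add algebra_simps)
qed

lemma hessian_lincomb:
  assumes u: "u \<in> H_per 2" and v: "v \<in> H_per 2"
  shows "AE x in lebesgue. hessian (\<lambda>x. u x + c * v x) x = hessian u x + c *\<^sub>R hessian v x"
proof -
  have "AE x in lebesgue. \<forall>i j. weak_deriv i (weak_deriv j (\<lambda>x. u x + c * v x)) x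
    = weak_deriv i (weak_deriv j u) x + c * weak_deriv i (weak_deriv j v) x"
    unfolding AE_all_countable using weak_deriv2_lincomb[OF u v] by blast
  then show ?thesis by eventually_elim (simp add: hessian_def vec_eq_iff)
qed

lemma laplacian_eq_inner: "laplacian v x = mat 1 \<bullet> hessian v x"
  by (simp add: laplacian_def hessian_def inner_vec_def mat_def if_distrib[of "\<lambda>a. a * _"] cong: if_cong)

lemma hat_sum:
  assumes "finite I" "\<And>i. i \<in> I \<Longrightarrow> f i \<in> L2_per" "k \<in> int_lattice"
  shows "hat (\<lambda>x. \<Sum>i\<in>I. f i x) k = (\<Sum>i\<in>I. hat (f i) k)"
  using assms(1,2)
proof (induction I rule: finite_induct)
  case empty
  then show ?case by (simp add: hat_def L2_inner_def)
next
  case (insert i I)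
  then show ?case
    using hat_add[of "f i" "\<lambda>x. \<Sum>i\<in>I. f i x" k 1] assms(3) by (simp add: L2_per_sum)
qed

lemma laplacian_H_per2:
  assumes v: "v \<in> H_per 2"
  shows "laplacian v \<in> L2_per"
    "k \<in> int_lattice \<Longrightarrow> hat (laplacian v) k = - (4 * pi\<^sup>2) * (norm k)\<^sup>2 * hat v k"
proof -
  have eq: "laplacian v = (\<lambda>x. \<Sum>i\<in>UNIV. weak_deriv i (weak_deriv i v) x)"
    by (rule ext) (simp add: laplacian_def)
  show "laplacian v \<in> L2_per"
    unfolding eq by (intro L2_per_sum weak_deriv_H_per2[OF v]) simp
  assume k: "k \<in> int_lattice"
  have "hat (laplacian v) k = (\<Sum>i\<in>UNIV. - (4 * pi\<^sup>2) * (k $ i * k $ i) * hat v k)"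
    unfolding eq using weak_deriv_H_per2[OF v] k by (simp add: hat_sum)
  also have "\<dots> = - (4 * pi\<^sup>2) * (\<Sum>i\<in>UNIV. k $ i * k $ i) * hat v k"
    by (simp only: sum_distrib_left sum_distrib_right)
  finally show "hat (laplacian v) k = - (4 * pi\<^sup>2) * (norm k)\<^sup>2 * hat v k"
    by (simp add: power2_norm_eq_inner inner_vec_def)
qed

section \<open>The Laplacian on the torus\<close>

lemma has_sum_finite_sum:
  fixes f :: "'i \<Rightarrow> 'k \<Rightarrow> real"
  assumes "finite I" "\<And>i. i \<in> I \<Longrightarrow> (f i has_sum s i) A"
  shows "((\<lambda>k. \<Sum>i\<in>I. f i k) has_sum (\<Sum>i\<in>I. s i)) A"
  using assms by (induction I rule: finite_induct) (auto intro: has_sum_add)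

text \<open>Totality enters once: the element that has the coefficients of $x$ by Riesz-Fischer differs from
  $x$ by something orthogonal to the whole system.\<close>

lemma parseval_square:
  assumes "f \<in> L2_per" shows "((\<lambda>k. (hat f k)\<^sup>2) has_sum (L2_norm f)\<^sup>2) int_lattice"
  using hartley_parseval[OF assms assms] by (simp add: power2_eq_square L2_norm_def L2_inner_cell)

text \<open>In coefficients, $\sum_{i,j} (k_i k_j)^2 = |k|^4$.\<close>

lemma hessian_norm_eq_laplacian_norm:
  assumes v: "v \<in> H_per 2"
  shows "(\<Sum>i\<in>UNIV. \<Sum>j\<in>UNIV. (L2_norm (weak_deriv i (weak_deriv j v)))\<^sup>2) = (L2_norm (laplacian v))\<^sup>2"
proof -
  let ?D = "\<lambda>i j. weak_deriv i (weak_deriv j v)"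
  have "((\<lambda>k. \<Sum>i\<in>UNIV. \<Sum>j\<in>UNIV. (hat (?D i j) k)\<^sup>2) has_sum
      (\<Sum>i\<in>UNIV. \<Sum>j\<in>UNIV. (L2_norm (?D i j))\<^sup>2)) int_lattice"
    by (intro has_sum_finite_sum parseval_square weak_deriv_H_per2[OF v]) auto
  moreover have "(\<Sum>i\<in>UNIV. \<Sum>j\<in>UNIV. (hat (?D i j) k)\<^sup>2) = (hat (laplacian v) k)\<^sup>2" if "k \<in> int_lattice" for k
  proof -
    have "(\<Sum>i\<in>UNIV. \<Sum>j\<in>UNIV. (hat (?D i j) k)\<^sup>2)
      = (\<Sum>i\<in>UNIV. \<Sum>j\<in>UNIV. (4 * pi\<^sup>2 * hat v k)\<^sup>2 * ((k $ i)\<^sup>2 * (k $ j)\<^sup>2))"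
      using that by (simp add: weak_deriv_H_per2[OF v] power_mult_distrib algebra_simps)
    also have "\<dots> = (4 * pi\<^sup>2 * hat v k)\<^sup>2 * ((\<Sum>i\<in>UNIV. (k $ i)\<^sup>2) * (\<Sum>j\<in>UNIV. (k $ j)\<^sup>2))"
      by (simp only: sum_distrib_left[symmetric] sum_distrib_right[symmetric])
    also have "(\<Sum>i\<in>UNIV. (k $ i)\<^sup>2) = (norm k)\<^sup>2"
      unfolding power2_norm_eq_inner inner_vec_def by (simp add: power2_eq_square)
    finally show ?thesis
      using that by (simp add: laplacian_H_per2[OF v] power_mult_distrib power2_eq_square algebra_simps)
  qed
  ultimately have "((\<lambda>k. (hat (laplacian v) k)\<^sup>2) has_sum
      (\<Sum>i\<in>UNIV. \<Sum>j\<in>UNIV. (L2_norm (?D i j))\<^sup>2)) int_lattice"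
    by (subst has_sum_cong[symmetric])
  then show ?thesis
    using parseval_square[OF laplacian_H_per2(1)[OF v]] by (rule has_sum_unique)
qed

lemma int_lattice_norm_ge_1:
  assumes "k \<in> int_lattice" "k \<noteq> 0" shows "1 \<le> norm k"
proof -
  obtain i where i: "k $ i \<noteq> 0" using assms(2) by (auto simp: vec_eq_iff)
  obtain n where n: "k $ i = of_int n" using assms(1) by (auto simp: int_lattice_def elim: Ints_cases)
  have "1 \<le> \<bar>k $ i\<bar>" using i by (simp add: n)
  then show ?thesis using component_le_norm_cart[of k i] by linarith
qed

lemma int_lattice_component_le:
  assumes "k \<in> int_lattice" shows "\<bar>k $ i\<bar> \<le> (norm k)\<^sup>2"
proof (cases "k = 0")
  case False
  then have "norm k * 1 \<le> norm k * norm k"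
    using int_lattice_norm_ge_1[OF assms] by (intro mult_left_mono) auto
  then show ?thesis using component_le_norm_cart[of k i] by (simp add: power2_eq_square)
qed simp

lemma one_le_four_pi_square: "1 \<le> 4 * pi\<^sup>2"
proof -
  have "1 \<le> pi\<^sup>2" using pi_gt3 by (intro one_le_power) auto
  then show ?thesis by simp
qed

lemma two_pi_le_four_pi_square: "2 * pi \<le> 4 * pi\<^sup>2"
proof -
  have "pi * 1 \<le> pi * pi" using pi_gt3 by (intro mult_left_mono) auto
  then show ?thesis by (simp add: power2_eq_square)
qed

text \<open>Without the zero frequency the symbol of the Laplacian is at least $4\pi^2|k|^2 \ge 1$, and it
  dominates the symbol $2\pi|k_j|$ of a first derivative because $|k_j| \le |k|^2$ on the lattice.\<close>

lemma poincare_H_per0_2: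
  assumes v: "v \<in> H_per0 2"
  shows "L2_norm v \<le> L2_norm (laplacian v)" "L2_norm (weak_deriv j v) \<le> L2_norm (laplacian v)"
proof -
  have vH: "v \<in> H_per 2" and v0: "hat v 0 = 0" using v by (auto simp: H_per0_def hat_zero)
  note L = laplacian_H_per2[OF vH] and W = weak_deriv_H_per2[OF vH]
  have sq: "L2_norm f \<le> L2_norm (laplacian v)" if "(L2_norm f)\<^sup>2 \<le> (L2_norm (laplacian v))\<^sup>2" for f
    using that by (rule power2_le_imp_le) (simp add: L2_norm_def L2_inner_cell)
  show "L2_norm v \<le> L2_norm (laplacian v)"
  proof (rule sq, rule has_sum_mono[OF parseval_square[OF H_per_L2[OF vH]] parseval_square[OF L(1)]])
    fix k :: "real^'a" assume k: "k \<in> int_lattice"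
    show "(hat v k)\<^sup>2 \<le> (hat (laplacian v) k)\<^sup>2"
    proof (cases "k = 0")
      case False
      have "1 * 1 \<le> 4 * pi\<^sup>2 * (norm k)\<^sup>2"
        using one_le_four_pi_square int_lattice_norm_ge_1[OF k False] by (intro mult_mono one_le_power) auto
      then have "1 * \<bar>hat v k\<bar> \<le> (4 * pi\<^sup>2 * (norm k)\<^sup>2) * \<bar>hat v k\<bar>" by (intro mult_right_mono) auto
      then have "\<bar>hat v k\<bar> \<le> \<bar>hat (laplacian v) k\<bar>" by (simp add: L(2)[OF k] abs_mult)
      then show ?thesis by (rule abs_le_square_iff[THEN iffD1])
    qed (simp add: v0)
  qed
  show "L2_norm (weak_deriv j v) \<le> L2_norm (laplacian v)"
  proof (rule sq, rule has_sum_mono[OF parseval_square[OF W(1)]])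
    show "((\<lambda>k. (hat (laplacian v) (- k))\<^sup>2) has_sum (L2_norm (laplacian v))\<^sup>2) int_lattice"
      using parseval_square[OF L(1)] by (subst has_sum_lattice_reflect)
    fix k :: "real^'a" assume k: "k \<in> int_lattice"
    have "2 * pi * \<bar>k $ j\<bar> \<le> 4 * pi\<^sup>2 * (norm k)\<^sup>2"
      using mult_mono[OF two_pi_le_four_pi_square int_lattice_component_le[OF k]] by simp
    then have "(2 * pi * \<bar>k $ j\<bar>) * \<bar>hat v (- k)\<bar> \<le> (4 * pi\<^sup>2 * (norm k)\<^sup>2) * \<bar>hat v (- k)\<bar>"
      by (intro mult_right_mono) auto
    then have "\<bar>hat (weak_deriv j v) k\<bar> \<le> \<bar>hat (laplacian v) (- k)\<bar>"
      by (simp add: W(2)[OF k] L(2)[OF int_lattice_uminus[OF k]] abs_mult)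
    then show "(hat (weak_deriv j v) k)\<^sup>2 \<le> (hat (laplacian v) (- k))\<^sup>2"
      by (rule abs_le_square_iff[THEN iffD1])
  qed
qed

lemma L2_norm_nonneg: "0 \<le> L2_norm f"
  by (simp add: L2_norm_def L2_inner_cell)

lemma H2_norm_le_laplacian:
  assumes v: "(v :: real^'n \<Rightarrow> real) \<in> H_per0 2"
  shows "H2_norm v \<le> sqrt (2 + real CARD('n)) * L2_norm (laplacian v)"
proof -
  have vH: "v \<in> H_per 2" using v by (simp add: H_per0_def)
  let ?L = "(L2_norm (laplacian v))\<^sup>2"
  have "(L2_norm v)\<^sup>2 \<le> ?L" using poincare_H_per0_2(1)[OF v] by (intro power_mono L2_norm_nonneg)
  moreover have "(\<Sum>i\<in>UNIV. (L2_norm (weak_deriv i v))\<^sup>2) \<le> (\<Sum>i\<in>(UNIV::'n set). ?L)"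
    using poincare_H_per0_2(2)[OF v] by (intro sum_mono power_mono L2_norm_nonneg)
  ultimately have "H2_norm v \<le> sqrt ((2 + real CARD('n)) * ?L)"
    unfolding H2_norm_def hessian_norm_eq_laplacian_norm[OF vH]
    by (intro real_sqrt_le_mono) (simp add: algebra_simps)
  then show ?thesis by (simp add: real_sqrt_mult L2_norm_nonneg)
qed

text \<open>Riesz-Fischer produces functions with the coefficients that the first and second derivatives ought
  to have; the coefficient criterion identifies them as weak derivatives.\<close>

lemma H_per_2I:
  assumes v: "v \<in> L2_per" and summ: "(\<lambda>k. ((norm k)\<^sup>2 * hat v k)\<^sup>2) summable_on int_lattice"
  shows "v \<in> H_per 2"
proof -
  let ?s = "\<lambda>k. (4 * pi\<^sup>2)\<^sup>2 * ((norm k)\<^sup>2 * hat v k)\<^sup>2"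
  have S: "?s summable_on int_lattice" using summ by (rule summable_on_cmult_right)
  have "\<exists>g. g \<in> L2_per \<and> has_weak_deriv i v g \<and> (\<forall>j. \<exists>h\<in>L2_per. has_weak_deriv j g h)" for i
  proof -
    have "(\<lambda>k. (- (2 * pi * k $ i) * hat v (- k))\<^sup>2) summable_on int_lattice"
    proof (rule summable_on_comparison_test[OF summable_lattice_reflect[OF S]])
      fix k :: "real^'a" assume k: "k \<in> int_lattice"
      have "2 * pi * \<bar>k $ i\<bar> \<le> 4 * pi\<^sup>2 * (norm k)\<^sup>2"
        using mult_mono[OF two_pi_le_four_pi_square int_lattice_component_le[OF k]] by simp
      then have "(2 * pi * \<bar>k $ i\<bar>) * \<bar>hat v (- k)\<bar> \<le> (4 * pi\<^sup>2 * (norm k)\<^sup>2) * \<bar>hat v (- k)\<bar>"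
        by (intro mult_right_mono) auto
      then have "\<bar>- (2 * pi * k $ i) * hat v (- k)\<bar> \<le> \<bar>4 * pi\<^sup>2 * ((norm k)\<^sup>2 * hat v (- k))\<bar>"
        by (simp add: abs_mult)
      then have "(- (2 * pi * k $ i) * hat v (- k))\<^sup>2 \<le> (4 * pi\<^sup>2 * ((norm k)\<^sup>2 * hat v (- k)))\<^sup>2"
        by (rule abs_le_square_iff[THEN iffD1])
      then show "(- (2 * pi * k $ i) * hat v (- k))\<^sup>2 \<le> (4 * pi\<^sup>2)\<^sup>2 * ((norm (- k))\<^sup>2 * hat v (- k))\<^sup>2"
        by (simp only: power_mult_distrib[of "4 * pi\<^sup>2"] norm_minus_cancel)
    qed simp
    then obtain g where g: "g \<in> L2_per" "\<And>k. k \<in> int_lattice \<Longrightarrow> hat g k = - (2 * pi * k $ i) * hat v (- k)"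
      by (rule hartley_riesz_fischer) blast
    have "\<exists>h\<in>L2_per. has_weak_deriv j g h" for j
    proof -
      have "(\<lambda>k. (- (2 * pi * k $ j) * hat g (- k))\<^sup>2) summable_on int_lattice"
      proof (rule summable_on_comparison_test[OF S])
        fix k :: "real^'a" assume k: "k \<in> int_lattice"
        have "\<bar>k $ i\<bar> * \<bar>k $ j\<bar> \<le> norm k * norm k"
          by (intro mult_mono component_le_norm_cart) auto
        then have "(4 * pi\<^sup>2) * ((\<bar>k $ i\<bar> * \<bar>k $ j\<bar>) * \<bar>hat v k\<bar>) \<le> (4 * pi\<^sup>2) * ((norm k * norm k) * \<bar>hat v k\<bar>)"
          by (intro mult_left_mono mult_right_mono) auto
        then have "\<bar>- (2 * pi * k $ j) * hat g (- k)\<bar> \<le> \<bar>4 * pi\<^sup>2 * ((norm k)\<^sup>2 * hat v k)\<bar>"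
          by (simp add: g(2)[OF int_lattice_uminus[OF k]] abs_mult power2_eq_square ac_simps)
        then have "(- (2 * pi * k $ j) * hat g (- k))\<^sup>2 \<le> (4 * pi\<^sup>2 * ((norm k)\<^sup>2 * hat v k))\<^sup>2"
          by (rule abs_le_square_iff[THEN iffD1])
        then show "(- (2 * pi * k $ j) * hat g (- k))\<^sup>2 \<le> (4 * pi\<^sup>2)\<^sup>2 * ((norm k)\<^sup>2 * hat v k)\<^sup>2"
          by (simp only: power_mult_distrib[of "4 * pi\<^sup>2"])
      qed simp
      then obtain h where h: "h \<in> L2_per" "\<And>k. k \<in> int_lattice \<Longrightarrow> hat h k = - (2 * pi * k $ j) * hat g (- k)"
        by (rule hartley_riesz_fischer) blast
      then show ?thesis using has_weak_deriv_iff_hat[OF g(1) h(1)] by blast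
    qed
    then show ?thesis using g has_weak_deriv_iff_hat[OF v g(1)] by blast
  qed
  then show ?thesis using v unfolding numeral_2_eq_2 H_per.simps by blast
qed

lemma abs_le_if_scaled_eq:
  fixes x y c :: real
  assumes "1 \<le> c" "c * x = - y" shows "\<bar>x\<bar> \<le> \<bar>y\<bar>"
proof -
  have "1 * \<bar>x\<bar> \<le> c * \<bar>x\<bar>" using assms(1) by (intro mult_right_mono) auto
  also have "\<dots> = \<bar>c * x\<bar>" using assms(1) by (simp add: abs_mult)
  finally show ?thesis by (simp add: assms(2))
qed

text \<open>Divide the coefficients by $-4\pi^2|k|^2$.  The mean value condition takes care of $k = 0$, where
  division by zero gives the coefficient $0$ that $v$ should have.\<close>

lemma poisson_solvable:
  assumes d: "d \<in> L2_per" and mean: "(LINT x:unit_cell|lebesgue. d x) = 0"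
  obtains v where "v \<in> H_per0 2" "AE x in lebesgue. laplacian v x = d x"
proof -
  define a where "a k = - hat d k / (4 * pi\<^sup>2 * (norm k)\<^sup>2)" for k :: "real^'a"
  have d0: "hat d 0 = 0" using mean by (simp add: hat_zero)
  have a_scale: "4 * pi\<^sup>2 * (norm k)\<^sup>2 * a k = - hat d k" for k
    by (cases "k = 0") (auto simp: a_def d0)
  have D: "(\<lambda>k. (hat d k)\<^sup>2) summable_on int_lattice"
    using parseval_square[OF d] summable_on_def by blast
  have ge1: "1 \<le> 4 * pi\<^sup>2 * (norm k)\<^sup>2" if "k \<in> int_lattice" "k \<noteq> 0" for k :: "real^'a"
    using mult_mono[OF one_le_four_pi_square one_le_power[OF int_lattice_norm_ge_1[OF that], of 2]] by simp
  have "(\<lambda>k. (a k)\<^sup>2) summable_on int_lattice"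
  proof (rule summable_on_comparison_test[OF D])
    fix k :: "real^'a" assume k: "k \<in> int_lattice"
    have "\<bar>a k\<bar> \<le> \<bar>hat d k\<bar>"
    proof (cases "k = 0")
      case True then show ?thesis by (simp add: a_def)
    next
      case False
      show ?thesis by (rule abs_le_if_scaled_eq[OF ge1[OF k False] a_scale])
    qed
    then show "(a k)\<^sup>2 \<le> (hat d k)\<^sup>2" by (rule abs_le_square_iff[THEN iffD1])
  qed simp
  then obtain v where v: "v \<in> L2_per" "\<And>k. k \<in> int_lattice \<Longrightarrow> hat v k = a k"
    by (rule hartley_riesz_fischer) blast
  have vH: "v \<in> H_per 2"
  proof (rule H_per_2I[OF v(1)], rule summable_on_comparison_test[OF D])
    fix k :: "real^'a" assume k: "k \<in> int_lattice"
    have "4 * pi\<^sup>2 * ((norm k)\<^sup>2 * hat v k) = - hat d k"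
      using a_scale[of k] v(2)[OF k] by (simp add: mult.assoc)
    then have "\<bar>(norm k)\<^sup>2 * hat v k\<bar> \<le> \<bar>hat d k\<bar>"
      by (rule abs_le_if_scaled_eq[OF one_le_four_pi_square])
    then show "((norm k)\<^sup>2 * hat v k)\<^sup>2 \<le> (hat d k)\<^sup>2" by (rule abs_le_square_iff[THEN iffD1])
  qed simp
  have "hat v 0 = 0" using v(2)[of 0] by (simp add: a_def)
  then have "v \<in> H_per0 2" using vH by (simp add: H_per0_def hat_zero)
  moreover have "AE x in lebesgue. laplacian v x = d x"
    by (rule hartley_unique[OF laplacian_H_per2(1)[OF vH] d])
      (use laplacian_H_per2(2)[OF vH] v(2) a_scale in simp)
  ultimately show ?thesis using that by blast
qed

section \<open>Operators in nondivergence form\<close>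

lemma entry_Linf_per:
  fixes M :: "real^'n \<Rightarrow> real^'n^'n"
  assumes "M \<in> Linf_per" shows "(\<lambda>x. M x $ i $ j) \<in> Linf_per"
proof -
  obtain C where M: "M \<in> borel_measurable lebesgue" "ae_periodic M" "AE x in lebesgue. norm (M x) \<le> C"
    using Linf_perD[OF assms] .
  have "(\<lambda>P :: real^'n^'n. P $ i $ j) \<in> borel_measurable borel"
    by (intro borel_measurable_continuous_onI continuous_intros)
  then have "(\<lambda>x. M x $ i $ j) \<in> borel_measurable lebesgue"
    by (rule measurable_compose[OF M(1)])
  moreover have "AE x in lebesgue. norm (M x $ i $ j) \<le> C"
    using M(3)
  proof eventually_elim
    case (elim x)
    have "norm (M x $ i $ j) \<le> norm (M x $ i)" by (rule Finite_Cartesian_Product.norm_nth_le)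
    also have "\<dots> \<le> norm (M x)" by (rule Finite_Cartesian_Product.norm_nth_le)
    finally show ?case using elim by simp
  qed
  ultimately show ?thesis
    using ae_periodic_comp[OF M(2), of "\<lambda>P. P $ i $ j"] by (auto simp: Linf_per_def)
qed

lemma contraction_hessian_L2_per:
  assumes M: "M \<in> Linf_per" and v: "v \<in> H_per 2"
  shows "(\<lambda>x. M x \<bullet> hessian v x) \<in> L2_per"
  unfolding matrix_inner_eq hessian_def vec_lambda_beta
  by (intro L2_per_sum L2_per_mult_bounded entry_Linf_per M weak_deriv_H_per2[OF v]) auto

text \<open>Pointwise Cauchy-Schwarz for the Frobenius product, followed by $\|D^2 v\| = \|\Delta v\|$.\<close>

lemma contraction_hessian_bound:
  assumes M: "M \<in> Linf_per" and v: "v \<in> H_per 2"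
    and c: "0 \<le> c" "AE x in lebesgue. norm (M x) \<le> c"
  shows "L2_norm (\<lambda>x. M x \<bullet> hessian v x) \<le> c * L2_norm (laplacian v)"
proof -
  let ?D = "\<lambda>i j. weak_deriv i (weak_deriv j v)"
  note D = weak_deriv_H_per2(3)[OF v]
  let ?S = "\<lambda>x. \<Sum>i\<in>UNIV. \<Sum>j\<in>UNIV. (?D i j x)\<^sup>2"
  note Mv = contraction_hessian_L2_per[OF M v]
  have S: "integrable cell_lebesgue ?S"
    by (intro Bochner_Integration.integrable_sum L2_perD(4) D)
  have "(LINT x|cell_lebesgue. (M x \<bullet> hessian v x)\<^sup>2) \<le> (LINT x|cell_lebesgue. c\<^sup>2 * ?S x)"
  proof (rule integral_mono_AE)
    show "integrable cell_lebesgue (\<lambda>x. (M x \<bullet> hessian v x)\<^sup>2)" using Mv by (rule L2_perD)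
    show "integrable cell_lebesgue (\<lambda>x. c\<^sup>2 * ?S x)" using S by simp
    show "AE x in cell_lebesgue. (M x \<bullet> hessian v x)\<^sup>2 \<le> c\<^sup>2 * ?S x"
      using AE_cell[OF c(2)]
    proof eventually_elim
      case (elim x)
      have "\<bar>M x \<bullet> hessian v x\<bar> \<le> norm (M x) * norm (hessian v x)" by (rule Cauchy_Schwarz_ineq2)
      also have "\<dots> \<le> c * norm (hessian v x)" using elim by (intro mult_right_mono) auto
      finally have "(M x \<bullet> hessian v x)\<^sup>2 \<le> (c * norm (hessian v x))\<^sup>2"
        using power_mono[of "\<bar>M x \<bullet> hessian v x\<bar>" _ 2] by simp
      also have "\<dots> = c\<^sup>2 * ?S x"
        unfolding power_mult_distrib power2_norm_eq_inner matrix_inner_eq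
        by (simp add: hessian_def power2_eq_square)
      finally show ?case .
    qed
  qed
  also have "\<dots> = c\<^sup>2 * (\<Sum>i\<in>UNIV. \<Sum>j\<in>UNIV. (LINT x|cell_lebesgue. (?D i j x)\<^sup>2))"
    using L2_perD(4)[OF D] by (simp add: Bochner_Integration.integral_sum)
  also have "\<dots> = c\<^sup>2 * (\<Sum>i\<in>UNIV. \<Sum>j\<in>UNIV. (L2_norm (?D i j))\<^sup>2)"
    by (simp add: L2_norm_def L2_inner_cell power2_eq_square)
  also have "\<dots> = (c * L2_norm (laplacian v))\<^sup>2"
    by (simp only: hessian_norm_eq_laplacian_norm[OF v] power_mult_distrib)
  finally have "(L2_norm (\<lambda>x. M x \<bullet> hessian v x))\<^sup>2 \<le> (c * L2_norm (laplacian v))\<^sup>2"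
    by (simp add: L2_norm_def L2_inner_cell power2_eq_square)
  then show ?thesis by (rule power2_le_imp_le[OF _ mult_nonneg_nonneg[OF c(1) L2_norm_nonneg]])
qed

lemma cls_contraction_hessian_lincomb:
  assumes M: "M \<in> Linf_per" and u: "u \<in> H_per 2" and v: "v \<in> H_per 2"
  shows "cls (\<lambda>x. M x \<bullet> hessian (\<lambda>x. u x + c * v x) x)
    = cls (\<lambda>x. M x \<bullet> hessian u x) + c *\<^sub>R cls (\<lambda>x. M x \<bullet> hessian v x)"
proof -
  note L = contraction_hessian_L2_per[OF M]
  have "cls (\<lambda>x. M x \<bullet> hessian (\<lambda>x. u x + c * v x) x) = cls (\<lambda>x. M x \<bullet> hessian u x + c * (M x \<bullet> hessian v x))"
  proof (subst cls_eq_iff)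
    show "AE x in lebesgue. M x \<bullet> hessian (\<lambda>x. u x + c * v x) x = M x \<bullet> hessian u x + c * (M x \<bullet> hessian v x)"
      using hessian_lincomb[OF u v, of c] by eventually_elim (simp add: inner_add_right)
  qed (intro L L2_per_add L2_per_scale H_per_lincomb u v)+
  then show ?thesis using L[OF u] L[OF v] by (simp add: cls_add cls_scale L2_per_scale)
qed

lemma const_Linf_per: "(\<lambda>x. P) \<in> Linf_per"
  by (auto simp: Linf_per_def ae_periodic_def)

lemma cls_laplacian_lincomb:
  assumes "u \<in> H_per 2" "v \<in> H_per 2"
  shows "cls (laplacian (\<lambda>x. u x + c * v x)) = cls (laplacian u) + c *\<^sub>R cls (laplacian v)"
  using cls_contraction_hessian_lincomb[OF const_Linf_per assms, of "mat 1" c]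
  by (simp add: laplacian_eq_inner[abs_def])

lemma cls_laplacian_diff:
  assumes "u \<in> H_per 2" "v \<in> H_per 2"
  shows "cls (laplacian (\<lambda>x. u x - v x)) = cls (laplacian u) - cls (laplacian v)"
  using cls_laplacian_lincomb[OF assms, of "-1"] by simp

lemma H_per0_diff: "u \<in> H_per0 k \<Longrightarrow> v \<in> H_per0 k \<Longrightarrow> (\<lambda>x. u x - v x) \<in> H_per0 k"
  using H_per0_lincomb[of u k v "-1"] by simp

lemma H_per0_imp_H_per: "v \<in> H_per0 k \<Longrightarrow> v \<in> H_per k"
  by (simp add: H_per0_def)

text \<open>Uniqueness for the dual problem is found at the level of Laplacians; this brings it back to the
  functions themselves.\<close>

lemma laplacian_determines_H_per0_2:
  assumes u: "u \<in> H_per0 2" and v: "v \<in> H_per0 2" and eq: "cls (laplacian u) = cls (laplacian v)"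
  shows "AE x in lebesgue. u x = v x"
proof -
  note uH = H_per0_imp_H_per[OF u] and vH = H_per0_imp_H_per[OF v]
  note d = H_per0_diff[OF u v]
  have "L2_norm (laplacian (\<lambda>x. u x - v x)) = norm (cls (laplacian (\<lambda>x. u x - v x)))"
    by (intro norm_cls[symmetric] laplacian_H_per2 H_per0_imp_H_per d)
  also have "\<dots> = 0" by (simp add: cls_laplacian_diff uH vH eq)
  finally have "norm (cls (\<lambda>x. u x - v x)) \<le> 0"
    using poincare_H_per0_2(1)[OF d] norm_cls[OF H_per_L2[OF H_per0_imp_H_per[OF d]]] by simp
  then have "cls u = cls v"
    using H_per_L2[OF uH] H_per_L2[OF vH] by (simp add: cls_diff)
  then show ?thesis using H_per_L2[OF uH] H_per_L2[OF vH] by (simp add: cls_eq_iff)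
qed

section \<open>The dual problem\<close>

lemma mean_eq_inner_one: "f \<in> L2_per \<Longrightarrow> (LINT x:unit_cell|lebesgue. f x) = cls f \<bullet> cls (\<lambda>x. 1)"
  by (simp add: inner_cls integral_cell_eq_inner)

lemma laplacian_mean_zero: "v \<in> H_per 2 \<Longrightarrow> cls (laplacian v) \<bullet> cls (\<lambda>x. 1) = 0"
  by (simp add: mean_eq_inner_one[OF laplacian_H_per2(1), symmetric] hat_zero[symmetric] laplacian_H_per2(2))

text \<open>Existence for Poisson's equation in terms of classes: orthogonality to constants characterises
  the Laplacians.\<close>

lemma mean_zero_is_laplacian:
  assumes "w \<bullet> cls (\<lambda>x. 1) = 0"
  obtains v where "v \<in> H_per0 2" "cls (laplacian v) = w"
proof -
  obtain d where d: "d \<in> L2_per" "w = cls d" using cls_surj .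
  then have "(LINT x:unit_cell|lebesgue. d x) = 0" using assms by (simp add: mean_eq_inner_one)
  then obtain v where v: "v \<in> H_per0 2" "AE x in lebesgue. laplacian v x = d x"
    using poisson_solvable[OF d(1)] by blast
  then have "cls (laplacian v) = w"
    using d(2) cls_eq_iff[OF laplacian_H_per2(1)[OF H_per0_imp_H_per[OF v(1)]] d(1)] by simp
  with v(1) show ?thesis using that by blast
qed

lemma closed_subspaceD:
  assumes "closed_subspace_H2_per0 V"
  shows "v \<in> V \<Longrightarrow> v \<in> H_per0 2" "(\<lambda>x. 0) \<in> V"
    "u \<in> V \<Longrightarrow> v \<in> V \<Longrightarrow> (\<lambda>x. u x + v x) \<in> V" "v \<in> V \<Longrightarrow> (\<lambda>x. c * v x) \<in> V"
    "(\<And>k::nat. f k \<in> V) \<Longrightarrow> v \<in> H_per0 2 \<Longrightarrow> (\<lambda>k. H2_norm (\<lambda>x. f k x - v x)) \<longlonglongrightarrow> 0 \<Longrightarrow> v \<in> V"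
  using assms unfolding closed_subspace_H2_per0_def by blast+

lemma closed_subspace_whole: "closed_subspace_H2_per0 (H_per0 2)"
  unfolding closed_subspace_H2_per0_def
proof (intro conjI ballI allI)
  fix u v :: "real^'n \<Rightarrow> real" assume u: "u \<in> H_per0 2" and v: "v \<in> H_per0 2"
  show "(\<lambda>x. u x + v x) \<in> H_per0 2" using H_per0_lincomb[OF u v, of 1] by simp
next
  fix c and v :: "real^'n \<Rightarrow> real" assume v: "v \<in> H_per0 2"
  show "(\<lambda>x. c * v x) \<in> H_per0 2" using H_per0_lincomb[OF zero_H_per0 v, of c] by simp
qed (auto simp: zero_H_per0)

text \<open>The limit of a Cauchy sequence of Laplacians has mean zero, hence is the Laplacian of some $v$;
  since Laplacians control the $H^2$ norm, the sequence itself converges to $v$ in $H^2$, and $v$ lies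
  in the closed subspace.\<close>

lemma complete_laplacian_image:
  fixes V :: "(real^'n \<Rightarrow> real) set"
  assumes V: "closed_subspace_H2_per0 V"
  shows "complete ((\<lambda>\<phi>. cls (laplacian \<phi>)) ` V)"
  unfolding complete_def
proof (intro allI impI)
  fix X :: "nat \<Rightarrow> 'n torus_L2"
  assume X: "(\<forall>k. X k \<in> (\<lambda>\<phi>. cls (laplacian \<phi>)) ` V) \<and> Cauchy X"
  then have "\<forall>k. \<exists>\<phi>\<in>V. X k = cls (laplacian \<phi>)" by auto
  then obtain \<phi> where \<phi>: "\<And>k. \<phi> k \<in> V" "\<And>k. X k = cls (laplacian (\<phi> k))" by metis
  have \<phi>0: "\<phi> k \<in> H_per0 2" for k using closed_subspaceD(1)[OF V \<phi>(1)] .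
  obtain w where w: "X \<longlonglongrightarrow> w" using X Cauchy_convergent convergent_def by blast
  have "(\<lambda>k. X k \<bullet> cls (\<lambda>x. 1)) \<longlonglongrightarrow> w \<bullet> cls (\<lambda>x. 1)"
    by (intro tendsto_intros w)
  then have "w \<bullet> cls (\<lambda>x. 1) = 0"
    using laplacian_mean_zero[OF H_per0_imp_H_per[OF \<phi>0]] by (simp add: \<phi>(2) LIMSEQ_const_iff)
  then obtain v where v: "v \<in> H_per0 2" "cls (laplacian v) = w" by (rule mean_zero_is_laplacian)
  have "(\<lambda>k. H2_norm (\<lambda>x. \<phi> k x - v x)) \<longlonglongrightarrow> 0"
  proof (rule Lim_null_comparison)
    have "H2_norm (\<lambda>x. \<phi> k x - v x) \<le> sqrt (2 + real CARD('n)) * norm (X k - w)" for k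
    proof -
      note d = H_per0_diff[OF \<phi>0[of k] v(1)]
      have "L2_norm (laplacian (\<lambda>x. \<phi> k x - v x)) = norm (X k - w)"
        using norm_cls[OF laplacian_H_per2(1)[OF H_per0_imp_H_per[OF d]]]
          cls_laplacian_diff[OF H_per0_imp_H_per[OF \<phi>0[of k]] H_per0_imp_H_per[OF v(1)]]
        by (simp add: \<phi>(2) v(2))
      then show ?thesis using H2_norm_le_laplacian[OF d] by simp
    qed
    moreover have "0 \<le> H2_norm (\<lambda>x. \<phi> k x - v x)" for k
      unfolding H2_norm_def by (intro real_sqrt_ge_zero add_nonneg_nonneg sum_nonneg) auto
    ultimately show "\<forall>\<^sub>F k in sequentially. norm (H2_norm (\<lambda>x. \<phi> k x - v x)) \<le> sqrt (2 + real CARD('n)) * norm (X k - w)"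
      by simp
    have "(\<lambda>k. norm (X k - w)) \<longlonglongrightarrow> 0" using w by (simp add: tendsto_norm_zero_iff LIM_zero_iff)
    then show "(\<lambda>k. sqrt (2 + real CARD('n)) * norm (X k - w)) \<longlonglongrightarrow> 0"
      by (rule tendsto_mult_right_zero)
  qed
  then have "v \<in> V" by (rule closed_subspaceD(5)[OF V \<phi>(1) v(1)])
  then show "\<exists>l\<in>(\<lambda>\<phi>. cls (laplacian \<phi>)) ` V. X \<longlonglongrightarrow> l" using w v(2) by blast
qed

text \<open>The operator $\varphi \mapsto B : D^2\varphi$ read as a linear relation that sends $\Delta\varphi$ to
  $B : D^2\varphi$, which is the form in which the Hilbert space lemmas apply.\<close>

definition operator_graph :: "(real^'n \<Rightarrow> real^'n^'n) \<Rightarrow> (real^'n \<Rightarrow> real) set \<Rightarrow> ('n torus_L2 \<times> 'n torus_L2) set" where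
  "operator_graph B V = (\<lambda>\<phi>. (cls (laplacian \<phi>), cls (\<lambda>x. B x \<bullet> hessian \<phi> x))) ` V"

lemma fst_operator_graph: "fst ` operator_graph B V = (\<lambda>\<phi>. cls (laplacian \<phi>)) ` V"
  by (force simp: operator_graph_def)

lemma subspace_operator_graph:
  assumes V: "closed_subspace_H2_per0 V" and B: "B \<in> Linf_per"
  shows "subspace (operator_graph B V)"
proof -
  let ?f = "\<lambda>\<phi>. (cls (laplacian \<phi>), cls (\<lambda>x. B x \<bullet> hessian \<phi> x))"
  have lin: "?f (\<lambda>x. u x + c * v x) = ?f u + c *\<^sub>R ?f v" if "u \<in> V" "v \<in> V" for u v c
    using that[THEN closed_subspaceD(1)[OF V], THEN H_per0_imp_H_per]
    by (simp add: cls_laplacian_lincomb cls_contraction_hessian_lincomb[OF B])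
  note z = closed_subspaceD(2)[OF V]
  have zero: "?f (\<lambda>x. 0) = 0"
    using lin[OF z z, of "1"] by (simp add: zero_prod_def)
  show ?thesis
    unfolding operator_graph_def
  proof (rule subspaceI)
    show "0 \<in> ?f ` V" by (rule image_eqI[OF _ z]) (rule zero[symmetric])
    fix a b assume "a \<in> ?f ` V" "b \<in> ?f ` V"
    then obtain u v where uv: "u \<in> V" "v \<in> V" "a = ?f u" "b = ?f v" by blast
    then have "a + b = ?f (\<lambda>x. u x + v x)" using lin[of u v 1] by simp
    then show "a + b \<in> ?f ` V" using closed_subspaceD(3)[OF V uv(1,2)] by (rule image_eqI)
  next
    fix c a assume "a \<in> ?f ` V"
    then obtain v where v: "v \<in> V" "a = ?f v" by blast
    then have "c *\<^sub>R a = ?f (\<lambda>x. c * v x)" using lin[OF z, of v c] zero by simp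
    then show "c *\<^sub>R a \<in> ?f ` V" using closed_subspaceD(4)[OF V v(1)] by (rule image_eqI)
  qed
qed

lemma operator_graph_bound:
  assumes V: "V \<subseteq> H_per 2" and B: "B \<in> Linf_per" "0 \<le> M" "AE x in lebesgue. norm (B x) \<le> M"
    and "(d, t) \<in> operator_graph B V"
  shows "norm t \<le> M * norm d"
proof -
  obtain \<phi> where \<phi>: "\<phi> \<in> H_per 2" "d = cls (laplacian \<phi>)" "t = cls (\<lambda>x. B x \<bullet> hessian \<phi> x)"
    using assms by (auto simp: operator_graph_def)
  then show ?thesis
    using contraction_hessian_bound[OF B(1) \<phi>(1) B(2,3)]
    by (simp add: norm_cls contraction_hessian_L2_per[OF B(1)] laplacian_H_per2)
qed

lemma operator_graph_near_identity:
  assumes V: "V \<subseteq> H_per 2" and B: "B \<in> Linf_per" "0 \<le> q" "AE x in lebesgue. norm (B x - mat 1) \<le> q"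
    and dt: "(d, t) \<in> operator_graph B V"
  shows "norm (t - d) \<le> q * norm d"
proof -
  obtain \<phi> where \<phi>: "\<phi> \<in> H_per 2" "d = cls (laplacian \<phi>)" "t = cls (\<lambda>x. B x \<bullet> hessian \<phi> x)"
    using dt V by (auto simp: operator_graph_def)
  have BI: "(\<lambda>x. B x - mat 1) \<in> Linf_per"
    using B(1,3) ae_periodic_comp[of B "\<lambda>P. P - mat 1"] by (auto simp: Linf_per_def)
  have "t - d = cls (\<lambda>x. (B x - mat 1) \<bullet> hessian \<phi> x)"
    using \<phi> cls_diff[OF contraction_hessian_L2_per[OF B(1) \<phi>(1)] laplacian_H_per2(1)[OF \<phi>(1)]]
    by (simp add: laplacian_eq_inner inner_diff_left)
  then show ?thesis
    using contraction_hessian_bound[OF BI \<phi>(1) B(2,3)] \<phi>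
    by (simp add: norm_cls contraction_hessian_L2_per[OF BI] laplacian_H_per2)
qed


lemma dual_problem_unique_laplacian:
  assumes V: "closed_subspace_H2_per0 V" and B: "B \<in> Linf_per"
    and q: "0 \<le> q" "q < 1" "AE x in lebesgue. norm (B x - mat 1) \<le> q"
  shows "\<exists>!w. w \<in> (\<lambda>\<phi>. cls (laplacian \<phi>)) ` V \<and> (\<forall>(d, t)\<in>operator_graph B V. t \<bullet> w = t \<bullet> y)"
proof -
  let ?G = "operator_graph B V"
  have VH: "V \<subseteq> H_per 2" using closed_subspaceD(1)[OF V] H_per0_imp_H_per by blast
  have "\<exists>!w. w \<in> fst ` ?G \<and> (\<forall>(d, t)\<in>?G. t \<bullet> w = t \<bullet> y)"
  proof (rule galerkin_dual_unique_solution[OF subspace_operator_graph[OF V B] _ q(1,2)])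
    show "complete (fst ` ?G)"
      unfolding fst_operator_graph by (rule complete_laplacian_image[OF V])
    show "norm (t - d) \<le> q * norm d" if "(d, t) \<in> ?G" for d t
      by (rule operator_graph_near_identity[OF VH B q(1,3) that])
  qed
  then show ?thesis unfolding fst_operator_graph .
qed

text \<open>Solving the abstract problem yields the class of the Laplacian of a solution, from which the solution
  is recovered almost everywhere.\<close>

lemma dual_problem_unique_solution:
  assumes V: "closed_subspace_H2_per0 V" and B: "B \<in> Linf_per"
    and q: "0 \<le> q" "q < 1" "AE x in lebesgue. norm (B x - mat 1) \<le> q"
  shows "ex1_AE V (\<lambda>\<psi>. \<forall>(d, t)\<in>operator_graph B V. t \<bullet> cls (laplacian \<psi>) = t \<bullet> y)"
proof -
  let ?P = "\<lambda>w. \<forall>(d, t)\<in>operator_graph B V. t \<bullet> w = t \<bullet> y"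
  obtain w where w: "w \<in> (\<lambda>\<phi>. cls (laplacian \<phi>)) ` V" "?P w"
    and uniq: "\<And>v. v \<in> (\<lambda>\<phi>. cls (laplacian \<phi>)) ` V \<and> ?P v \<Longrightarrow> v = w"
    using dual_problem_unique_laplacian[OF assms, of y] by (elim ex1E) blast
  then obtain \<psi> where \<psi>: "\<psi> \<in> V" "w = cls (laplacian \<psi>)" by blast
  have "AE x in lebesgue. \<phi> x = \<psi> x" if \<phi>: "\<phi> \<in> V" "?P (cls (laplacian \<phi>))" for \<phi>
  proof -
    have "cls (laplacian \<phi>) = cls (laplacian \<psi>)"
      unfolding \<psi>(2)[symmetric] using \<phi> by (intro uniq conjI imageI)
    then show ?thesis
      by (rule laplacian_determines_H_per0_2[OF closed_subspaceD(1)[OF V \<phi>(1)] closed_subspaceD(1)[OF V \<psi>(1)]])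
  qed
  with \<psi> w(2) show ?thesis unfolding ex1_AE_def by blast
qed

text \<open>Since $r$ has mean one, $1 - r$ is a Laplacian $\Delta\psi$, and orthogonality of $r$ to the range of
  the operator is the dual problem for $\psi$.  The invariant measure is tested with all of
  $H^2_{\mathrm{per}}$ and $\psi$ only with mean-zero functions, but the two ranges agree: a function has a
  mean-zero companion with the same Laplacian, and the operator depends on the Laplacian only.\<close>

lemma invariant_measure_iff_dual:
  fixes B :: "real^'n \<Rightarrow> real^'n^'n"
  assumes B: "B \<in> Linf_per" and r: "r \<in> L2_per"
  shows "invariant_measure B r \<longleftrightarrow>
    (\<exists>\<psi>\<in>H_per0 2. cls r = cls (\<lambda>x. 1) - cls (laplacian \<psi>) \<and>
      (\<forall>(d, t)\<in>operator_graph B (H_per0 2). t \<bullet> cls (laplacian \<psi>) = t \<bullet> cls (\<lambda>x. 1)))"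
proof
  let ?T = "\<lambda>\<phi>. cls (\<lambda>x. B x \<bullet> hessian \<phi> x)" and ?one = "cls (\<lambda>x. 1) :: 'n torus_L2"
  have pair: "L2_inner r (\<lambda>x. (- B x) \<bullet> hessian \<phi> x) = - (cls r \<bullet> ?T \<phi>)" if "\<phi> \<in> H_per 2" for \<phi>
    using contraction_hessian_L2_per[OF B that] r by (simp add: inner_cls L2_inner_cell)
  have one: "?one \<bullet> ?one = 1"
    using measure_cell[where 'n='n] by (simp add: inner_cls L2_inner_cell)
  {
    assume inv: "invariant_measure B r"
    have "(?one - cls r) \<bullet> ?one = 0"
      using inv mean_eq_inner_one[OF r] by (simp add: invariant_measure_def inner_diff_left one)
    then obtain \<psi> where \<psi>: "\<psi> \<in> H_per0 2" "cls (laplacian \<psi>) = ?one - cls r"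
      by (rule mean_zero_is_laplacian)
    have "t \<bullet> cls (laplacian \<psi>) = t \<bullet> ?one" if "(d, t) \<in> operator_graph B (H_per0 2)" for d t
    proof -
      obtain \<phi> where \<phi>: "\<phi> \<in> H_per0 2" "t = ?T \<phi>" using \<open>(d, t) \<in> _\<close> by (auto simp: operator_graph_def)
      then have "t \<bullet> cls r = 0"
        using inv pair[OF H_per0_imp_H_per[OF \<phi>(1)]] H_per0_imp_H_per[OF \<phi>(1)]
        by (simp add: invariant_measure_def inner_commute)
      then show ?thesis by (simp add: \<psi>(2) inner_diff_right)
    qed
    then show "\<exists>\<psi>\<in>H_per0 2. cls r = ?one - cls (laplacian \<psi>) \<and>
      (\<forall>(d, t)\<in>operator_graph B (H_per0 2). t \<bullet> cls (laplacian \<psi>) = t \<bullet> ?one)"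
      using \<psi> by (intro bexI[OF _ \<psi>(1)]) auto
  next
    assume "\<exists>\<psi>\<in>H_per0 2. cls r = ?one - cls (laplacian \<psi>) \<and>
      (\<forall>(d, t)\<in>operator_graph B (H_per0 2). t \<bullet> cls (laplacian \<psi>) = t \<bullet> ?one)"
    then obtain \<psi> where \<psi>: "\<psi> \<in> H_per0 2" "cls r = ?one - cls (laplacian \<psi>)"
      "\<And>d t. (d, t) \<in> operator_graph B (H_per0 2) \<Longrightarrow> t \<bullet> cls (laplacian \<psi>) = t \<bullet> ?one" by blast
    have mean: "(LINT x:unit_cell|lebesgue. r x) = 1"
      unfolding mean_eq_inner_one[OF r] \<psi>(2)
      by (simp add: inner_diff_left one laplacian_mean_zero[OF H_per0_imp_H_per[OF \<psi>(1)]])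
    have "L2_inner r (\<lambda>x. (- B x) \<bullet> hessian \<phi> x) = 0" if \<phi>: "\<phi> \<in> H_per 2" for \<phi>
    proof -
      obtain \<phi>0 where \<phi>0: "\<phi>0 \<in> H_per0 2" "cls (laplacian \<phi>0) = cls (laplacian \<phi>)"
        using mean_zero_is_laplacian[OF laplacian_mean_zero[OF \<phi>]] .
      note \<phi>0H = H_per0_imp_H_per[OF \<phi>0(1)]
      obtain C where C: "AE x in lebesgue. norm (B x) \<le> C" using Linf_perD[OF B] .
      have C': "AE x in lebesgue. norm (B x) \<le> \<bar>C\<bar>" using C by eventually_elim simp
      let ?u = "\<lambda>x. \<phi> x + (- 1) * \<phi>0 x"
      have "(cls (laplacian ?u), ?T ?u) \<in> operator_graph B (H_per 2)"
        unfolding operator_graph_def by (intro image_eqI[OF refl] H_per_lincomb \<phi> \<phi>0H)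
      then have "norm (?T ?u) \<le> \<bar>C\<bar> * norm (cls (laplacian ?u))"
        by (rule operator_graph_bound[OF order_refl B abs_ge_zero C'])
      then have "norm (?T \<phi> - ?T \<phi>0) \<le> 0"
        unfolding cls_laplacian_lincomb[OF \<phi> \<phi>0H] cls_contraction_hessian_lincomb[OF B \<phi> \<phi>0H] \<phi>0(2)
        by simp
      then have "?T \<phi> = ?T \<phi>0" by simp
      moreover have "(cls (laplacian \<phi>0), ?T \<phi>0) \<in> operator_graph B (H_per0 2)"
        unfolding operator_graph_def using \<phi>0(1) by (rule imageI)
      ultimately have "?T \<phi> \<bullet> cls (laplacian \<psi>) = ?T \<phi> \<bullet> ?one"
        using \<psi>(3)[of "cls (laplacian \<phi>0)" "?T \<phi>0"] by simp
      then have "cls r \<bullet> ?T \<phi> = 0"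
        by (simp add: \<psi>(2) inner_diff_right inner_commute[of _ "?T \<phi>"])
      then show ?thesis unfolding pair[OF \<phi>] by simp
    qed
    with r mean show "invariant_measure B r" unfolding invariant_measure_def by blast
  }
qed

text \<open>The right-hand side $(\gamma, A : D^2\varphi)$ is $(\gamma A : D^2\varphi, 1)$, so that the data
  of the dual problem is the constant $1$.\<close>

lemma solves_dual_iff_graph:
  assumes V: "V \<subseteq> H_per 2" and \<psi>: "\<psi> \<in> H_per 2" and B: "(\<lambda>x. renorm A x *\<^sub>R A x) \<in> Linf_per"
  shows "solves_dual A V \<psi> \<longleftrightarrow>
    (\<forall>(d, t)\<in>operator_graph (\<lambda>x. renorm A x *\<^sub>R A x) V. t \<bullet> cls (laplacian \<psi>) = t \<bullet> cls (\<lambda>x. 1))"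
proof -
  let ?T = "\<lambda>\<phi>. cls (\<lambda>x. (renorm A x *\<^sub>R A x) \<bullet> hessian \<phi> x)"
  have "b0 A \<phi> \<psi> = ?T \<phi> \<bullet> cls (laplacian \<psi>)"
    "L2_inner (renorm A) (\<lambda>x. A x \<bullet> hessian \<phi> x) = ?T \<phi> \<bullet> cls (\<lambda>x. 1)" if "\<phi> \<in> V" for \<phi>
  proof -
    have "\<phi> \<in> H_per 2" using that V by blast
    note L = contraction_hessian_L2_per[OF B this]
    show "b0 A \<phi> \<psi> = ?T \<phi> \<bullet> cls (laplacian \<psi>)"
      by (simp only: b0_def inner_cls[OF L laplacian_H_per2(1)[OF \<psi>]])
    show "L2_inner (renorm A) (\<lambda>x. A x \<bullet> hessian \<phi> x) = ?T \<phi> \<bullet> cls (\<lambda>x. 1)"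
      by (simp only: inner_cls[OF L const_L2_per]) (simp add: L2_inner_def)
  qed
  then show ?thesis by (simp add: solves_dual_def operator_graph_def)
qed

section \<open>The Cordes condition\<close>

lemma trace_eq_inner: "trace P = P \<bullet> mat 1" for P :: "real^'n^'n"
  by (simp add: trace_def inner_vec_def mat_def if_distrib[of "\<lambda>a. _ * a"] cong: if_cong)

lemma norm_mat_1: "(norm (mat 1 :: real^'n^'n))\<^sup>2 = real CARD('n)"
  by (simp add: power2_norm_eq_inner trace_eq_inner[symmetric] trace_I)

lemma trace_le_norm: "\<bar>trace P\<bar> \<le> sqrt (real CARD('n)) * norm P" for P :: "real^'n^'n"
proof -
  have "norm (mat 1 :: real^'n^'n) = sqrt (real CARD('n))"
    using norm_mat_1[where 'n='n] by (metis norm_ge_zero real_sqrt_unique)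
  then show ?thesis
    using Cauchy_Schwarz_ineq2[of P "mat 1"] by (simp add: trace_eq_inner mult.commute)
qed

text \<open>Both bounds are the Cauchy-Schwarz inequality $\mathrm{tr} P = P : I \le \sqrt n\,|P|$.\<close>

lemma renormalised_matrix_bounds:
  fixes P :: "real^'n^'n"
  assumes tr: "trace P > 0"
  shows "norm ((trace P / (norm P)\<^sup>2) *\<^sub>R P) \<le> sqrt (real CARD('n))"
    and "\<bar>trace P / (norm P)\<^sup>2\<bar> \<le> real CARD('n) / trace P"
proof -
  have nz: "norm P > 0" using tr trace_le_norm[of P] by (auto simp: trace_eq_inner)
  have "norm ((trace P / (norm P)\<^sup>2) *\<^sub>R P) = trace P / norm P"
    using tr nz by (simp add: power2_eq_square)
  also have "\<dots> \<le> sqrt (real CARD('n))"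
    using trace_le_norm[of P] tr nz by (simp add: pos_divide_le_eq)
  finally show "norm ((trace P / (norm P)\<^sup>2) *\<^sub>R P) \<le> sqrt (real CARD('n))" .
  have "\<bar>trace P\<bar>\<^sup>2 \<le> (sqrt (real CARD('n)) * norm P)\<^sup>2"
    by (intro power_mono trace_le_norm) simp
  then have "(trace P)\<^sup>2 \<le> real CARD('n) * (norm P)\<^sup>2"
    by (simp add: power_mult_distrib)
  then have "trace P * trace P \<le> real CARD('n) * (norm P)\<^sup>2"
    by (simp only: power2_eq_square[of "trace P"])
  then show "\<bar>trace P / (norm P)\<^sup>2\<bar> \<le> real CARD('n) / trace P"
    using tr nz by (simp add: divide_simps)
qed

text \<open>Expanding the square with $g = \mathrm{tr} P/|P|^2$ gives
  $|gP - I|^2 = n - (\mathrm{tr} P)^2/|P|^2$; this $g$ is the minimiser of $|gP - I|$, which explains the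
  choice of $\gamma$.\<close>

lemma cordes_near_identity:
  fixes P :: "real^'n^'n"
  assumes tr: "trace P > 0" and \<delta>: "0 < \<delta>"
    and cordes: "(norm P)\<^sup>2 / (trace P)\<^sup>2 \<le> 1 / (real CARD('n) - 1 + \<delta>)"
  shows "norm ((trace P / (norm P)\<^sup>2) *\<^sub>R P - mat 1) \<le> sqrt (1 - \<delta>)"
proof (rule real_le_rsqrt)
  have nz: "norm P > 0" using tr trace_le_norm[of P] by (auto simp: trace_eq_inner)
  let ?g = "trace P / (norm P)\<^sup>2"
  have n: "real CARD('n) \<ge> 1" by (simp add: Suc_le_eq)
  have "(norm (g *\<^sub>R P - mat 1))\<^sup>2 = g\<^sup>2 * (norm P)\<^sup>2 - 2 * (g * trace P) + real CARD('n)" for g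
    unfolding norm_mat_1[symmetric] trace_eq_inner
    by (simp add: power2_norm_eq_inner inner_diff_left inner_diff_right inner_commute power2_eq_square[of g])
  then have "(norm (?g *\<^sub>R P - mat 1))\<^sup>2 = ?g\<^sup>2 * (norm P)\<^sup>2 - 2 * (?g * trace P) + real CARD('n)" .
  also have "?g\<^sup>2 * (norm P)\<^sup>2 = ?g * trace P"
    using nz by (simp add: power2_eq_square)
  also have "?g * trace P = (trace P)\<^sup>2 / (norm P)\<^sup>2" by (simp add: power2_eq_square)
  also have "(trace P)\<^sup>2 / (norm P)\<^sup>2 - 2 * ((trace P)\<^sup>2 / (norm P)\<^sup>2) + real CARD('n) \<le> 1 - \<delta>"
  proof -
    have "(real CARD('n) - 1 + \<delta>) * (norm P)\<^sup>2 \<le> (trace P)\<^sup>2"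
      using cordes tr \<delta> n by (simp add: divide_simps mult.commute)
    then have "real CARD('n) - 1 + \<delta> \<le> (trace P)\<^sup>2 / (norm P)\<^sup>2"
      using nz by (simp add: pos_le_divide_eq)
    then show ?thesis by simp
  qed
  finally show "(norm (?g *\<^sub>R P - mat 1))\<^sup>2 \<le> 1 - \<delta>" .
qed

lemma elliptic_coeffs_diagonal:
  fixes A :: "real^'n \<Rightarrow> real^'n^'n"
  assumes "A \<in> elliptic_coeffs lam Lam"
  shows "AE x in lebesgue. lam \<le> A x $ i $ i \<and> A x $ i $ i \<le> Lam"
proof -
  have "(axis i 1 :: real^'n) \<noteq> 0" by (simp add: axis_eq_0_iff)
  then have "AE x in lebesgue. lam * (norm (axis i 1 :: real^'n))\<^sup>2 \<le> (A x *v axis i 1) \<bullet> axis i 1 \<and>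
      (A x *v axis i 1) \<bullet> axis i 1 \<le> Lam * (norm (axis i 1 :: real^'n))\<^sup>2"
    using assms unfolding elliptic_coeffs_def by blast
  then show ?thesis
    by eventually_elim (simp add: inner_axis matrix_vector_mult_basis column_def)
qed

lemma elliptic_coeffs_trace:
  fixes A :: "real^'n \<Rightarrow> real^'n^'n"
  assumes "A \<in> elliptic_coeffs lam Lam"
  shows "AE x in lebesgue. real CARD('n) * lam \<le> trace (A x)"
proof -
  have "AE x in lebesgue. \<forall>i. lam \<le> A x $ i $ i \<and> A x $ i $ i \<le> Lam"
    unfolding AE_all_countable using elliptic_coeffs_diagonal[OF assms] by blast
  then show ?thesis
  proof eventually_elim
    case (elim x)
    have "(\<Sum>i\<in>(UNIV::'n set). lam) \<le> (\<Sum>i\<in>UNIV. A x $ i $ i)" using elim by (intro sum_mono) auto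
    then show ?case by (simp add: trace_def)
  qed
qed

text \<open>The inequality holds almost everywhere for constants, and Lebesgue measure is not zero.\<close>

lemma elliptic_coeffs_order:
  assumes "(A :: real^'n \<Rightarrow> real^'n^'n) \<in> elliptic_coeffs lam Lam" shows "lam \<le> Lam"
proof (rule ccontr)
  assume "\<not> lam \<le> Lam"
  then have "AE x in (lebesgue :: (real^'n) measure). False"
    using elliptic_coeffs_diagonal[OF assms, of undefined] by (auto elim: eventually_mono)
  then have "negligible (UNIV :: (real^'n) set)"
    unfolding eventually_ae_filter_negligible by (auto simp: top.extremum_unique)
  then show False by simp
qed

lemma renorm_Linf_per:
  fixes A :: "real^'n \<Rightarrow> real^'n^'n"
  assumes lam: "lam > 0" and A: "A \<in> elliptic_coeffs lam Lam"
  shows "renorm A \<in> Linf_per" "(\<lambda>x. renorm A x *\<^sub>R A x) \<in> Linf_per"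
    "AE x in lebesgue. norm (renorm A x *\<^sub>R A x) \<le> sqrt (real CARD('n))"
proof -
  have AL: "A \<in> Linf_per" using A by (simp add: elliptic_coeffs_def)
  then have Am[measurable]: "A \<in> borel_measurable lebesgue" and Ap: "ae_periodic A"
    by (auto simp: Linf_per_def)
  have tr: "AE x in lebesgue. real CARD('n) * lam \<le> trace (A x)" by (rule elliptic_coeffs_trace[OF A])
  have nlam: "real CARD('n) * lam > 0" using lam by simp
  have rm[measurable]: "renorm A \<in> borel_measurable lebesgue"
    unfolding renorm_def[abs_def] trace_eq_inner by measurable
  have bound: "AE x in lebesgue. norm (renorm A x) \<le> 1 / lam"
    using tr
  proof eventually_elim
    case (elim x)
    then have pos: "trace (A x) > 0" using nlam by linarith
    have "\<bar>renorm A x\<bar> \<le> real CARD('n) / trace (A x)"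
      unfolding renorm_def by (rule renormalised_matrix_bounds(2)[OF pos])
    also have "\<dots> \<le> real CARD('n) / (real CARD('n) * lam)"
      using elim nlam by (intro divide_left_mono) auto
    finally show ?case by simp
  qed
  have rp: "ae_periodic (renorm A)"
    unfolding renorm_def[abs_def] using ae_periodic_comp[OF Ap, of "\<lambda>P. trace P / (norm P)\<^sup>2"] .
  show "renorm A \<in> Linf_per" using rm rp bound by (auto simp: Linf_per_def)
  show b: "AE x in lebesgue. norm (renorm A x *\<^sub>R A x) \<le> sqrt (real CARD('n))"
    using tr
  proof eventually_elim
    case (elim x)
    then have pos: "trace (A x) > 0" using nlam by linarith
    show ?case unfolding renorm_def by (rule renormalised_matrix_bounds(1)[OF pos])
  qed
  have "(\<lambda>x. renorm A x *\<^sub>R A x) \<in> borel_measurable lebesgue" by measurable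
  moreover have "ae_periodic (\<lambda>x. renorm A x *\<^sub>R A x)"
    using ae_periodic_comp2[OF rp Ap, of "(*\<^sub>R)"] .
  ultimately show "(\<lambda>x. renorm A x *\<^sub>R A x) \<in> Linf_per" using b by (auto simp: Linf_per_def)
qed

lemma renorm_near_identity:
  fixes A :: "real^'n \<Rightarrow> real^'n^'n"
  assumes lam: "lam > 0" and A: "A \<in> elliptic_coeffs lam Lam" and \<delta>: "0 < \<delta>" and cordes: "cordes \<delta> A"
  shows "AE x in lebesgue. norm (renorm A x *\<^sub>R A x - mat 1) \<le> sqrt (1 - \<delta>)"
  using elliptic_coeffs_trace[OF A] cordes[unfolded cordes_def]
proof eventually_elim
  case (elim x)
  have "0 < real CARD('n) * lam" using lam by simp
  then have "trace (A x) > 0" using elim(1) by linarith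
  from cordes_near_identity[OF this \<delta> elim(2)] show ?case by (simp add: renorm_def)
qed

section \<open>Quasi-optimality of the discrete invariant measure\<close>

theorem lemma4p1:
  fixes A :: "real^'n \<Rightarrow> real^'n^'n"
    and lam Lam \<delta> :: real
    and \<Psi>h :: "(real^'n \<Rightarrow> real) set"
  assumes "lam > 0" and "Lam > 0"
    and "A \<in> elliptic_coeffs lam Lam"
    and "0 < \<delta>" and "\<delta> \<le> 1"
    and "cordes \<delta> A"
    and "closed_subspace_H2_per0 \<Psi>h"
  shows "renorm A \<in> Linf_per \<and>
         ex1_AE L2_per (invariant_measure (\<lambda>x. renorm A x *\<^sub>R A x)) \<and>
         ex1_AE (H_per0 2) (solves_dual A (H_per0 2)) \<and>
         ex1_AE \<Psi>h (solves_dual A \<Psi>h) \<and>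
         (\<forall>r \<psi> \<psi>h.
           invariant_measure (\<lambda>x. renorm A x *\<^sub>R A x) r \<and>
           \<psi> \<in> H_per0 2 \<and> solves_dual A (H_per0 2) \<psi> \<and>
           \<psi>h \<in> \<Psi>h \<and> solves_dual A \<Psi>h \<psi>h \<longrightarrow>
           (let rh = (\<lambda>x. 1 - laplacian \<psi>h x) in
              rh \<in> L2_per \<and>
              L2_norm (\<lambda>x. r x - rh x) = L2_norm (laplacian (\<lambda>x. \<psi> x - \<psi>h x)) \<and>
              L2_norm (laplacian (\<lambda>x. \<psi> x - \<psi>h x))
                \<le> sqrt (real CARD('n)) * (Lam / lam) * cordes_const \<delta> *
                   (INF \<phi>h\<in>\<Psi>h. L2_norm (laplacian (\<lambda>x. \<psi> x - \<phi>h x)))))"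
proof -
  let ?B = "\<lambda>x. renorm A x *\<^sub>R A x" and ?q = "sqrt (1 - \<delta>)" and ?one = "cls (\<lambda>x. 1) :: 'n torus_L2"
  let ?W = "H_per0 2 :: (real^'n \<Rightarrow> real) set"
  note \<Psi>h = assms(7)
  note R = renorm_Linf_per[OF assms(1,3)]
  note near = renorm_near_identity[OF assms(1,3,4,6)]
  have q: "0 \<le> ?q" "?q < 1" using assms(4,5) by (auto simp: real_sqrt_lt_1_iff)
  have WH: "?W \<subseteq> H_per 2" using H_per0_imp_H_per by blast
  have \<Psi>W: "\<Psi>h \<subseteq> ?W" using closed_subspaceD(1)[OF \<Psi>h] by blast
  have dual: "solves_dual A V \<psi> \<longleftrightarrow> (\<forall>(d, t)\<in>operator_graph ?B V. t \<bullet> cls (laplacian \<psi>) = t \<bullet> ?one)"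
    if "V \<subseteq> ?W" "\<psi> \<in> ?W" for V \<psi>
    by (rule solves_dual_iff_graph[OF _ _ R(2)]) (use that WH in auto)
  have ex1: "ex1_AE V (solves_dual A V)" if V: "closed_subspace_H2_per0 V" for V
  proof -
    have VW: "V \<subseteq> ?W" using closed_subspaceD(1)[OF V] by blast
    have "\<psi> \<in> V \<Longrightarrow> solves_dual A V \<psi> \<longleftrightarrow>
        (\<forall>(d, t)\<in>operator_graph ?B V. t \<bullet> cls (laplacian \<psi>) = t \<bullet> ?one)" for \<psi>
      using VW by (intro dual) auto
    then show ?thesis
      using dual_problem_unique_solution[OF V R(2) q near, of ?one] by (auto simp: ex1_AE_def)
  qed
  have lap_unique: "cls (laplacian \<phi>) = cls (laplacian \<psi>)"
    if "\<phi> \<in> ?W" "\<psi> \<in> ?W"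
      "\<forall>(d, t)\<in>operator_graph ?B ?W. t \<bullet> cls (laplacian \<phi>) = t \<bullet> ?one"
      "\<forall>(d, t)\<in>operator_graph ?B ?W. t \<bullet> cls (laplacian \<psi>) = t \<bullet> ?one" for \<phi> \<psi>
  proof -
    obtain w where uniq: "\<And>v. v \<in> (\<lambda>\<phi>. cls (laplacian \<phi>)) ` ?W \<and>
        (\<forall>(d, t)\<in>operator_graph ?B ?W. t \<bullet> v = t \<bullet> ?one) \<Longrightarrow> v = w"
      using dual_problem_unique_laplacian[OF closed_subspace_whole R(2) q near, of ?one]
      by (elim ex1E) blast
    have "cls (laplacian \<phi>) = w" using that by (intro uniq conjI imageI)
    moreover have "cls (laplacian \<psi>) = w" using that by (intro uniq conjI imageI)
    ultimately show ?thesis by simp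
  qed
  have inv_dual: "cls r = ?one - cls (laplacian \<psi>)"
    if inv: "invariant_measure ?B r" and \<psi>: "\<psi> \<in> ?W" "solves_dual A ?W \<psi>" for r \<psi>
  proof -
    have "r \<in> L2_per" using inv by (simp add: invariant_measure_def)
    from invariant_measure_iff_dual[OF R(2) this] inv
    obtain \<phi> where \<phi>: "\<phi> \<in> ?W" "cls r = ?one - cls (laplacian \<phi>)"
      "\<forall>(d, t)\<in>operator_graph ?B ?W. t \<bullet> cls (laplacian \<phi>) = t \<bullet> ?one"
      by blast
    from \<psi>(2) have "\<forall>(d, t)\<in>operator_graph ?B ?W. t \<bullet> cls (laplacian \<psi>) = t \<bullet> ?one"
      by (simp only: dual[OF order_refl \<psi>(1)])
    from lap_unique[OF \<phi>(1) \<psi>(1) \<phi>(3) this] show ?thesis using \<phi>(2) by simp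
  qed
  have inv: "ex1_AE L2_per (invariant_measure ?B)"
  proof -
    obtain \<psi> where \<psi>: "\<psi> \<in> ?W" "solves_dual A ?W \<psi>"
      using ex1[OF closed_subspace_whole] by (auto simp: ex1_AE_def)
    note L = laplacian_H_per2(1)[OF H_per0_imp_H_per[OF \<psi>(1)]]
    let ?r = "\<lambda>x. 1 - laplacian \<psi> x"
    have rL: "?r \<in> L2_per" by (intro L2_per_diff const_L2_per L)
    have "cls ?r = ?one - cls (laplacian \<psi>)" by (rule cls_diff[OF const_L2_per L])
    then have "invariant_measure ?B ?r"
      unfolding invariant_measure_iff_dual[OF R(2) rL] using \<psi> dual[OF order_refl \<psi>(1)] by blast
    moreover have "AE x in lebesgue. s x = ?r x" if "s \<in> L2_per" "invariant_measure ?B s" for s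
      using inv_dual[OF that(2) \<psi>] \<open>cls ?r = _\<close> cls_eq_iff[OF that(1) rL] by simp
    ultimately show ?thesis unfolding ex1_AE_def using rL by blast
  qed
  have fin: "let rh = (\<lambda>x. 1 - laplacian \<psi>h x) in
      rh \<in> L2_per \<and>
      L2_norm (\<lambda>x. r x - rh x) = L2_norm (laplacian (\<lambda>x. \<psi> x - \<psi>h x)) \<and>
      L2_norm (laplacian (\<lambda>x. \<psi> x - \<psi>h x))
        \<le> sqrt (real CARD('n)) * (Lam / lam) * cordes_const \<delta> *
           (INF \<phi>h\<in>\<Psi>h. L2_norm (laplacian (\<lambda>x. \<psi> x - \<phi>h x)))"
    if r: "invariant_measure ?B r" and \<psi>: "\<psi> \<in> ?W" "solves_dual A ?W \<psi>"
      and \<psi>h: "\<psi>h \<in> \<Psi>h" "solves_dual A \<Psi>h \<psi>h" for r \<psi> \<psi>h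
  proof -
    have rL: "r \<in> L2_per" using r by (simp add: invariant_measure_def)
    have \<psi>hW: "\<psi>h \<in> ?W" using \<psi>h(1) \<Psi>W by blast
    have norm_diff: "L2_norm (laplacian (\<lambda>x. \<psi> x - \<phi> x)) = norm (cls (laplacian \<psi>) - cls (laplacian \<phi>))"
      if "\<phi> \<in> ?W" for \<phi>
      using norm_cls[OF laplacian_H_per2(1)[OF H_per0_imp_H_per[OF H_per0_diff[OF \<psi>(1) that]]]]
        cls_laplacian_diff[OF H_per0_imp_H_per[OF \<psi>(1)] H_per0_imp_H_per[OF that]] by simp
    let ?rh = "\<lambda>x. 1 - laplacian \<psi>h x"
    note Lh = laplacian_H_per2(1)[OF H_per0_imp_H_per[OF \<psi>hW]]
    have rhL: "?rh \<in> L2_per" by (intro L2_per_diff const_L2_per Lh)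
    have "L2_norm (\<lambda>x. r x - ?rh x) = norm (cls r - cls ?rh)"
      using norm_cls[OF L2_per_diff[OF rL rhL]] by (simp only: cls_diff[OF rL rhL])
    also have "cls ?rh = ?one - cls (laplacian \<psi>h)" by (rule cls_diff[OF const_L2_per Lh])
    also have "cls r = ?one - cls (laplacian \<psi>)" by (rule inv_dual[OF r \<psi>])
    finally have "L2_norm (\<lambda>x. r x - ?rh x) = norm (cls (laplacian \<psi>h) - cls (laplacian \<psi>))" by simp
    then have eq: "L2_norm (\<lambda>x. r x - ?rh x) = L2_norm (laplacian (\<lambda>x. \<psi> x - \<psi>h x))"
      by (simp only: norm_diff[OF \<psi>hW] norm_minus_commute[of "cls (laplacian \<psi>h)"])
    let ?E = "L2_norm (laplacian (\<lambda>x. \<psi> x - \<psi>h x))"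
      and ?K = "sqrt (real CARD('n)) * (Lam / lam) * cordes_const \<delta>"
    have K: "?K > 0" using q assms(1,2) by (simp add: cordes_const_def)
    have "?E / ?K \<le> L2_norm (laplacian (\<lambda>x. \<psi> x - \<phi> x))" if \<phi>: "\<phi> \<in> \<Psi>h" for \<phi>
    proof -
      have \<phi>W: "\<phi> \<in> ?W" using \<phi> \<Psi>W by blast
      let ?F = "L2_norm (laplacian (\<lambda>x. \<psi> x - \<phi> x))"
      have "(1 - ?q) * norm (cls (laplacian \<psi>) - cls (laplacian \<psi>h))
          \<le> sqrt (real CARD('n)) * norm (cls (laplacian \<psi>) - cls (laplacian \<phi>))"
      proof (rule galerkin_dual_quasi_optimal)
        show "subspace (operator_graph ?B ?W)" by (rule subspace_operator_graph[OF closed_subspace_whole R(2)])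
        show "operator_graph ?B \<Psi>h \<subseteq> operator_graph ?B ?W"
          unfolding operator_graph_def by (rule image_mono[OF \<Psi>W])
        show "norm (t - d) \<le> ?q * norm d" if "(d, t) \<in> operator_graph ?B ?W" for d t
          by (rule operator_graph_near_identity[OF WH R(2) q(1) near that])
        show "norm t \<le> sqrt (real CARD('n)) * norm d" if "(d, t) \<in> operator_graph ?B ?W" for d t
          by (rule operator_graph_bound[OF WH R(2) _ R(3) that]) simp
        show "t \<bullet> cls (laplacian \<psi>) = t \<bullet> ?one" if "(d, t) \<in> operator_graph ?B ?W" for d t
          using \<psi>(2) that unfolding dual[OF order_refl \<psi>(1)] by blast
        show "t \<bullet> cls (laplacian \<psi>h) = t \<bullet> ?one" if "(d, t) \<in> operator_graph ?B \<Psi>h" for d t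
          using \<psi>h(2) that unfolding dual[OF \<Psi>W \<psi>hW] by blast
      qed (simp_all add: fst_operator_graph \<psi>(1) \<psi>h(1) \<phi>)
      then have "?E \<le> (sqrt (real CARD('n)) * cordes_const \<delta>) * ?F"
        using q(2) unfolding norm_diff[OF \<psi>hW] norm_diff[OF \<phi>W] cordes_const_def
        by (simp add: field_simps)
      also have "\<dots> \<le> ?K * ?F"
      proof (rule mult_right_mono[OF _ L2_norm_nonneg])
        have "1 \<le> Lam / lam" using elliptic_coeffs_order[OF assms(3)] assms(1) by simp
        then have "1 * (sqrt (real CARD('n)) * cordes_const \<delta>) \<le> (Lam / lam) * (sqrt (real CARD('n)) * cordes_const \<delta>)"
          using q(2) by (intro mult_right_mono) (auto simp: cordes_const_def)
        then show "sqrt (real CARD('n)) * cordes_const \<delta> \<le> ?K" by (simp add: ac_simps)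
      qed
      finally show ?thesis unfolding pos_divide_le_eq[OF K] by (simp only: mult.commute)
    qed
    then have "?E / ?K \<le> (INF \<phi>h\<in>\<Psi>h. L2_norm (laplacian (\<lambda>x. \<psi> x - \<phi>h x)))"
      using \<psi>h(1) by (intro cINF_greatest) auto
    then have "?E \<le> ?K * (INF \<phi>h\<in>\<Psi>h. L2_norm (laplacian (\<lambda>x. \<psi> x - \<phi>h x)))"
      unfolding pos_divide_le_eq[OF K] by (simp only: mult.commute)
    then show ?thesis unfolding Let_def using rhL eq by blast
  qed
  show ?thesis
    using R(1) inv ex1[OF closed_subspace_whole] ex1[OF \<Psi>h] fin by blast
qed

end
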